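(* Let $(z,z')$ be admissible and $t=zz'$. The restriction of the density measure $\rho^{(zz')}_1$ of $\mathcal P_{zz'}$ to $(-1,0)\cup(0,1)$ is absolutely continuous with respect to Lebesgue measure, and its density $\rho^{(zz')}_1(x)$ is real analytic on $(0,1)$ and on $(-1,0)$. For $x\in(0,1)$, $$\rho^{(zz')}_1(x)=\frac{\Gamma(t+1)}{\Gamma(z+1)\Gamma(z'+1)}\,(1-x)^{t-z-z'}\,\langle A,\Psi_x\rangle,$$ where $A(u,v)=\phi_{-z}(u)\,\phi_{-z'}(v)\,\phi_{t-2}(1-u-v)$ is a distribution concentrated on the triangle $\{u,v\ge0,\ u+v\le1\}$ and $$\Psi_x(u,v)=(1-(1-x)u)^{z}\,(1-(1-x)v)^{z'}\,(1-(1-x)(u+v))^{-t},$$ which is smooth on a neighborhood of that triangle. For $x\in(-1,0)$ the same formula holds with $x$ replaced by $|x|$ and $(z,z')$ replaced by $(-z,-z')$.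
   Context: Admissible parameters: either $z'=\bar z$, $z\notin\mathbb Z$, or $z,z'$ real in a common interval $(m,m+1)$, $m\in\mathbb Z$. $P_{zz'}$ is the spectral $z$-measure on the Thoma simplex and $\mathcal P_{zz'}$ the associated point process on $I=[-1,1]\setminus\{0\}$; its density measure is $\rho^{(zz')}_1=|x|^{-1}\sigma^{(zz')}_1|_I$, where $\sigma^{(zz')}_1$ is the unique measure on $[-1,1]$ with moments $\int x^l\sigma^{(zz')}_1(dx)=\sum_{p+q=l,\ p,q\ge0}\frac{(-1)^q\,t\,(z+1)_p(-z+1)_q(z'+1)_p(-z'+1)_q}{(t)_{p+q+1}(p+q+1)p!q!}$, $l\ge0$. For $a\in\mathbb C$, $\phi_a(u)=u_+^a/\Gamma(a+1)$, a distribution on $\mathbb R$ defined for $\operatorname{Re}a>-1$ as a function and otherwise by analytic continuation in $a$; the two-variable distribution $A$ and the pairing $\langle A,\Psi_x\rangle$ are understood by analytic continuation in the parameters from the region where $-z,-z',t-2$ (regarded as independent parameters) have positive real parts. *)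

theory Defs
  imports "HOL-Analysis.Analysis"
begin

definition admissible :: "complex \<Rightarrow> complex \<Rightarrow> bool" where
  "admissible z z' \<longleftrightarrow>
     (z' = cnj z \<and> z \<notin> \<int>) \<or>
     (z \<in> \<real> \<and> z' \<in> \<real> \<and>
      (\<exists>m::int. of_int m < Re z \<and> Re z < of_int m + 1 \<and>
                 of_int m < Re z' \<and> Re z' < of_int m + 1))"

definition sigma_moment :: "complex \<Rightarrow> complex \<Rightarrow> nat \<Rightarrow> complex" where
  "sigma_moment z z' l = (let t = z * z' in
     (\<Sum>p\<le>l. let q = l - p in
        (-1) ^ q * t * pochhammer (z + 1) p * pochhammer (- z + 1) q
          * pochhammer (z' + 1) p * pochhammer (- z' + 1) q
        / (pochhammer t (p + q + 1) * of_nat (p + q + 1) * fact p * fact q)))"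

definition sigma1 :: "complex \<Rightarrow> complex \<Rightarrow> real measure" where
  "sigma1 z z' = (THE M. sets M = sets borel \<and> finite_measure M \<and>
      emeasure M (UNIV - {-1..1}) = 0 \<and>
      (\<forall>l. complex_of_real (\<integral>x. x ^ l \<partial>M) = sigma_moment z z' l))"

definition I_set :: "real set" where
  "I_set = {-1..1} - {0}"

definition rho1 :: "complex \<Rightarrow> complex \<Rightarrow> real measure" where
  "rho1 z z' = density (sigma1 z z') (\<lambda>x. ennreal (indicator I_set x / \<bar>x\<bar>))"

text \<open>phi_a(u) = u_+^a / Gamma(a+1) (as a function, meaningful for Re a > -1).\<close>
definition phi :: "complex \<Rightarrow> real \<Rightarrow> complex" where
  "phi a u = (if u > 0 then complex_of_real u powr a / Gamma (a + 1) else 0)"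

definition triangle :: "(real \<times> real) set" where
  "triangle = {(u, v). 0 \<le> u \<and> 0 \<le> v \<and> u + v \<le> 1}"

definition Psi :: "complex \<Rightarrow> complex \<Rightarrow> complex \<Rightarrow> real \<Rightarrow> real \<times> real \<Rightarrow> complex" where
  "Psi z z' t x uv = (case uv of (u, v) \<Rightarrow>
      complex_of_real (1 - (1 - x) * u) powr z
    * complex_of_real (1 - (1 - x) * v) powr z'
    * complex_of_real (1 - (1 - x) * (u + v)) powr (- t))"

text \<open>The pairing of A_{a,b,c}(u,v) = phi_a(u) phi_b(v) phi_c(1-u-v) with a test function,
  as an honest integral over the triangle (valid for Re a, Re b, Re c > 0).\<close>
definition pairing_int :: "complex \<Rightarrow> complex \<Rightarrow> complex \<Rightarrow> (real \<times> real \<Rightarrow> complex) \<Rightarrow> complex" where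
  "pairing_int a b c F =
     (LINT uv:triangle|lborel. phi a (fst uv) * phi b (snd uv) * phi c (1 - fst uv - snd uv) * F uv)"

text \<open>G is entire in each of its three complex variables separately
  (equivalently, by Hartogs, jointly holomorphic on C^3).\<close>
definition sep_entire :: "(complex \<Rightarrow> complex \<Rightarrow> complex \<Rightarrow> complex) \<Rightarrow> bool" where
  "sep_entire G \<longleftrightarrow>
     (\<forall>b c. (\<lambda>a. G a b c) holomorphic_on UNIV) \<and>
     (\<forall>a c. (\<lambda>b. G a b c) holomorphic_on UNIV) \<and>
     (\<forall>a b. (\<lambda>c. G a b c) holomorphic_on UNIV)"

text \<open>The pairing, defined by analytic continuation in (a,b,c) from the region
  Re a, Re b, Re c > 0.\<close>
definition pairing :: "complex \<Rightarrow> complex \<Rightarrow> complex \<Rightarrow> (real \<times> real \<Rightarrow> complex) \<Rightarrow> complex" where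
  "pairing a0 b0 c0 F = (THE w. \<exists>G. sep_entire G \<and>
      (\<forall>a b c. 0 < Re a \<and> 0 < Re b \<and> 0 < Re c \<longrightarrow> G a b c = pairing_int a b c F) \<and>
      w = G a0 b0 c0)"

definition real_analytic_on :: "(real \<Rightarrow> real) \<Rightarrow> real set \<Rightarrow> bool" where
  "real_analytic_on f S \<longleftrightarrow>
     (\<forall>x\<in>S. \<exists>r>0. \<exists>c::nat \<Rightarrow> real. \<forall>y. \<bar>y - x\<bar> < r \<longrightarrow> (\<lambda>n. c n * (y - x) ^ n) sums f y)"

end

theory Submission
  imports Defs "HOL-Complex_Analysis.Complex_Analysis" "HOL-Probability.Probability" "HOL-Library.Poly_Mapping"
    "HOL-Combinatorics.Combinatorics" "HOL-Real_Asymp.Real_Asymp"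
begin

text \<open>
  Put \<open>\<kappa>(c) = (z + c) (z' + c)\<close>, which is positive at integers for admissible parameters. In the group
  algebra of the finitary symmetric group, with its trace \<open>\<tau>\<close>, the Jucys--Murphy elements \<open>J\<^sub>k\<close> are
  self-adjoint and have integer spectrum in \<open>[-k, k]\<close>, so that \<open>D = \<kappa>(J\<^sub>0) \<dots> \<kappa>(J\<^sub>n)\<close> is positive and
  \<open>p \<mapsto> \<tau>(D p(J\<^sub>n / (n + 1))) / \<tau>(D)\<close> is a probability measure on \<open>[-1, 1]\<close>. As \<open>n\<close> grows, \<open>J\<^sub>n\<^sup>l\<close> is dominated
  by \<open>(l + 1)\<close>-cycles, and the trace of the central element \<open>D\<close> against a full cycle is a sum over hooks;
  hence the moments converge to \<^const>\<open>sigma_moment\<close> and a limit measure is \<^const>\<open>sigma1\<close>.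

  On the analytic side, the Taylor expansion of \<open>\<Psi>\<^sub>x\<close> in \<open>1 - x\<close> makes the pairing a power series in
  \<open>1 - x\<close> with entire coefficients in the parameters. For \<open>\<bar>z\<bar>, \<bar>z'\<bar> < 1 < t\<close> everything is an honest positive
  integral, and in the coordinates \<open>U = (1 - x) u\<close>, \<open>V = (1 - x) v\<close> the \<open>x\<close>-integral of the claimed density
  against \<open>x\<^sup>l \<bar>x\<bar>\<close> becomes a Beta integral. The two branches \<open>x > 0\<close> and \<open>x < 0\<close> then give
  \<open>(1 - U - V)\<^sup>l\<close> on the two parts \<open>U + V < 1\<close> and \<open>U + V > 1\<close> of the unit square, and the sum factors into
  products of Beta integrals. Both sides being analytic in \<open>(z, z', t)\<close> for large \<open>l\<close>, the moments of large
  order agree with \<^const>\<open>sigma_moment\<close> at \<open>t = z z'\<close>. This determines \<open>x\<^sup>n \<sigma>\<^sub>1(dx)\<close> for some even \<open>n\<close>, hence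
  \<open>\<sigma>\<^sub>1\<close> away from \<open>0\<close>.
\<close>

section \<open>Group algebras with their trace\<close>

text \<open>\<open>sigma1\<close> is a definite description, so a measure with these moments must be
  constructed before anything can be said about it. Representation theory is replaced by the
  faithful trace: central vanishing statements follow from \<open>tau (a * star a) \<le> 0\<close>
  implying \<open>a = 0\<close>. Hooks appear because the sum of all full cycles is the product of
  \<open>JM 1\<close>, ..., \<open>JM l\<close>; this product kills every tableau with a box of
  content 0 besides the corner, that is, every shape containing a 2 by 2 square. On the analytic
  side the obstacle is that |z|, |z'| < 1 < t excludes t = z z'. Hence t is kept independent of z
  and z', and the moment identity reaches t = z z' only by continuation. The coefficients of the
  series in 1 - x grow polynomially, so termwise integration up to x = 0 needs a high power of x;
  this is why only moments of large order are compared. Evenness of that power keeps the weighted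
  measure positive.\<close>

type_synonym 'g group_alg = "'g \<Rightarrow>\<^sub>0 real"

text \<open>The product of \<open>Poly_Mapping\<close> is convolution along \<open>+\<close> of the
  keys. Groups are therefore written additively, although they are not commutative, and
  \<open>delta g * delta h\<close> is \<open>delta (g + h)\<close>.\<close>

abbreviation delta :: "'g \<Rightarrow> 'g::group_add group_alg" where
  "delta g \<equiv> Poly_Mapping.single g 1"

abbreviation sc :: "real \<Rightarrow> 'g::group_add group_alg" where
  "sc c \<equiv> Poly_Mapping.single 0 c"

lift_definition star :: "'g::group_add group_alg \<Rightarrow> 'g group_alg" is "\<lambda>f k. f (- k)"
proof -
  fix f :: "'g \<Rightarrow> real" assume "finite {x. f x \<noteq> 0}"
  then have "finite (uminus ` {x. f x \<noteq> 0})" by simp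
  moreover have "{x. f (- x) \<noteq> 0} \<subseteq> uminus ` {x. f x \<noteq> 0}"
    by (metis (mono_tags, lifting) image_eqI mem_Collect_eq minus_minus subsetI)
  ultimately show "finite {x. f (- x) \<noteq> 0}" by (rule finite_subset[rotated])
qed

definition tau :: "'g::group_add group_alg \<Rightarrow> real" where
  "tau a = Poly_Mapping.lookup a 0"

lemma poly_mapping_sum_single:
  "(\<Sum>k\<in>Poly_Mapping.keys a. Poly_Mapping.single k (Poly_Mapping.lookup a k)) = a"
proof (rule poly_mapping_eqI)
  fix k
  show "Poly_Mapping.lookup (\<Sum>k\<in>Poly_Mapping.keys a. Poly_Mapping.single k (Poly_Mapping.lookup a k)) k
      = Poly_Mapping.lookup a k"
    by (cases "k \<in> Poly_Mapping.keys a")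
       (auto simp: lookup_sum lookup_single when_def in_keys_iff)
qed

lemma group_alg_induct [case_names zero add]:
  fixes a :: "'g::group_add group_alg"
  assumes "P 0" and "\<And>k c a. P a \<Longrightarrow> P (Poly_Mapping.single k c + a)"
  shows "P a"
proof -
  have "finite F \<Longrightarrow> P (\<Sum>k\<in>F. Poly_Mapping.single k (Poly_Mapping.lookup a k))" for F
    by (induction F rule: finite_induct) (use assms in auto)
  from this[of "Poly_Mapping.keys a"] show ?thesis
    by (simp add: poly_mapping_sum_single)
qed

lemma star_0 [simp]: "star 0 = 0" by transfer simp
lemma star_add [simp]: "star (a + b) = star a + star b" by transfer simp
lemma star_diff [simp]: "star (a - b) = star a - star b"
  by (metis add_diff_cancel diff_add_cancel star_add)
lemma star_single [simp]: "star (Poly_Mapping.single k c) = Poly_Mapping.single (- k) c"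
  by transfer (auto simp: fun_eq_iff when_def minus_equation_iff)
lemma star_1 [simp]: "star 1 = 1" by (metis star_single single_one minus_zero)
lemma star_sum: "star (sum f A) = (\<Sum>x\<in>A. star (f x))"
  by (induction A rule: infinite_finite_induct) auto

lemma star_mult [simp]: "star (a * b) = star b * star a"
proof (induction a rule: group_alg_induct)
  case (add k c a)
  have "star (Poly_Mapping.single k c * b) = star b * star (Poly_Mapping.single k c)"
    by (induction b rule: group_alg_induct) (auto simp: algebra_simps mult_single minus_add)
  with add show ?case by (simp add: algebra_simps)
qed simp

lemma tau_0 [simp]: "tau 0 = 0" by (simp add: tau_def)
lemma tau_1 [simp]: "tau 1 = 1" by (simp add: tau_def)
lemma tau_add [simp]: "tau (a + b) = tau a + tau b" by (simp add: tau_def lookup_add)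
lemma tau_diff [simp]: "tau (a - b) = tau a - tau b" by (simp add: tau_def lookup_minus)
lemma tau_minus [simp]: "tau (- a) = - tau a" by (simp add: tau_def)
lemma tau_sum: "tau (sum f A) = (\<Sum>x\<in>A. tau (f x))"
  by (induction A rule: infinite_finite_induct) auto
lemma tau_single: "tau (Poly_Mapping.single k c) = (if k = 0 then c else 0)"
  by (simp add: tau_def lookup_single when_def)

lemma sc_0 [simp]: "sc 0 = 0" by simp
lemma sc_commute: "sc c * a = a * sc c"
  by (induction a rule: group_alg_induct) (auto simp: algebra_simps mult_single)

lemma tau_sc_mult [simp]: "tau (sc c * a) = c * tau a"
  by (induction a rule: group_alg_induct) (auto simp: algebra_simps mult_single tau_single)

lemma tau_mult_sc [simp]: "tau (a * sc c) = c * tau a"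
  by (metis sc_commute tau_sc_mult)

lemma tau_commute: "tau (a * b) = tau (b * a)"
proof (induction a rule: group_alg_induct)
  case (add k c a)
  have "tau (Poly_Mapping.single k c * b) = tau (b * Poly_Mapping.single k c)"
    by (induction b rule: group_alg_induct)
       (auto simp: algebra_simps mult_single tau_single,
        (metis add_eq_0_iff2 add_eq_0_iff)+)
  with add show ?case by (simp add: algebra_simps)
qed simp

lemma tau_mult_delta: "tau (a * delta k) = Poly_Mapping.lookup a (- k)"
  by (induction a rule: group_alg_induct)
     (auto simp: algebra_simps mult_single tau_single lookup_add lookup_single when_def eq_neg_iff_add_eq_0)

lemma tau_mult_star: "tau (a * star a) = (\<Sum>k\<in>Poly_Mapping.keys a. (Poly_Mapping.lookup a k)\<^sup>2)"
proof -
  have "star a = (\<Sum>k\<in>Poly_Mapping.keys a. sc (Poly_Mapping.lookup a k) * delta (- k))"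
    by (subst poly_mapping_sum_single[of a, symmetric]) (simp add: star_sum mult_single)
  then have "tau (a * star a) = (\<Sum>k\<in>Poly_Mapping.keys a. tau (a * (sc (Poly_Mapping.lookup a k) * delta (- k))))"
    by (simp only: sum_distrib_left tau_sum)
  also have "\<dots> = (\<Sum>k\<in>Poly_Mapping.keys a. tau (sc (Poly_Mapping.lookup a k) * (a * delta (- k))))"
    by (metis (no_types, lifting) mult.assoc sc_commute)
  also have "\<dots> = (\<Sum>k\<in>Poly_Mapping.keys a. (Poly_Mapping.lookup a k)\<^sup>2)"
    by (simp only: tau_sc_mult tau_mult_delta minus_minus power2_eq_square)
  finally show ?thesis .
qed

lemma tau_mult_star_nonneg: "tau (a * star a) \<ge> 0"
  unfolding tau_mult_star by (intro sum_nonneg) auto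

text \<open>The trace is faithful because \<open>tau (a * star a)\<close> is the sum of the squared
  coefficients. A typical use: a self-adjoint element whose square has trace at most 0 vanishes,
  which takes the place of the spectral theorem.\<close>

lemma tau_mult_star_eq_0: "tau (a * star a) \<le> 0 \<Longrightarrow> a = 0"
proof -
  assume "tau (a * star a) \<le> 0"
  with tau_mult_star_nonneg[of a] have "tau (a * star a) = 0" by simp
  then have "\<forall>k\<in>Poly_Mapping.keys a. (Poly_Mapping.lookup a k)\<^sup>2 = 0"
    unfolding tau_mult_star by (subst (asm) sum_nonneg_eq_0_iff) auto
  then have "Poly_Mapping.lookup a k = 0" for k by (cases "k \<in> Poly_Mapping.keys a") (auto simp: in_keys_iff)
  then show "a = 0" by (intro poly_mapping_eqI) simp
qed

section \<open>Real polynomials evaluated in a group algebra\<close>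

definition ev :: "real poly \<Rightarrow> 'g::group_add group_alg \<Rightarrow> 'g group_alg" where
  "ev p x = fold_coeffs (\<lambda>c r. sc c + x * r) p 0"

lemma ev_0 [simp]: "ev 0 x = 0" by (simp add: ev_def)

lemma ev_pCons: "ev (pCons c p) x = sc c + x * ev p x"
  by (cases "p = 0 \<and> c = 0") (auto simp: ev_def)

lemma ev_1 [simp]: "ev 1 x = 1"
  using ev_pCons[of 1 0 x] by (simp add: one_pCons)

lemma ev_lin [simp]: "ev [:c, d:] x = sc c + sc d * x"
  by (simp add: ev_pCons sc_commute)

lemma ev_add: "ev (p + q) x = ev p x + ev q x"
  by (induction p q rule: poly_induct2) (auto simp: ev_pCons single_add algebra_simps)

lemma ev_smult: "ev (smult c p) x = sc c * ev p x"
proof (induction p)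
  case (pCons a p)
  have "x * (sc c * ev p x) = sc c * (x * ev p x)"
    by (metis mult.assoc sc_commute)
  with pCons show ?case by (simp add: ev_pCons mult_single algebra_simps)
qed simp

lemma ev_minus: "ev (- p) x = - ev p x"
proof -
  have "ev (-p) x + ev p x = 0" by (simp flip: ev_add)
  then show ?thesis by (simp add: eq_neg_iff_add_eq_0)
qed

lemma ev_diff: "ev (p - q) x = ev p x - ev q x"
  using ev_add[of p "-q" x] by (simp add: ev_minus)

lemma ev_mult: "ev (p * q) x = ev p x * ev q x"
  by (induction p) (auto simp: ev_pCons ev_add ev_smult algebra_simps)

lemma ev_power: "ev (p ^ n) x = ev p x ^ n"
  by (induction n) (auto simp: ev_mult)

lemma ev_sum: "ev (sum f A) x = (\<Sum>i\<in>A. ev (f i) x)"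
  by (induction A rule: infinite_finite_induct) (auto simp: ev_add)

lemma ev_intertwine:
  assumes "f * x = y * f" shows "f * ev p x = ev p y * f"
proof (induction p)
  case (pCons a p)
  have "f * (sc a + x * ev p x) = sc a * f + (f * x) * ev p x"
    by (simp add: algebra_simps sc_commute)
  also have "\<dots> = sc a * f + y * (f * ev p x)" using assms by (simp add: mult.assoc)
  finally show ?case using pCons by (simp add: ev_pCons algebra_simps)
qed simp

lemma ev_commute_ev: "x * y = y * x \<Longrightarrow> ev p x * ev q y = ev q y * ev p x"
  by (rule ev_intertwine) (rule ev_intertwine[symmetric], simp)

lemma ev_self_commute: "x * ev p x = ev p x * x"
  by (rule ev_intertwine) simp

lemma ev_eigen:
  assumes "e * x = sc c * e" shows "e * ev p x = sc (poly p c) * e"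
proof (induction p)
  case (pCons a p)
  have "e * (sc a + x * ev p x) = sc a * e + sc c * (e * ev p x)"
    by (metis assms distrib_left mult.assoc sc_commute)
  then show ?case using pCons
    by (simp add: ev_pCons single_add distrib_right mult.assoc[symmetric] mult_single)
qed simp

lemma star_ev: "star (ev p x) = ev p (star x)"
  by (induction p) (auto simp: ev_pCons ev_self_commute)

lemma tau_star [simp]: "tau (star a) = tau a"
  unfolding tau_def by transfer simp

text \<open>The relations between two neighbouring Jucys--Murphy elements \<open>x\<close>, \<open>y\<close> and the adjacent
  transposition \<open>s\<close>.\<close>

context
  fixes x y s :: "'g::group_add group_alg"
  assumes xy: "x * y = y * x" and ss: "s * s = 1" and sx: "s * x = y * s - 1"
begin

text \<open>The intertwiner known from degenerate affine Hecke algebras. Unlike \<open>s\<close> it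
  carries \<open>x\<close> to \<open>y\<close> without a correction term, and its square is a
  polynomial in \<open>x - y\<close>.\<close>

definition "itw = s * (x - y) + 1"

lemma sy: "s * y = x * s + 1"
proof -
  have "s * (s * x) * s = s * y - s * s" unfolding sx by (simp add: algebra_simps ss)
  moreover have "s * (s * x) * s = x * s" by (simp add: mult.assoc[symmetric] ss)
  ultimately show ?thesis by (simp add: ss algebra_simps)
qed

lemma itw_alt: "itw = (y - x) * s - 1"
  unfolding itw_def right_diff_distrib sx sy by (simp add: algebra_simps)

lemma itw_x: "itw * x = y * itw"
proof -
  have 1: "itw * x = (y - x) * (s * x) - x" unfolding itw_alt by (simp add: algebra_simps)
  have 2: "(y - x) * (y * s - 1) - x = (y - x) * y * s - y" for s :: "'g group_alg"
    by (simp add: algebra_simps)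
  have 3: "(y - x) * y = y * (y - x)" by (simp add: algebra_simps xy)
  have 4: "y * (w * s - 1) = y * w * s - y" for w :: "'g group_alg" by (simp add: algebra_simps)
  show ?thesis unfolding 1 sx 2 3 unfolding itw_alt 4 by (rule refl)
qed

lemma itw_itw: "itw * itw = 1 - (x - y) * (x - y)"
proof -
  have 1: "(a - 1) * (b + 1) = a * b + a - b - 1" for a b :: "'g group_alg"
    by (simp add: algebra_simps)
  have 2: "(w * s) * (s * v) = w * v" for w v
    by (metis mult.assoc mult_1_right ss)
  have 3: "s * (x - y) = (y - x) * s - (1 + 1)"
    unfolding right_diff_distrib sx sy by (simp add: algebra_simps)
  have 4: "p + q - (q - (c + d)) - d = p + c" for p q c d :: "'g group_alg"
    by (simp add: algebra_simps)
  have "itw * itw = ((y - x) * s - 1) * (s * (x - y) + 1)"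
    by (subst (1) itw_alt, subst itw_def) (rule refl)
  then have "itw * itw = (y - x) * (x - y) + 1" unfolding 1 2 unfolding 3 4 .
  then show ?thesis by (simp add: algebra_simps)
qed

text \<open>Moving \<open>itw\<close> across turns \<open>ev p x\<close> into \<open>ev p y\<close>,
  so that \<open>e * ev p y\<close> is killed by the square of \<open>itw\<close>, which is 1 minus
  the square of \<open>x - y\<close>. Spectral information thus passes from one Jucys--Murphy
  element to the next.\<close>

lemma ev_transfer:
  assumes e: "e * s = s * e" "e * x = x * e" "e * y = y * e" "e * ev p x = 0"
  shows "e * ev p y * ((x - y) * (x - y) - 1) = 0"
proof -
  have exy: "e * (x - y) = (x - y) * e" using e by (simp add: right_diff_distrib left_diff_distrib)
  have "e * itw = (e * s) * (x - y) + e" unfolding itw_def by (simp add: distrib_left mult.assoc)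
  also have "\<dots> = s * (e * (x - y)) + e" using e by (simp add: mult.assoc)
  finally have ei: "e * itw = itw * e" unfolding exy itw_def by (simp add: distrib_right mult.assoc)
  have "e * ev p y * (itw * itw) = e * (ev p y * itw) * itw" by (simp add: mult.assoc)
  also have "ev p y * itw = itw * ev p x" by (rule ev_intertwine[OF itw_x, symmetric])
  also have "e * (itw * ev p x) * itw = itw * (e * ev p x) * itw" by (metis ei mult.assoc)
  finally have "e * ev p y * (itw * itw) = 0" using e by simp
  then show ?thesis unfolding itw_itw by (simp add: algebra_simps)
qed

text \<open>Neighbouring elements have no common eigenvalue on a common eigenvector. If
  \<open>v\<close> kills \<open>x - y\<close>, then the square of \<open>itw\<close> acts on
  \<open>v\<close> as 1; but \<open>itw\<close> is anti-self-adjoint, so positivity of the trace at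
  \<open>v * itw\<close> reads \<open>- tau (v * star v) \<ge> 0\<close>.\<close>

lemma eigen_gap:
  assumes st: "star x = x" "star y = y" "star s = s"
    and v: "v * (x - y) = 0"
  shows "v = 0"
proof (rule tau_mult_star_eq_0)
  have "star itw = (x - y) * s + 1" unfolding itw_def using st by simp
  also have "\<dots> = - ((y - x) * s - 1)" by (simp add: algebra_simps)
  finally have si: "star itw = - itw" by (simp only: itw_alt)
  have "0 \<le> tau ((v * itw) * star (v * itw))" by (rule tau_mult_star_nonneg)
  also have "(v * itw) * star (v * itw) = - (v * (itw * itw) * star v)" using si by (simp add: mult.assoc)
  also have "v * (itw * itw) = v - (v * (x - y)) * (x - y)"
    unfolding itw_itw by (simp only: right_diff_distrib[of v 1] mult_1_right mult.assoc)
  also have "\<dots> = v" using v by simp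
  finally show "tau (v * star v) \<le> 0" by simp
qed

end

section \<open>Finitary permutations and Jucys--Murphy elements\<close>

typedef fperm = "{p :: nat \<Rightarrow> nat. permutation p}" morphisms fapply Abs_fperm
  by (rule exI[of _ id]) auto

setup_lifting type_definition_fperm

instantiation fperm :: group_add
begin
lift_definition zero_fperm :: fperm is id by simp
lift_definition plus_fperm :: "fperm \<Rightarrow> fperm \<Rightarrow> fperm" is comp by (rule permutation_compose)
lift_definition uminus_fperm :: "fperm \<Rightarrow> fperm" is inv by (rule permutation_inverse)
definition minus_fperm :: "fperm \<Rightarrow> fperm \<Rightarrow> fperm" where "minus_fperm a b = a + - b"
instance
proof
  fix a b c :: fperm
  show "a + b + c = a + (b + c)" by transfer (simp add: comp_assoc)
  show "0 + a = a" by transfer simp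
  show "a + 0 = a" by transfer simp
  show "- a + a = 0" by transfer (simp add: permutation_bijective bij_is_inj)
  show "a + - b = a - b" by (simp add: minus_fperm_def)
qed
end

lift_definition transp :: "nat \<Rightarrow> nat \<Rightarrow> fperm" is "Transposition.transpose" by (rule permutation_swap_id)

lemma fapply_plus [simp]: "fapply (a + b) i = fapply a (fapply b i)" by transfer simp
lemma fapply_zero [simp]: "fapply 0 i = i" by transfer simp
lemma fapply_transp [simp]: "fapply (transp i j) = Transposition.transpose i j" by transfer simp
lemma fapply_uminus: "fapply (- a) = inv (fapply a)" by transfer simp
lemma fapply_bij: "bij (fapply a)" by transfer (simp add: permutation_bijective)
lemma fperm_eqI: "(\<And>i. fapply a i = fapply b i) \<Longrightarrow> a = b" by transfer auto
lemma fapply_eq_iff [simp]: "fapply a i = fapply a j \<longleftrightarrow> i = j"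
  using fapply_bij[of a] by (auto simp: bij_def inj_def)
lemma fapply_uminus_cancel [simp]: "fapply (- a) (fapply a i) = i" "fapply a (fapply (- a) i) = i"
  using fapply_plus[of "- a" a i] fapply_plus[of a "- a" i] by simp_all

lemma transp_add_self [simp]: "transp i j + transp i j = 0" by (rule fperm_eqI) simp
lemma uminus_transp [simp]: "- transp i j = transp i j" by (rule minus_unique) simp
lemma transp_commute: "transp i j = transp j i" by (rule fperm_eqI) (simp add: Transposition.transpose_commute)
lemma transp_conj: "g + transp i j = transp (fapply g i) (fapply g j) + g"
  by (rule fperm_eqI) (auto simp: Transposition.transpose_def)

definition Sym :: "nat \<Rightarrow> fperm set" where
  "Sym n = {p. \<forall>i\<ge>n. fapply p i = i}"

lemma Sym_0 [simp]: "0 \<in> Sym n" by (simp add: Sym_def)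
lemma Sym_add: "a \<in> Sym n \<Longrightarrow> b \<in> Sym n \<Longrightarrow> a + b \<in> Sym n" by (simp add: Sym_def)
lemma Sym_uminus: "a \<in> Sym n \<Longrightarrow> - a \<in> Sym n"
proof -
  assume a: "a \<in> Sym n"
  have "fapply (- a) i = i" if "n \<le> i" for i
  proof -
    have "fapply a i = i" using a that by (simp add: Sym_def)
    then show ?thesis by (metis fapply_uminus_cancel(1))
  qed
  then show "- a \<in> Sym n" by (simp add: Sym_def)
qed
lemma Sym_uminus_iff [simp]: "- a \<in> Sym n \<longleftrightarrow> a \<in> Sym n"
  using Sym_uminus[of a n] Sym_uminus[of "-a" n] by auto
lemma Sym_mono: "m \<le> n \<Longrightarrow> Sym m \<subseteq> Sym n" by (auto simp: Sym_def)
lemma transp_Sym: "i < n \<Longrightarrow> j < n \<Longrightarrow> transp i j \<in> Sym n" by (auto simp: Sym_def Transposition.transpose_def)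
lemma Sym_less_iff: assumes "g \<in> Sym n" shows "fapply g i < n \<longleftrightarrow> i < n"
proof
  assume "fapply g i < n" then show "i < n"
    using assms by (auto simp: Sym_def intro: ccontr)
next
  assume "i < n"
  show "fapply g i < n"
  proof (rule ccontr)
    assume "\<not> fapply g i < n"
    moreover have "\<forall>j\<ge>n. fapply (- g) j = j"
      using Sym_uminus[OF assms] by (simp only: Sym_def mem_Collect_eq)
    ultimately have "fapply (- g) (fapply g i) = fapply g i" by (simp only: not_less)
    with \<open>i < n\<close> \<open>\<not> fapply g i < n\<close> show False by simp
  qed
qed
lemma Sym_bij_betw: assumes "g \<in> Sym n" shows "bij_betw (fapply g) {..<n} {..<n}"
proof (rule bij_betwI[where g = "fapply (- g)"])
  show "fapply g \<in> {..<n} \<rightarrow> {..<n}" "fapply (- g) \<in> {..<n} \<rightarrow> {..<n}"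
    using Sym_less_iff[OF assms] Sym_less_iff[OF Sym_uminus[OF assms]] by auto
qed auto

definition galg :: "nat \<Rightarrow> fperm group_alg set" where
  "galg n = {a. Poly_Mapping.keys a \<subseteq> Sym n}"

lemma galg_0 [simp]: "0 \<in> galg n" by (simp add: galg_def)
lemma galg_single: "g \<in> Sym n \<Longrightarrow> Poly_Mapping.single g c \<in> galg n" by (simp add: galg_def)
lemma galg_sc [simp]: "sc c \<in> galg n" by (rule galg_single) simp
lemma galg_1 [simp]: "1 \<in> galg n" using galg_sc[of 1] by simp
lemma galg_add: "a \<in> galg n \<Longrightarrow> b \<in> galg n \<Longrightarrow> a + b \<in> galg n"
  unfolding galg_def using keys_add[of a b] by blast
lemma galg_mult: "a \<in> galg n \<Longrightarrow> b \<in> galg n \<Longrightarrow> a * b \<in> galg n"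
  unfolding galg_def using keys_mult[of a b] Sym_add by blast
lemma galg_sum: "(\<And>x. x \<in> A \<Longrightarrow> f x \<in> galg n) \<Longrightarrow> sum f A \<in> galg n"
  by (induction A rule: infinite_finite_induct) (auto intro: galg_add)
lemma galg_ev: "x \<in> galg n \<Longrightarrow> ev p x \<in> galg n"
  by (induction p) (auto simp: ev_pCons intro: galg_add galg_mult)
lemma galg_mono: "m \<le> n \<Longrightarrow> galg m \<subseteq> galg n" using Sym_mono by (auto simp: galg_def)

lemma galg_commuteI:
  assumes "a \<in> galg n" and "\<And>g. g \<in> Sym n \<Longrightarrow> delta g * y = y * delta g"
  shows "a * y = y * a"
proof -
  have "Poly_Mapping.single g c * y = y * Poly_Mapping.single g c" if "g \<in> Sym n" for g c
  proof -
    have "Poly_Mapping.single g c = sc c * delta g" by (simp add: mult_single)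
    then show ?thesis by (metis assms(2)[OF that] mult.assoc sc_commute)
  qed
  then have "(\<Sum>k\<in>Poly_Mapping.keys a. Poly_Mapping.single k (Poly_Mapping.lookup a k)) * y
      = y * (\<Sum>k\<in>Poly_Mapping.keys a. Poly_Mapping.single k (Poly_Mapping.lookup a k))"
    unfolding sum_distrib_left sum_distrib_right
    using assms(1) by (intro sum.cong) (auto simp: galg_def)
  then show ?thesis by (simp add: poly_mapping_sum_single)
qed

text \<open>Points are numbered from 0, so \<open>JM k\<close> belongs to the box filled (k+1)-st in
  a standard Young tableau, and its eigenvalues are the possible contents of that box.\<close>

definition JM :: "nat \<Rightarrow> fperm group_alg" where
  "JM k = (\<Sum>i<k. delta (transp i k))"

definition adj :: "nat \<Rightarrow> fperm group_alg" where
  "adj k = delta (transp k (Suc k))"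

lemma JM_0 [simp]: "JM 0 = 0" by (simp add: JM_def)
lemma star_JM [simp]: "star (JM k) = JM k" by (simp add: JM_def star_sum)
lemma star_adj [simp]: "star (adj k) = adj k" by (simp add: adj_def)
lemma JM_galg: "k < n \<Longrightarrow> JM k \<in> galg n"
  unfolding JM_def by (intro galg_sum galg_single transp_Sym) auto
lemma adj_galg: "Suc k < n \<Longrightarrow> adj k \<in> galg n"
  unfolding adj_def by (intro galg_single transp_Sym) auto

text \<open>Conjugation by a permutation of the points below \<open>k\<close> only permutes the
  transpositions that make up \<open>JM k\<close>.\<close>

lemma delta_JM: "g \<in> Sym k \<Longrightarrow> delta g * JM k = JM k * delta g"
proof -
  assume g: "g \<in> Sym k"
  then have gk: "fapply g k = k" by (simp add: Sym_def)
  have "delta g * JM k = (\<Sum>i<k. delta (transp (fapply g i) k + g))"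
    unfolding JM_def sum_distrib_left by (simp add: mult_single transp_conj gk)
  also have "\<dots> = (\<Sum>i<k. delta (transp i k + g))"
    by (rule sum.reindex_bij_betw[OF Sym_bij_betw[OF g]])
  finally show ?thesis unfolding JM_def sum_distrib_right by (simp add: mult_single)
qed

lemma galg_JM_commute: "a \<in> galg k \<Longrightarrow> a * JM k = JM k * a"
  by (rule galg_commuteI) (auto intro: delta_JM)

lemma galg_adj_commute: "a \<in> galg k \<Longrightarrow> a * adj k = adj k * a"
proof (rule galg_commuteI)
  fix g assume "g \<in> Sym k"
  then show "delta g * adj k = adj k * delta g"
    by (simp add: adj_def mult_single transp_conj Sym_def)
qed

lemma JM_commute: "JM i * JM j = JM j * JM i"
proof (cases i j rule: linorder_cases)
  case less then show ?thesis by (intro galg_JM_commute JM_galg)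
next
  case greater then show ?thesis by (intro galg_JM_commute[symmetric] JM_galg)
qed simp

lemma adj_adj [simp]: "adj k * adj k = 1"
  by (simp add: adj_def mult_single)

lemma adj_JM: "adj k * JM k = JM (Suc k) * adj k - 1"
proof -
  have *: "transp k (Suc k) + transp i k = transp i (Suc k) + transp k (Suc k)" if "i < k" for i
    by (rule fperm_eqI) (use that in \<open>auto simp: Transposition.transpose_def\<close>)
  have "adj k * JM k = (\<Sum>i<k. delta (transp k (Suc k) + transp i k))"
    unfolding JM_def sum_distrib_left adj_def by (simp add: mult_single)
  also have "\<dots> = (\<Sum>i<k. delta (transp i (Suc k) + transp k (Suc k)))"
    by (intro sum.cong refl) (simp add: *)
  finally have "adj k * JM k = (\<Sum>i<k. delta (transp i (Suc k) + transp k (Suc k)))" .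
  moreover have "JM (Suc k) * adj k = (\<Sum>i<k. delta (transp i (Suc k) + transp k (Suc k))) + 1"
    unfolding JM_def adj_def by (simp add: sum_distrib_right distrib_right mult_single)
  ultimately show ?thesis by simp
qed

lemmas JM_transfer = ev_transfer[OF JM_commute adj_adj adj_JM]
lemmas JM_gap = eigen_gap[OF JM_commute adj_adj adj_JM star_JM star_JM star_adj]

section \<open>Spectral calculus through Lagrange interpolation\<close>

definition lin :: "real \<Rightarrow> real poly" where "lin c = [:- c, 1:]"

lemma poly_lin [simp]: "poly (lin c) x = x - c" by (simp add: lin_def)

lemma ev_linear [simp]: "ev (lin c) x = x - sc c"
  by (simp add: lin_def single_uminus)

definition nodal :: "real set \<Rightarrow> real poly" where "nodal C = (\<Prod>c\<in>C. lin c)"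

text \<open>The Lagrange basis polynomial of the node \<open>c\<close>. At an element annihilated by
  \<open>nodal C\<close> it evaluates to the spectral projection for the eigenvalue
  \<open>c\<close>.\<close>

definition lagr :: "real set \<Rightarrow> real \<Rightarrow> real poly" where
  "lagr C c = smult (1 / (\<Prod>d\<in>C-{c}. c - d)) (nodal (C - {c}))"

lemma poly_nodal: "poly (nodal C) x = (\<Prod>c\<in>C. x - c)"
  by (simp add: nodal_def poly_prod)

lemma poly_lagr:
  assumes "finite C" "c \<in> C" "d \<in> C"
  shows "poly (lagr C c) d = (if d = c then 1 else 0)"
  using assms by (auto simp: lagr_def poly_nodal)

lemma degree_nodal: "finite C \<Longrightarrow> degree (nodal C) = card C"
  unfolding nodal_def by (subst degree_prod_eq_sum_degree) (auto simp: lin_def)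

lemma sum_lagr:
  assumes C: "finite C" "C \<noteq> {}"
  shows "(\<Sum>c\<in>C. lagr C c) = 1"
proof (rule poly_eqI_degree[of C])
  fix x assume x: "x \<in> C"
  then have "poly (\<Sum>c\<in>C. lagr C c) x = (\<Sum>c\<in>C. if x = c then 1 else 0)"
    unfolding poly_sum using C by (intro sum.cong refl poly_lagr) auto
  then show "poly (\<Sum>c\<in>C. lagr C c) x = poly 1 x" using x C by simp
next
  have "degree (\<Sum>c\<in>C. lagr C c) \<le> card C - 1"
  proof (rule degree_sum_le)
    fix c assume "c \<in> C"
    then show "degree (lagr C c) \<le> card C - 1"
      using C degree_smult_le[of _ "nodal (C - {c})"] degree_nodal[of "C - {c}"] by (simp add: lagr_def)
  qed (use C in auto)
  moreover have "card C > 0" using C by (simp add: card_gt_0_iff)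
  ultimately show "degree (\<Sum>c\<in>C. lagr C c) < card C" by simp
  show "degree (1 :: real poly) < card C" using \<open>card C > 0\<close> by simp
qed

lemma nodal_split: "finite C \<Longrightarrow> c \<in> C \<Longrightarrow> nodal C = lin c * nodal (C - {c})"
  by (simp add: nodal_def prod.remove)

context
  fixes C :: "real set" and x :: "'g::group_add group_alg"
  assumes C: "finite C" "C \<noteq> {}" and ann: "ev (nodal C) x = 0"
begin

lemma sum_ev_lagr: "(\<Sum>c\<in>C. ev (lagr C c) x) = 1"
  using sum_lagr[OF C] by (simp flip: ev_sum)

lemma lagr_eigen:
  assumes "c \<in> C" shows "ev (lagr C c) x * x = sc c * ev (lagr C c) x"
proof -
  have "ev (lin c * lagr C c) x = 0"
    using ann nodal_split[of C c] C assms by (simp add: lagr_def ev_smult)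
  then have "x * ev (lagr C c) x - sc c * ev (lagr C c) x = 0"
    by (simp add: ev_mult left_diff_distrib)
  then show ?thesis by (simp add: ev_self_commute)
qed

lemma lagr_ev: "c \<in> C \<Longrightarrow> ev (lagr C c) x * ev p x = sc (poly p c) * ev (lagr C c) x"
  by (rule ev_eigen[OF lagr_eigen])

lemma ev_eq_sum_lagr: "ev p x = (\<Sum>c\<in>C. sc (poly p c) * ev (lagr C c) x)"
proof -
  have "ev p x = (\<Sum>c\<in>C. ev (lagr C c) x) * ev p x" by (simp add: sum_ev_lagr)
  also have "\<dots> = (\<Sum>c\<in>C. sc (poly p c) * ev (lagr C c) x)"
    unfolding sum_distrib_right by (intro sum.cong refl lagr_ev)
  finally show ?thesis .
qed

lemma ev_cong: assumes "\<And>c. c \<in> C \<Longrightarrow> poly p c = poly q c" shows "ev p x = ev q x"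
proof -
  have "(\<Sum>c\<in>C. sc (poly p c) * ev (lagr C c) x) = (\<Sum>c\<in>C. sc (poly q c) * ev (lagr C c) x)"
    by (intro sum.cong refl) (simp add: assms)
  then show ?thesis by (metis ev_eq_sum_lagr)
qed

end

section \<open>Integer spectrum of the Jucys--Murphy elements\<close>

definition iset :: "nat \<Rightarrow> real set" where
  "iset k = real_of_int ` {- int k..int k}"

lemma iset_finite [simp]: "finite (iset k)" and iset_ne [simp]: "iset k \<noteq> {}"
  by (auto simp: iset_def)

lemma iset_iff: "real_of_int m \<in> iset k \<longleftrightarrow> \<bar>m\<bar> \<le> int k"
  unfolding iset_def by (subst inj_image_mem_iff) (auto simp: inj_def)

lemma nodal_dvd: "A \<subseteq> B \<Longrightarrow> finite B \<Longrightarrow> nodal A dvd nodal B"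
  unfolding nodal_def by (rule prod_dvd_prod_subset)

text \<open>Where \<open>x\<close> acts as \<open>c\<close>, the factor produced by
  \<open>ev_transfer\<close> becomes (y - c - 1)(y - c + 1): the contents \<open>c + 1\<close> and
  \<open>c - 1\<close> of the boxes adjacent to one of content \<open>c\<close>.\<close>

lemma diff_sq_eigen:
  fixes e x y :: "'g::group_add group_alg"
  assumes "e * x = sc c * e" and "x * y = y * x"
  shows "e * ((x - y) * (x - y) - 1) = e * ev (lin (c + 1) * lin (c - 1)) y"
proof -
  have 1: "e * (x - y) = e * (sc c - y)" using assms(1) by (simp add: right_diff_distrib sc_commute)
  have "e * ((x - y) * (x - y)) = e * (sc c - y) * (x - y)" by (simp add: 1 mult.assoc[symmetric])
  also have "\<dots> = e * ((sc c - y) * (x - y))" by (simp add: mult.assoc)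
  also have "(sc c - y) * (x - y) = (x - y) * (sc c - y)"
    using assms(2) by (simp add: algebra_simps sc_commute)
  also have "e * ((x - y) * (sc c - y)) = e * ((sc c - y) * (sc c - y))"
    using 1 by (simp add: mult.assoc[symmetric])
  finally have "e * ((x - y) * (x - y) - 1) = e * ((sc c - y) * (sc c - y) - 1)"
    by (simp add: right_diff_distrib)
  also have "(sc c - y) * (sc c - y) - 1 = ev (lin (c + 1) * lin (c - 1)) y"
  proof -
    have "ev (lin (c + 1) * lin (c - 1)) y = (y - sc c - 1) * (y - sc c + 1)"
      by (simp add: ev_mult single_add single_diff diff_diff_eq2 diff_diff_eq add_diff_eq diff_add_eq)
    also have "\<dots> = (y - sc c) * (y - sc c) - 1" by (simp add: algebra_simps)
    finally show ?thesis by (simp add: algebra_simps)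
  qed
  finally show ?thesis .
qed

text \<open>On the \<open>c\<close>-eigenspace of \<open>JM k\<close>, \<open>ev_transfer\<close>
  allows \<open>JM (Suc k)\<close> only the old eigenvalues and \<open>c + 1\<close>,
  \<open>c - 1\<close>, all of which lie in the enlarged range. The projections onto the eigenspaces
  sum to 1, so the local statements combine.\<close>

theorem JM_annihilator: "ev (nodal (iset k)) (JM k) = 0"
proof (induction k)
  case 0
  then show ?case by (simp add: iset_def nodal_def lin_def)
next
  case (Suc k)
  define x y where "x = JM k" and "y = JM (Suc k)"
  define P P' where "P = nodal (iset k)" and "P' = nodal (iset (Suc k))"
  have xy: "x * y = y * x" unfolding x_def y_def by (rule JM_commute)
  have 1: "ev P y * ((x - y) * (x - y) - 1) = 0"
    using JM_transfer[of 1 k P] Suc by (simp add: x_def y_def P_def)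
  have "ev (lagr (iset k) c) x * ev P' y = 0" (is "?a = 0") if c: "c \<in> iset k" for c
  proof -
    define e where "e = ev (lagr (iset k) c) x"
    have ex: "e * x = sc c * e"
      unfolding e_def by (rule lagr_eigen) (use Suc c in \<open>auto simp: x_def\<close>)
    have ee: "e * ev p y = ev p y * e" for p unfolding e_def by (rule ev_commute_ev[OF xy])
    obtain m where m: "c = of_int m" "\<bar>m\<bar> \<le> int k" using c by (auto simp: iset_def)
    have "nodal {c + 1, c - 1} dvd P'" unfolding P'_def
      by (rule nodal_dvd) (use m in \<open>auto simp: iset_iff[of "m+1", simplified] iset_iff[of "m-1", simplified]\<close>)
    moreover have "nodal {c + 1, c - 1} = lin (c + 1) * lin (c - 1)" by (simp add: nodal_def)
    moreover have "P dvd P'" unfolding P_def P'_def by (rule nodal_dvd) (auto simp: iset_def)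
    \<comment> \<open>\<open>P\<close> may already have \<open>c + 1\<close> or \<open>c - 1\<close>
      as a root, so the product need not divide \<open>P'\<close> itself. Its dividing the square of
      \<open>P'\<close> suffices, because \<open>e * ev P' y\<close> is self-adjoint and vanishes
      with its square.\<close>
    ultimately have "P * (lin (c + 1) * lin (c - 1)) dvd P' * P'" by (metis mult_dvd_mono)
    then obtain R where R: "P' * P' = P * (lin (c + 1) * lin (c - 1)) * R" by (auto simp: dvd_def)
    have "e * ev (P * (lin (c + 1) * lin (c - 1))) y = ev P y * (e * ev (lin (c + 1) * lin (c - 1)) y)"
      by (metis ee ev_mult mult.assoc)
    also have "\<dots> = ev P y * (e * ((x - y) * (x - y) - 1))" by (simp add: diff_sq_eigen[OF ex xy])
    also have "\<dots> = e * (ev P y * ((x - y) * (x - y) - 1))" by (metis ee mult.assoc)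
    finally have 2: "e * ev (P' * P') y = 0" unfolding R ev_mult[of _ R] by (simp add: mult.assoc[symmetric] 1)
    have "star (e * ev P' y) = e * ev P' y"
      using ee[of P'] by (simp add: e_def star_ev x_def y_def)
    then have "(e * ev P' y) * star (e * ev P' y) = e * (e * ev (P' * P') y)"
      by (simp add: ee ev_mult) (metis ee mult.assoc)
    then have "tau ((e * ev P' y) * star (e * ev P' y)) \<le> 0" using 2 by simp
    from tau_mult_star_eq_0[OF this] show ?thesis by (simp add: e_def)
  qed
  then have "(\<Sum>c\<in>iset k. ev (lagr (iset k) c) x) * ev P' y = 0"
    by (simp add: sum_distrib_right)
  then show ?case using sum_ev_lagr[of "iset k" x] Suc by (simp add: x_def y_def P'_def)
qed

lemmas JM_lagr_ev = lagr_ev[OF iset_finite iset_ne JM_annihilator]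
lemmas JM_ev_cong = ev_cong[OF iset_finite iset_ne JM_annihilator]
lemmas JM_ev_eq = ev_eq_sum_lagr[OF iset_finite iset_ne JM_annihilator]

section \<open>Products over all Jucys--Murphy elements and traces of small powers\<close>

primrec JMprod :: "(nat \<Rightarrow> real poly) \<Rightarrow> nat \<Rightarrow> fperm group_alg" where
  "JMprod f 0 = 1"
| "JMprod f (Suc n) = JMprod f n * ev (f n) (JM n)"

lemma JMprod_galg: "JMprod f n \<in> galg n"
proof (induction n)
  case (Suc n)
  have "JMprod f n \<in> galg (Suc n)" using galg_mono[of n "Suc n"] Suc by auto
  then show ?case by (auto intro!: galg_mult galg_ev JM_galg)
qed simp

lemma JMprod_commute_ev: "JMprod f n * ev p (JM n) = ev p (JM n) * JMprod f n"
  by (rule ev_intertwine) (rule galg_JM_commute[OF JMprod_galg])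

lemma star_JMprod [simp]: "star (JMprod f n) = JMprod f n"
  by (induction n) (auto simp: star_ev JMprod_commute_ev)

lemma JMprod_mult: "JMprod f n * JMprod g n = JMprod (\<lambda>k. f k * g k) n"
proof (induction n)
  case (Suc n)
  have "JMprod f n * ev (f n) (JM n) * (JMprod g n * ev (g n) (JM n))
      = JMprod f n * (JMprod g n * ev (f n) (JM n)) * ev (g n) (JM n)"
    by (metis JMprod_commute_ev mult.assoc)
  then show ?case using Suc by (simp add: ev_mult mult.assoc[symmetric])
qed simp

lemma JMprod_cong:
  assumes "\<And>k c. k < n \<Longrightarrow> c \<in> iset k \<Longrightarrow> poly (f k) c = poly (g k) c"
  shows "JMprod f n = JMprod g n"
  using assms
proof (induction n)
  case (Suc n)
  then have "ev (f n) (JM n) = ev (g n) (JM n)" by (intro JM_ev_cong) auto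
  with Suc show ?case by auto
qed simp

lemma poly_interp:
  assumes "finite C" "c \<in> C"
  shows "poly (\<Sum>d\<in>C. smult (h d) (lagr C d)) c = h c"
proof -
  have "poly (\<Sum>d\<in>C. smult (h d) (lagr C d)) c = (\<Sum>d\<in>C. if c = d then h d else 0)"
    unfolding poly_sum using assms by (intro sum.cong refl) (auto simp: poly_lagr)
  then show ?thesis using assms by simp
qed

text \<open>Only the values of the k-th factor on \<open>iset k\<close> matter, and there
  \<open>\<kappa>\<close> is nonnegative; so its square root is interpolated at those nodes. The
  interpolant depends on \<open>k\<close>, which is why \<open>JMprod\<close> takes a family of
  polynomials.\<close>

lemma JMprod_sqrt:
  assumes "\<And>m::int. poly \<kappa> (of_int m) \<ge> 0"
  obtains r where "JMprod (\<lambda>_. \<kappa>) n = JMprod r n * JMprod r n"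
proof
  let ?r = "\<lambda>k. \<Sum>d\<in>iset k. smult (sqrt (poly \<kappa> d)) (lagr (iset k) d)"
  have "JMprod ?r n * JMprod ?r n = JMprod (\<lambda>k. ?r k * ?r k) n" by (rule JMprod_mult)
  also have "\<dots> = JMprod (\<lambda>_. \<kappa>) n"
    by (intro JMprod_cong) (use assms in \<open>auto simp only: poly_mult poly_interp[OF iset_finite], auto simp: iset_def\<close>)
  finally show "JMprod (\<lambda>_. \<kappa>) n = JMprod ?r n * JMprod ?r n" by simp
qed

text \<open>The support of \<open>a\<close> lies in the subgroup \<open>Sym n\<close>, so a
  permutation outside of it never meets an inverse there. In the following moments of
  \<open>JM n\<close> only the words that fix the point \<open>n\<close> survive.\<close>

lemma tau_galg_delta: "a \<in> galg n \<Longrightarrow> g \<notin> Sym n \<Longrightarrow> tau (a * delta g) = 0"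
  unfolding tau_mult_delta galg_def by (metis (mono_tags) Sym_uminus_iff in_keys_iff mem_Collect_eq subsetD)

lemma notin_SymI: "n \<le> i \<Longrightarrow> fapply g i \<noteq> i \<Longrightarrow> g \<notin> Sym n" by (auto simp: Sym_def)

lemma tau_JM1:
  assumes "a \<in> galg n" shows "tau (a * JM n) = 0"
  unfolding JM_def sum_distrib_left tau_sum
  by (intro sum.neutral ballI tau_galg_delta[OF assms] notin_SymI[of n n]) auto

text \<open>A product of two transpositions (i n)(j n) fixes \<open>n\<close> only for
  \<open>i = j\<close>, and then it is the identity.\<close>

lemma tau_JM2:
  assumes "a \<in> galg n" shows "tau (a * (JM n * JM n)) = n * tau a"
proof -
  have "tau (a * (JM n * JM n)) = (\<Sum>i<n. \<Sum>j<n. tau (a * delta (transp i n + transp j n)))"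
    unfolding JM_def sum_product by (simp add: sum_distrib_left tau_sum mult_single)
  also have "\<dots> = (\<Sum>i<n. \<Sum>j<n. if i = j then tau a else 0)"
  proof (intro sum.cong refl)
    fix i j assume ij: "i \<in> {..<n}" "j \<in> {..<n}"
    show "tau (a * delta (transp i n + transp j n)) = (if i = j then tau a else 0)"
    proof (cases "i = j")
      case False
      then show ?thesis using ij
        by (simp, intro tau_galg_delta[OF assms] notin_SymI[of n n]) (auto simp: Transposition.transpose_def)
    qed simp
  qed
  also have "\<dots> = n * tau a" by simp
  finally show ?thesis .
qed

lemma sum_triple_rev:
  "(\<Sum>x\<in>A. \<Sum>y\<in>A. \<Sum>z\<in>A. F z y x) = (\<Sum>x\<in>A. \<Sum>y\<in>A. \<Sum>z\<in>A. F x y z)"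
proof -
  have "(\<Sum>x\<in>A. \<Sum>y\<in>A. \<Sum>z\<in>A. F z y x) = (\<Sum>y\<in>A. \<Sum>x\<in>A. \<Sum>z\<in>A. F z y x)"
    by (rule sum.swap)
  also have "\<dots> = (\<Sum>y\<in>A. \<Sum>z\<in>A. \<Sum>x\<in>A. F z y x)"
    by (intro sum.cong refl sum.swap)
  also have "\<dots> = (\<Sum>z\<in>A. \<Sum>y\<in>A. \<Sum>x\<in>A. F z y x)"
    by (rule sum.swap)
  finally show ?thesis .
qed

text \<open>The word (i n)(j n)(k n) fixes \<open>n\<close> only if \<open>i = k\<close> and
  \<open>j \<noteq> k\<close>, and then it equals (j k). Each transposition below \<open>n\<close>
  therefore occurs twice, and together these form the sum of all earlier Jucys--Murphy
  elements.\<close>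

lemma tau_JM3:
  assumes "a \<in> galg n" shows "tau (a * (JM n * (JM n * JM n))) = 2 * (\<Sum>k<n. tau (a * JM k))"
proof -
  have 1: "tau (a * delta (transp i n + (transp j n + transp k n))) =
      (if i = k \<and> j \<noteq> k then tau (a * delta (transp j k)) else 0)" if ij: "i < n" "j < n" "k < n" for i j k
  proof (cases "i = k \<and> j \<noteq> k")
    case True
    then have "transp i n + (transp j n + transp k n) = transp j k"
      by (intro fperm_eqI) (use ij in \<open>auto simp: Transposition.transpose_def\<close>)
    then show ?thesis using True by simp
  next
    case False
    then have "fapply (transp i n + (transp j n + transp k n)) n \<noteq> n"
      using ij by (auto simp: Transposition.transpose_def)
    then show ?thesis using False using tau_galg_delta[OF assms notin_SymI[OF le_refl]]
      by presburger
  qed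
  have "tau (a * (JM n * (JM n * JM n))) =
      (\<Sum>i<n. \<Sum>j<n. \<Sum>k<n. tau (a * delta (transp i n + (transp j n + transp k n))))"
    unfolding JM_def by (simp add: sum_distrib_left sum_distrib_right tau_sum mult_single)
      (rule sum_triple_rev)
  also have "\<dots> = (\<Sum>i<n. \<Sum>j<n. \<Sum>k<n. if i = k \<and> j \<noteq> k then tau (a * delta (transp j k)) else 0)"
    by (intro sum.cong refl 1) auto
  also have "\<dots> = (\<Sum>i<n. \<Sum>j<n. if j \<noteq> i then tau (a * delta (transp j i)) else 0)"
  proof (intro sum.cong refl)
    fix i j assume "i \<in> {..<n}" "j \<in> {..<n}"
    have "(\<Sum>k<n. if i = k \<and> j \<noteq> k then tau (a * delta (transp j k)) else 0) =
       (\<Sum>k<n. if k = i then (if j \<noteq> i then tau (a * delta (transp j i)) else 0) else 0)"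
      by (intro sum.cong) auto
    then show "(\<Sum>k<n. if i = k \<and> j \<noteq> k then tau (a * delta (transp j k)) else 0) =
       (if j \<noteq> i then tau (a * delta (transp j i)) else 0)" using \<open>i \<in> _\<close> by simp
  qed
  also have "\<dots> = (\<Sum>i<n. \<Sum>j<n. (if j < i then tau (a * delta (transp j i)) else 0) + (if i < j then tau (a * delta (transp j i)) else 0))"
    by (intro sum.cong refl) auto
  also have "\<dots> = (\<Sum>i<n. \<Sum>j<n. if j < i then tau (a * delta (transp j i)) else 0)
     + (\<Sum>i<n. \<Sum>j<n. if i < j then tau (a * delta (transp j i)) else 0)"
    by (simp add: sum.distrib)
  also have "(\<Sum>i<n. \<Sum>j<n. if i < j then tau (a * delta (transp j i)) else 0)
     = (\<Sum>i<n. \<Sum>j<n. if j < i then tau (a * delta (transp j i)) else 0)"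
    by (subst sum.swap) (simp only: transp_commute)
  also have "(\<Sum>i<n. \<Sum>j<n. if j < i then tau (a * delta (transp j i)) else 0) = (\<Sum>k<n. tau (a * JM k))"
  proof (intro sum.cong refl)
    fix i assume "i \<in> {..<n}"
    then have "{..<n} \<inter> {j. j < i} = {..<i}" by auto
    then show "(\<Sum>j<n. if j < i then tau (a * delta (transp j i)) else 0) = tau (a * JM i)"
      by (simp add: sum.If_cases JM_def sum_distrib_left tau_sum)
  qed
  finally show ?thesis by simp
qed

section \<open>Centrality of the product of one polynomial over all Jucys--Murphy elements\<close>

lemma delta_add: "delta (g + h) = delta g * delta h" by (simp add: mult_single)

text \<open>The symmetric product commutes with the intertwiner, which exchanges its two factors,
  and also with \<open>x - y\<close>. Hence its commutator with the transposition is killed by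
  \<open>x - y\<close>, and \<open>JM_gap\<close> makes that commutator vanish.\<close>

lemma adj_commute_sym:
  "adj k * (ev p (JM k) * ev p (JM (Suc k))) = (ev p (JM k) * ev p (JM (Suc k))) * adj k"
proof -
  define x y where "x = JM k" and "y = JM (Suc k)"
  define S w where "S = ev p x * ev p y" and "w = itw x y (adj k)"
  have w: "w = adj k * (x - y) + 1"
    unfolding w_def x_def y_def by (rule itw_def[OF JM_commute adj_adj adj_JM])
  have wx: "w * x = y * w" unfolding w_def x_def y_def by (rule itw_x[OF JM_commute adj_adj adj_JM])
  have "w = (y - x) * adj k - 1" 
    unfolding w_def x_def y_def by (rule itw_alt[OF JM_commute adj_adj adj_JM])
  then have sw: "star w = - w" unfolding w by (simp add: x_def y_def algebra_simps)
  have "star (w * x) = star (y * w)" by (simp only: wx)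
  then have wy: "w * y = x * w" by (simp add: sw) (simp add: x_def y_def)
  have xy: "x * y = y * x" unfolding x_def y_def by (rule JM_commute)
  have "w * S = ev p y * (w * ev p y)"
    unfolding S_def by (simp only: mult.assoc[symmetric] ev_intertwine[OF wx])
  also have "\<dots> = ev p y * (ev p x * w)" by (simp only: ev_intertwine[OF wy])
  also have "\<dots> = S * w" unfolding S_def by (simp only: mult.assoc[symmetric] ev_commute_ev[OF xy])
  finally have "w * S = S * w" .
  then have 1: "adj k * ((x - y) * S) = S * (adj k * (x - y))"
    unfolding w by (simp add: distrib_left distrib_right mult.assoc)
  have "x * S = S * x" "y * S = S * y" unfolding S_def
    by (simp_all only: mult.assoc[symmetric] ev_self_commute ev_intertwine[OF xy] ev_intertwine[OF xy[symmetric]])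
       (simp_all only: mult.assoc ev_self_commute ev_intertwine[OF xy] ev_intertwine[OF xy[symmetric]])
  then have "(x - y) * S = S * (x - y)" by (simp add: left_diff_distrib right_diff_distrib)
  with 1 have "(adj k * S - S * adj k) * (x - y) = 0"
    by (simp add: left_diff_distrib mult.assoc)
  then have "adj k * S - S * adj k = 0" unfolding x_def y_def by (rule JM_gap)
  then show ?thesis by (simp add: S_def x_def y_def)
qed

lemma adj_JMprod: "Suc k < n \<Longrightarrow> adj k * JMprod (\<lambda>_. p) n = JMprod (\<lambda>_. p) n * adj k"
proof (induction n)
  case (Suc n)
  show ?case
  proof (cases "Suc k = n")
    case True
    have 1: "JMprod (\<lambda>_. p) k * adj k = adj k * JMprod (\<lambda>_. p) k"
      by (rule galg_adj_commute[OF JMprod_galg])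
    have "adj k * JMprod (\<lambda>_. p) (Suc n) = JMprod (\<lambda>_. p) k * (adj k * (ev p (JM k) * ev p (JM (Suc k))))"
      unfolding True[symmetric] by (simp add: mult.assoc[symmetric] 1)
    then show ?thesis
      unfolding adj_commute_sym unfolding True[symmetric] by (simp add: mult.assoc)
  next
    case False
    then have k: "Suc k < n" using Suc by simp
    have "adj k * JM n = JM n * adj k" by (rule galg_JM_commute[OF adj_galg[OF k]])
    then have 1: "adj k * ev p (JM n) = ev p (JM n) * adj k" by (rule ev_intertwine)
    have "adj k * JMprod (\<lambda>_. p) (Suc n) = JMprod (\<lambda>_. p) n * (adj k * ev p (JM n))"
      using Suc.IH[OF k] by (simp add: mult.assoc[symmetric])
    then show ?thesis by (simp add: 1 mult.assoc)
  qed
qed simp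

lemma commute_mult: 
  fixes a b d :: "'a::semigroup_mult"
  shows "a * d = d * a \<Longrightarrow> b * d = d * b \<Longrightarrow> (a * b) * d = d * (a * b)"
  by (metis mult.assoc)

lemma transp_JMprod:
  assumes "i < j" "j < n"
  shows "delta (transp i j) * JMprod (\<lambda>_. p) n = JMprod (\<lambda>_. p) n * delta (transp i j)"
  using assms
proof (induction j)
  case (Suc j)
  have a: "delta (transp j (Suc j)) * JMprod (\<lambda>_. p) n = JMprod (\<lambda>_. p) n * delta (transp j (Suc j))"
    using adj_JMprod[of j n p] Suc.prems by (simp add: adj_def)
  show ?case
  proof (cases "i = j")
    case False
    then have i: "i < j" using Suc by simp
    have "transp i (Suc j) = transp j (Suc j) + (transp i j + transp j (Suc j))"
      using i by (intro fperm_eqI) (auto simp: Transposition.transpose_def)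
    then show ?thesis unfolding \<open>transp i (Suc j) = _\<close> delta_add
      using Suc i by (intro commute_mult a) auto
  qed (use a in simp)
qed simp

lemma Sym_induct [consumes 1, case_names zero transp]:
  assumes g: "g \<in> Sym n" and z: "P 0"
    and t: "\<And>a b g. a < b \<Longrightarrow> b < n \<Longrightarrow> P g \<Longrightarrow> P (transp a b + g)"
  shows "P g"
proof -
  have "fapply g permutes {..<n}"
    using fapply_bij[of g] g unfolding permutes_def Sym_def bij_iff by auto
  from this finite_lessThan[of n] have "\<forall>h. fapply h = fapply g \<longrightarrow> P h"
  proof (induction rule: permutes_induct)
    case id
    show ?case using z by (metis (mono_tags) fapply_zero fperm_eqI id_apply)
  next
    case (swap a b p)
    show ?case
    proof (intro allI impI)
      fix h assume h: "fapply h = Transposition.transpose a b \<circ> p"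
      have "fapply (transp a b + h) = p" by (rule ext) (simp add: h)
      with swap have "P (transp a b + h)" by blast
      then have "P (transp (min a b) (max a b) + (transp a b + h))"
        using swap by (intro t[OF _ _ \<open>P (transp a b + h)\<close>]) auto
      moreover have "transp (min a b) (max a b) = transp a b"
        by (cases "a \<le> b") (auto simp: min_def max_def transp_commute)
      ultimately show "P h" by (simp add: add.assoc[symmetric])
    qed
  qed
  then show ?thesis by simp
qed

text \<open>Adjacent transpositions commute with the product by the case of two neighbouring
  factors, and they generate \<open>Sym n\<close>. This is an instance of Jucys' theorem on
  symmetric polynomials.\<close>

theorem JMprod_central:
  assumes "g \<in> Sym n"
  shows "delta g * JMprod (\<lambda>_. p) n = JMprod (\<lambda>_. p) n * delta g"
  using assms
proof (induction rule: Sym_induct)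
  case (transp a b g)
  then show ?case unfolding delta_add by (intro commute_mult transp_JMprod)
qed simp

lemma tau_JMprod_conj:
  assumes "h \<in> Sym n"
  shows "tau (JMprod (\<lambda>_. p) n * delta (h + g - h)) = tau (JMprod (\<lambda>_. p) n * delta g)"
proof -
  have "tau (JMprod (\<lambda>_. p) n * delta (h + g - h)) = tau (JMprod (\<lambda>_. p) n * (delta h * delta g * delta (- h)))"
    by (simp add: mult_single)
  also have "\<dots> = tau ((delta h * JMprod (\<lambda>_. p) n) * delta g * delta (- h))"
    by (simp only: JMprod_central[OF assms] mult.assoc)
  also have "\<dots> = tau (delta (- h) * (delta h * JMprod (\<lambda>_. p) n) * delta g)"
    by (subst tau_commute) (simp only: mult.assoc)
  also have "delta (- h) * (delta h * JMprod (\<lambda>_. p) n) = JMprod (\<lambda>_. p) n"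
    by (simp add: mult.assoc[symmetric] mult_single)
  finally show ?thesis .
qed

text \<open>A Cauchy--Schwarz argument: positivity of the trace at \<open>B * (1 + delta g)\<close>
  and at \<open>B * (1 - delta g)\<close> gives the two inequalities.\<close>

lemma tau_square_bound:
  assumes "D = B * B" "star B = B"
  shows "\<bar>tau (D * delta g)\<bar> \<le> tau D"
proof -
  have s: "star D = D" using assms by simp
  have "star (D * delta (- g)) = delta g * D" by (simp add: s)
  then have g: "tau (D * delta (- g)) = tau (D * delta g)" by (metis tau_star tau_commute)
  have "0 \<le> tau ((B * (1 + sc c * delta g)) * star (B * (1 + sc c * delta g)))" for c
    by (rule tau_mult_star_nonneg)
  also have "tau ((B * (1 + sc c * delta g)) * star (B * (1 + sc c * delta g)))
     = tau (D * ((1 + sc c * delta g) * (1 + sc c * delta (- g))))" for c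
    unfolding star_mult assms(2) mult.assoc assms(1) 
    by (subst (2) tau_commute) (simp add: mult.assoc mult_single)
  also have "\<dots> c = (1 + c * c) * tau D + 2 * c * tau (D * delta g)" for c
  proof -
    have "D * ((1 + sc c * delta g) * (1 + sc c * delta (- g)))
      = D + D * sc (c * c) + sc c * (D * delta g) + sc c * (D * delta (- g))"
    proof -
      have 1: "D * (sc c * b) = sc c * (D * b)" for b by (metis mult.assoc sc_commute)
      have 2: "(1 + sc c * delta g) * (1 + sc c * delta (- g))
        = 1 + sc (c * c) + sc c * delta g + sc c * delta (- g)"
        by (simp add: distrib_left distrib_right mult_single add_ac)
      show ?thesis unfolding 2 by (simp only: distrib_left 1 mult_1_right)
    qed
    then show ?thesis by (simp add: g algebra_simps)
  qed
  finally have "0 \<le> (1 + c * c) * tau D + 2 * c * tau (D * delta g)" for c .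
  from this[of 1] this[of "-1"] show ?thesis by simp
qed

section \<open>The normalised trace as a function on the infinite symmetric group\<close>

lemma ev_quad: "ev [:t, e, 1:] x = sc t + sc e * x + x * x"
  by (simp add: ev_pCons distrib_left sc_commute)

text \<open>In the last factor t + e x + x^2 the linear term has trace 0 by \<open>tau_JM1\<close>
  and the square contributes \<open>n\<close> by \<open>tau_JM2\<close>.\<close>

lemma tau_JMprod_Suc:
  assumes "g \<in> Sym n"
  shows "tau (JMprod (\<lambda>_. [:t, e, 1:]) (Suc n) * delta g) = (t + n) * tau (JMprod (\<lambda>_. [:t, e, 1:]) n * delta g)"
proof -
  define a where "a = delta g * JMprod (\<lambda>_. [:t, e, 1:]) n"
  have a: "a \<in> galg n" unfolding a_def by (intro galg_mult JMprod_galg galg_single assms)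
  have ta: "tau a = tau (JMprod (\<lambda>_. [:t, e, 1:]) n * delta g)" unfolding a_def by (rule tau_commute)
  have "tau (JMprod (\<lambda>_. [:t, e, 1:]) (Suc n) * delta g) = tau (a * ev [:t, e, 1:] (JM n))"
    unfolding a_def by (subst tau_commute) (simp add: mult.assoc)
  also have "a * ev [:t, e, 1:] (JM n) = sc t * a + sc e * (a * JM n) + a * (JM n * JM n)"
  proof -
    have "a * (sc c * b) = sc c * (a * b)" for c b by (metis mult.assoc sc_commute)
    then show ?thesis unfolding ev_quad by (simp add: distrib_left sc_commute)
  qed
  finally show ?thesis using a by (simp add: tau_JM1 tau_JM2 ta algebra_simps)
qed

text \<open>After division by the total trace the value at \<open>g\<close> no longer depends on
  \<open>n\<close>: the functionals on the groups \<open>Sym n\<close> are restrictions of a single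
  one. Its value on a cycle can thus be read off in the smallest group containing the cycle.\<close>

lemma tau_JMprod_coherent:
  assumes "g \<in> Sym m" "m \<le> n"
  shows "tau (JMprod (\<lambda>_. [:t, e, 1:]) n * delta g) * pochhammer t m
     = pochhammer t n * tau (JMprod (\<lambda>_. [:t, e, 1:]) m * delta g)"
  using assms(2)
proof (induction n rule: dec_induct)
  case (step n)
  have "g \<in> Sym n" using assms Sym_mono[of m n] step by auto
  from tau_JMprod_Suc[OF this] show ?case using step by (simp add: pochhammer_Suc algebra_simps)
qed simp

lemma tau_JMprod: "tau (JMprod (\<lambda>_. [:t, e, 1:]) n) = pochhammer t n"
  using tau_JMprod_coherent[of 0 0 n t e] by simp

lemma nodal_dvdI:
  assumes "finite C" "\<And>c. c \<in> C \<Longrightarrow> poly p c = 0"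
  shows "nodal C dvd p"
  using assms
proof (induction C arbitrary: p rule: finite_induct)
  case (insert c C)
  then obtain q where q: "p = lin c * q"
    unfolding lin_def by (metis dvdE insertI1 poly_eq_0_iff_dvd)
  have "poly q d = 0" if "d \<in> C" for d
    using insert.prems[of d] insert.hyps that by (auto simp: q)
  then have "nodal C dvd q" by (rule insert.IH)
  then show ?case using insert.hyps by (auto simp: nodal_def q)
qed (simp add: nodal_def)

lemma ev_dvd_zero:
  fixes E :: "'g::group_add group_alg"
  assumes "E * ev p y = 0" "p dvd q" shows "E * ev q y = 0"
proof -
  obtain r where "q = p * r" using assms(2) by (auto simp: dvd_def)
  then have "E * ev q y = (E * ev p y) * ev r y" by (simp add: ev_mult mult.assoc)
  then show ?thesis using assms by simp
qed

lemma ev_cong_nodal: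
  fixes E :: "'g::group_add group_alg"
  assumes "E * ev (nodal C) y = 0" "finite C" "\<And>c. c \<in> C \<Longrightarrow> poly p c = poly q c"
  shows "E * ev p y = E * ev q y"
proof -
  have "nodal C dvd p - q" by (rule nodal_dvdI) (use assms in auto)
  from ev_dvd_zero[OF assms(1) this] show ?thesis by (simp add: ev_diff right_diff_distrib)
qed

section \<open>The trace against a full cycle as a sum over hooks\<close>

text \<open>An element \<open>E\<close> satisfying \<open>hook n a b E\<close> behaves like the idempotent of a standard
  tableau of hook shape with \<open>n\<close> boxes, where \<open>a\<close> and \<open>b\<close> are the contents of the two boxes
  that may be added to the arm and the leg; the value \<open>0\<close> is the content of the inner corner.\<close>

definition hook :: "nat \<Rightarrow> real \<Rightarrow> real \<Rightarrow> fperm group_alg \<Rightarrow> bool" where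
  "hook n a b E \<longleftrightarrow> E \<in> galg n \<and> star E = E \<and> E * E = E \<and>
     E * ev (nodal {0, a, b}) (JM n) = 0 \<and>
     2 * (\<Sum>k<n. tau (E * JM k)) = (a + b) * n * tau E"

lemma mult_sc_left: "w * (sc c * v) = sc c * (w * v)"
  by (metis mult.assoc sc_commute)

lemma mult_ev_quad:
  "w * ev (smult c (lin 0 * lin b)) x = sc c * (w * (x * x) - sc b * (w * x))"
proof -
  have "w * ev (smult c (lin 0 * lin b)) x = sc c * (w * (x * (x - sc b)))"
    unfolding ev_smult ev_mult ev_linear sc_0 diff_zero mult_sc_left ..
  also have "x * (x - sc b) = x * x - sc b * x"
    unfolding right_diff_distrib sc_commute[of b x] ..
  finally show ?thesis unfolding right_diff_distrib[of w] mult_sc_left .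
qed

lemma hook_1: "hook 1 1 (- 1) 1"
proof -
  have "JM 1 = delta (transp 0 1)" by (simp add: JM_def)
  then have "JM 1 * JM 1 = 1" by (simp add: mult_single)
  then have "ev (nodal {0, 1, - 1}) (JM 1) = 0"
    by (simp add: nodal_def ev_mult single_uminus algebra_simps)
  then show ?thesis by (simp add: hook_def)
qed

text \<open>Adding a box of content \<open>a\<close>: the polynomial is the Lagrange basis
  polynomial at \<open>a\<close> for the nodes 0, \<open>a\<close>, \<open>b\<close>, so
  \<open>E\<close> is cut down to the eigenvalue \<open>a\<close> of \<open>JM n\<close>.\<close>

definition hook_step :: "nat \<Rightarrow> real \<Rightarrow> real \<Rightarrow> fperm group_alg \<Rightarrow> fperm group_alg" where
  "hook_step n a b E = E * ev (smult (1 / (a * (a - b))) (lin 0 * lin b)) (JM n)"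

lemma hook_stepD:
  assumes h: "hook n a b E" and ab: "a \<noteq> 0" "b \<noteq> 0" "a \<noteq> b"
  shows "hook_step n a b E \<in> galg (Suc n)" "star (hook_step n a b E) = hook_step n a b E"
    "hook_step n a b E * hook_step n a b E = hook_step n a b E"
    "hook_step n a b E * JM n = sc a * hook_step n a b E"
    "tau (hook_step n a b E) = n / (a * (a - b)) * tau E"
proof -
  let ?f = "smult (1 / (a * (a - b))) (lin 0 * lin b)"
  have fv: "poly ?f 0 = 0" "poly ?f a = 1" "poly ?f b = 0" using ab by simp_all
  define y where "y = JM n"
  have E: "E \<in> galg n" "star E = E" "E * E = E" "E * ev (nodal {0, a, b}) y = 0"
    using h by (auto simp: hook_def y_def)
  have Ey: "E * y = y * E" unfolding y_def by (rule galg_JM_commute[OF E(1)])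
  have Ep: "E * ev p y = ev p y * E" for p by (rule ev_intertwine[OF Ey])
  show "hook_step n a b E \<in> galg (Suc n)"
    unfolding hook_step_def using galg_mono[of n "Suc n"] E(1) by (auto intro!: galg_mult galg_ev JM_galg)
  show "star (hook_step n a b E) = hook_step n a b E"
    using Ep by (simp add: hook_step_def star_ev E y_def)
  have "hook_step n a b E * hook_step n a b E = E * (ev ?f y * E) * ev ?f y"
    by (simp add: hook_step_def y_def mult.assoc)
  also have "\<dots> = (E * E) * ev (?f * ?f) y" by (simp only: Ep[symmetric] mult.assoc ev_mult)
  also have "\<dots> = E * ev ?f y"
    unfolding E(3) by (rule ev_cong_nodal[OF E(4)]) (auto simp only: poly_mult fv)
  finally show "hook_step n a b E * hook_step n a b E = hook_step n a b E"
    by (simp add: hook_step_def y_def)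
  have "hook_step n a b E * JM n = E * ev (?f * lin 0) y"
    by (simp only: hook_step_def y_def ev_mult mult.assoc) simp
  also have "\<dots> = E * ev (smult a ?f) y"
    by (rule ev_cong_nodal[OF E(4)]) (auto simp only: poly_mult poly_smult[of a] fv poly_lin, auto)
  also have "\<dots> = sc a * hook_step n a b E"
    by (simp only: ev_smult[of a] hook_step_def y_def mult_sc_left)
  finally show "hook_step n a b E * JM n = sc a * hook_step n a b E" .
  have "tau (hook_step n a b E) = tau (sc (1 / (a * (a - b))) * (E * (y * y) - sc b * (E * y)))"
    unfolding hook_step_def mult_ev_quad y_def ..
  also have "\<dots> = n / (a * (a - b)) * tau E"
    unfolding tau_sc_mult tau_diff unfolding y_def tau_JM2[OF E(1)] tau_JM1[OF E(1)] by simp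
  finally show "tau (hook_step n a b E) = n / (a * (a - b)) * tau E" .
qed

text \<open>Of the three ways to add a box to a hook, the inner corner has content 0 and is
  discarded by a polynomial vanishing there. The two continuations that remain are hooks
  again.\<close>

lemma hook_decompose:
  assumes h: "hook n a b E" and ab: "a \<noteq> 0" "b \<noteq> 0" "a \<noteq> b" and g: "poly g 0 = 0"
  shows "E * ev g (JM n) = sc (poly g a) * hook_step n a b E + sc (poly g b) * hook_step n b a E"
proof -
  have E: "E * ev (nodal {0, a, b}) (JM n) = 0" using h by (auto simp: hook_def)
  have "E * ev g (JM n) = E * ev (smult (poly g a) (smult (1 / (a * (a - b))) (lin 0 * lin b))
     + smult (poly g b) (smult (1 / (b * (b - a))) (lin 0 * lin a))) (JM n)"
    by (rule ev_cong_nodal[OF E]) (use ab g in auto)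
  also have "\<dots> = sc (poly g a) * hook_step n a b E + sc (poly g b) * hook_step n b a E"
    by (simp only: ev_add ev_smult[of "poly g a"] ev_smult[of "poly g b"] hook_step_def distrib_left mult_sc_left)
  finally show ?thesis .
qed

lemma ev_factor: 
  fixes V :: "'g::group_add group_alg"
  assumes "V * ev (lin a) y = 0" shows "V * y = sc a * V"
  using assms by (simp add: right_diff_distrib sc_commute)

text \<open>The sign \<open>\<delta>\<close> is 1 on the arm and -1 on the leg; the new box moves
  its own corner outward and leaves the other in place. \<open>JM_transfer\<close> allows the next
  element the roots 0, \<open>b\<close>, \<open>a\<close>, \<open>a + 1\<close>,
  \<open>a - 1\<close>. Of these, \<open>a\<close> is excluded by \<open>JM_gap\<close> and
  \<open>a - \<delta>\<close> by comparing traces. The relation between \<open>a - b\<close> and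
  \<open>n\<close> is the hook geometry that makes the traces match.\<close>

theorem hook_step_hook:
  assumes h: "hook n a b E" and ab: "a \<noteq> 0" "b \<noteq> 0" "a \<noteq> b"
    and \<delta>: "\<delta> = 1 \<or> \<delta> = - 1" "a - b = \<delta> * (n + 1)" and new: "a + \<delta> \<noteq> 0" "a + \<delta> \<noteq> b"
  shows "hook (Suc n) (a + \<delta>) b (hook_step n a b E)"
proof -
  define x y E' where "x = JM n" and "y = JM (Suc n)" and "E' = hook_step n a b E"
  let ?f = "smult (1 / (a * (a - b))) (lin 0 * lin b)"
  note D = hook_stepD[OF h ab, folded E'_def x_def]
  have E: "E \<in> galg n" "E * ev (nodal {0, a, b}) x = 0"
    and trE: "2 * (\<Sum>k<n. tau (E * JM k)) = (a + b) * n * tau E"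
    using h by (auto simp: hook_def x_def)
  have xy: "x * y = y * x" unfolding x_def y_def by (rule JM_commute)
  have En: "E \<in> galg (Suc n)" using E galg_mono[of n "Suc n"] by auto
  have E'y: "E' * ev p y = ev p y * E'" for p
    by (rule ev_intertwine) (simp add: y_def galg_JM_commute[OF D(1)])
  \<comment> \<open>The sum of the contents is carried as an invariant because
    \<open>tau_JM3\<close> expresses the third moment of the next element through it.\<close>
  have sumE': "2 * (\<Sum>k<Suc n. tau (E' * JM k)) = (a + b + \<delta>) * Suc n * tau E'"
  proof -
    have "tau (E' * JM k) = n / (a * (a - b)) * tau (E * JM k)" if k: "k < n" for k
    proof -
      have "JM k * JM n = JM n * JM k" by (rule JM_commute)
      from ev_intertwine[OF this] have "E' * JM k = (E * JM k) * ev ?f x"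
        unfolding E'_def hook_step_def x_def by (metis mult.assoc)
      also have "tau \<dots> = tau (sc (1 / (a * (a - b))) * ((E * JM k) * (x * x) - sc b * ((E * JM k) * x)))"
        unfolding mult_ev_quad ..
      also have "\<dots> = n / (a * (a - b)) * tau (E * JM k)"
      proof -
        have "E * JM k \<in> galg n" by (intro galg_mult E JM_galg k)
        then show ?thesis unfolding tau_sc_mult tau_diff unfolding x_def by (simp add: tau_JM1 tau_JM2)
      qed
      finally show ?thesis .
    qed
    then have "(\<Sum>k<n. tau (E' * JM k)) = n / (a * (a - b)) * (\<Sum>k<n. tau (E * JM k))"
      by (simp add: sum_distrib_left)
    then have "2 * (\<Sum>k<n. tau (E' * JM k)) = (a + b) * n * tau E'"
      using trE D(5) by simp
    moreover have "tau (E' * JM n) = a * tau E'" using D(4) by (simp add: x_def)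
    moreover have "2 * a = (a + b) + \<delta> * (n + 1)" using \<delta> by simp
    ultimately have "2 * (\<Sum>k<Suc n. tau (E' * JM k)) = ((a + b) * n + ((a + b) + \<delta> * (n + 1))) * tau E'"
      by (simp add: algebra_simps)
    then show ?thesis by (simp add: algebra_simps)
  qed
  have 1: "E' * ev (nodal {0, a, b} * (lin (a + 1) * lin (a - 1))) y = 0"
  proof -
    have "E * ev (nodal {0, a, b}) y * ((x - y) * (x - y) - 1) = 0"
      unfolding x_def y_def
      by (rule JM_transfer) (use E in \<open>auto simp: x_def galg_adj_commute galg_JM_commute galg_JM_commute[OF En]\<close>)
    then have "ev ?f x * (E * ev (nodal {0, a, b}) y * ((x - y) * (x - y) - 1)) = 0" by simp
    moreover have "ev ?f x * E = E'"
      unfolding E'_def hook_step_def x_def by (rule ev_intertwine[symmetric]) (rule galg_JM_commute[OF E(1)])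
    ultimately have 2: "(E' * ev (nodal {0, a, b}) y) * ((x - y) * (x - y) - 1) = 0"
      by (metis mult.assoc)
    have "(E' * ev (nodal {0, a, b}) y) * x = sc a * (E' * ev (nodal {0, a, b}) y)"
    proof -
      have "x * ev (nodal {0, a, b}) y = ev (nodal {0, a, b}) y * x" by (rule ev_intertwine[OF xy])
      then show ?thesis by (metis D(4) mult.assoc)
    qed
    from diff_sq_eigen[OF this xy] 2 show ?thesis by (simp add: ev_mult mult.assoc)
  qed
  have lin2: "lin (a + 1) * lin (a - 1) = lin (a + \<delta>) * lin (a - \<delta>)" using \<delta>(1) by auto
  define R where "R = nodal {0, a + \<delta>, b}"
  have R: "R = lin 0 * lin b * lin (a + \<delta>)" using ab new by (simp add: R_def nodal_def mult_ac)
  have nab: "nodal {0, a, b} = lin 0 * lin b * lin a" using ab by (simp add: nodal_def mult_ac)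
  \<comment> \<open>Write the annihilating polynomial as
    \<open>R * lin (a - \<delta>) * lin a\<close>. If the factor \<open>lin a\<close> were needed,
    the product of the others would be an element on which \<open>JM n\<close> and
    \<open>JM (Suc n)\<close> both act as \<open>a\<close>.\<close>
  have 3: "E' * ev (R * lin (a - \<delta>)) y = 0" (is "?V = 0")
  proof -
    have "nodal {0, a, b} * (lin (a + 1) * lin (a - 1)) = (R * lin (a - \<delta>)) * lin a"
      unfolding lin2 R nab by (simp only: mult_ac)
    then have "?V * ev (lin a) y = 0" using 1 by (simp only: ev_mult mult.assoc)
    then have Vy: "?V * y = sc a * ?V" by (rule ev_factor)
    have "x * ev (R * lin (a - \<delta>)) y = ev (R * lin (a - \<delta>)) y * x" by (rule ev_intertwine[OF xy])
    then have "?V * x = sc a * ?V" by (metis D(4) mult.assoc)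
    with Vy have "?V * (JM n - JM (Suc n)) = 0" by (simp add: right_diff_distrib x_def y_def)
    then show ?thesis by (rule JM_gap)
  qed
  \<comment> \<open>In the cubic \<open>R\<close> the linear term has trace 0, and the invariant
    \<open>sumE'\<close> makes the contributions of degree 3 and degree 2 cancel.\<close>
  have trR: "tau (E' * ev R y) = 0"
  proof -
    have "R = lin 0 * (lin 0 * lin 0) + smult (- (a + b + \<delta>)) (lin 0 * lin 0) + smult (b * (a + \<delta>)) (lin 0)"
      unfolding R by (simp add: lin_def algebra_simps)
    then have "E' * ev R y = E' * (y * (y * y)) + E' * (sc (- (a + b + \<delta>)) * (y * y)) + E' * (sc (b * (a + \<delta>)) * y)"
      by (simp only: ev_add ev_smult ev_mult ev_linear sc_0 diff_zero distrib_left)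
    then have "tau (E' * ev R y) = tau (E' * (y * (y * y))) - (a + b + \<delta>) * tau (E' * (y * y)) + b * (a + \<delta>) * tau (E' * y)"
      by (simp only: mult_sc_left tau_add tau_sc_mult)
    then show ?thesis
      using sumE' unfolding y_def tau_JM1[OF D(1)] tau_JM2[OF D(1)] tau_JM3[OF D(1)] by simp
  qed
  have "E' * ev R y = 0"
  proof (rule tau_mult_star_eq_0)
    \<comment> \<open>Modulo the annihilating polynomial \<open>R * lin (a - \<delta>)\<close> the
      square of \<open>R\<close> is \<open>\<rho>\<close> times \<open>R\<close>. Hence the trace of
      the square of \<open>E' * ev R y\<close> is a multiple of \<open>trR\<close>, whatever the
      sign of \<open>\<rho>\<close>.\<close>
    define \<rho> where "\<rho> = poly R (a - \<delta>)"
    have "lin (a - \<delta>) dvd R - [:\<rho>:]"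
      unfolding lin_def by (subst poly_eq_0_iff_dvd[symmetric]) (simp add: \<rho>_def)
    then have "R * lin (a - \<delta>) dvd R * (R - [:\<rho>:])" by simp
    from ev_dvd_zero[OF 3 this] have "E' * ev (R * R - smult \<rho> R) y = 0" by (simp add: algebra_simps)
    then have RR: "E' * ev (R * R) y = sc \<rho> * (E' * ev R y)"
      by (simp add: ev_diff ev_smult right_diff_distrib mult_sc_left)
    have "(E' * ev R y) * star (E' * ev R y) = E' * ev R y * (ev R y * E')"
      by (simp add: star_ev D(2) y_def)
    also have "E' * ev R y * (ev R y * E') = (E' * ev (R * R) y) * E'"
      by (simp only: ev_mult mult.assoc)
    also have "tau \<dots> = tau (E' * E' * ev (R * R) y)"
      by (subst tau_commute) (simp only: mult.assoc)
    also have "\<dots> = \<rho> * tau (E' * ev R y)" unfolding D(3) RR by simp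
    finally show "tau ((E' * ev R y) * star (E' * ev R y)) \<le> 0" using trR by simp
  qed
  then show ?thesis
    unfolding hook_def E'_def[symmetric] using D sumE' by (simp add: R_def y_def algebra_simps)
qed

text \<open>Sum over the hooks reached from arm length \<open>p\<close> and leg length
  \<open>q\<close> by adding \<open>r\<close> boxes, \<open>i\<close> of them to the leg. The
  binomial coefficient counts the orders of insertion. Each leg box brings a minus sign, since its
  trace ratio has the denominator \<open>b - a = - (n + 1)\<close>.\<close>

definition hook_sum :: "real poly \<Rightarrow> nat \<Rightarrow> nat \<Rightarrow> nat \<Rightarrow> real" where
  "hook_sum \<kappa> r p q = (\<Sum>i\<le>r. real (r choose i) * (- 1) ^ i *
     ((\<Prod>j<r - i. poly \<kappa> (real p + 1 + real j)) * (\<Prod>j<i. poly \<kappa> (- real q - 1 - real j))))"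

lemma sum_choose_Suc:
  fixes G :: "nat \<Rightarrow> nat \<Rightarrow> real"
  shows "(\<Sum>i\<le>Suc r. (Suc r choose i) * G (Suc r - i) i)
     = (\<Sum>i\<le>r. (r choose i) * G (Suc (r - i)) i) + (\<Sum>i\<le>r. (r choose i) * G (r - i) (Suc i))"
proof -
  have "(\<Sum>i\<le>Suc r. (Suc r choose i) * G (Suc r - i) i)
     = G (Suc r) 0 + (\<Sum>i\<le>r. (r choose Suc i) * G (r - i) (Suc i)) + (\<Sum>i\<le>r. (r choose i) * G (r - i) (Suc i))"
    by (subst sum.atMost_Suc_shift) (simp add: distrib_right sum.distrib)
  also have "G (Suc r) 0 + (\<Sum>i\<le>r. (r choose Suc i) * G (r - i) (Suc i)) = (\<Sum>i\<le>Suc r. (r choose i) * G (Suc r - i) i)"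
    by (subst sum.atMost_Suc_shift) simp
  also have "\<dots> = (\<Sum>i\<le>r. (r choose i) * G (Suc (r - i)) i)"
    by (simp add: Suc_diff_le)
  finally show ?thesis by simp
qed

lemma hook_sum_Suc:
  "hook_sum \<kappa> (Suc r) p q = poly \<kappa> (real p + 1) * hook_sum \<kappa> r (Suc p) q - poly \<kappa> (- real q - 1) * hook_sum \<kappa> r p (Suc q)"
proof -
  define G where "G m i = (- 1) ^ i * ((\<Prod>j<m. poly \<kappa> (real p + 1 + real j)) * (\<Prod>j<i. poly \<kappa> (- real q - 1 - real j)))" for m i :: nat
  have 1: "G (Suc m) i = poly \<kappa> (real p + 1) * ((- 1) ^ i * ((\<Prod>j<m. poly \<kappa> (real (Suc p) + 1 + real j)) * (\<Prod>j<i. poly \<kappa> (- real q - 1 - real j))))" for m i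
    unfolding G_def prod.lessThan_Suc_shift by (simp add: add_ac)
  have 2: "G m (Suc i) = - poly \<kappa> (- real q - 1) * ((- 1) ^ i * ((\<Prod>j<m. poly \<kappa> (real p + 1 + real j)) * (\<Prod>j<i. poly \<kappa> (- real (Suc q) - 1 - real j))))" for m i
    unfolding G_def prod.lessThan_Suc_shift by (simp add: diff_diff_eq add_ac)
  have "hook_sum \<kappa> (Suc r) p q = (\<Sum>i\<le>Suc r. (Suc r choose i) * G (Suc r - i) i)"
    unfolding hook_sum_def G_def by (simp only: mult.assoc)
  also have "\<dots> = (\<Sum>i\<le>r. (r choose i) * G (Suc (r - i)) i) + (\<Sum>i\<le>r. (r choose i) * G (r - i) (Suc i))"
    by (rule sum_choose_Suc)
  also have "(\<Sum>i\<le>r. (r choose i) * G (Suc (r - i)) i) = poly \<kappa> (real p + 1) * hook_sum \<kappa> r (Suc p) q"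
    unfolding 1 hook_sum_def by (simp only: sum_distrib_left mult.assoc mult.left_commute)
  also have "(\<Sum>i\<le>r. (r choose i) * G (r - i) (Suc i)) = - poly \<kappa> (- real q - 1) * hook_sum \<kappa> r p (Suc q)"
    unfolding 2 hook_sum_def by (simp only: sum_distrib_left mult.assoc mult.left_commute)
  finally show ?thesis by simp
qed

text \<open>Factors are absorbed into \<open>E\<close> one at a time, so that an induction on
  \<open>r\<close> may replace \<open>E\<close> by its two hook continuations at each step.\<close>

primrec JMtail :: "real poly \<Rightarrow> fperm group_alg \<Rightarrow> nat \<Rightarrow> nat \<Rightarrow> fperm group_alg" where
  "JMtail g E n 0 = E"
| "JMtail g E n (Suc r) = JMtail g (E * ev g (JM n)) (Suc n) r"

lemma JMtail_linear:
  "JMtail g (sc c * E + sc d * E') n r = sc c * JMtail g E n r + sc d * JMtail g E' n r"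
  by (induction r arbitrary: n E E') (simp_all add: distrib_right mult.assoc)

lemma JMtail_JMprod:
  "(\<And>k. k \<ge> n \<Longrightarrow> f k = g) \<Longrightarrow> JMtail g (JMprod f n) n r = JMprod f (n + r)"
proof (induction r arbitrary: n)
  case (Suc r)
  have "JMtail g (JMprod f n) n (Suc r) = JMtail g (JMprod f (Suc n)) (Suc n) r" using Suc.prems by simp
  also have "\<dots> = JMprod f (Suc n + r)" using Suc.prems by (intro Suc.IH) auto
  finally show ?case by simp
qed simp

lemma hook_swap: "hook n a b E \<Longrightarrow> hook n b a E"
  by (simp add: hook_def insert_commute add.commute)

lemma hook_arith:
  fixes a b N M n :: real
  assumes "a \<noteq> 0" "b \<noteq> 0" "N \<noteq> 0" "M \<noteq> 0"
  shows "a * A * (N / M * F1 * (n / (a * N) * T)) + b * B * (N / M * F2 * (n / (b * (- N)) * T))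
    = n / M * (A * F1 - B * F2) * T"
proof -
  have "a * A * (N / M * F1 * (n / (a * N) * T)) = n / M * (A * F1) * T" using assms by simp
  moreover have "b * B * (N / M * F2 * (n / (b * (- N)) * T)) = - (n / M * (B * F2) * T)" using assms by simp
  ultimately show ?thesis by (simp only: right_diff_distrib left_diff_distrib)
qed

text \<open>The factor \<open>lin 0\<close> contributes the content \<open>a\<close> of the new box
  and cancels it in the trace ratio n/(a(a - b)). What remains is n/(n + 1) up to sign, and these
  quotients telescope over the \<open>r\<close> steps.\<close>

lemma tau_JMtail:
  assumes "hook (p + q + 1) (real p + 1) (- real q - 1) E"
  shows "tau (JMtail (lin 0 * \<kappa>) E (p + q + 1) r) = (p + q + 1) / (p + q + 1 + r) * hook_sum \<kappa> r p q * tau E"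
  using assms
proof (induction r arbitrary: p q E)
  case (Suc r)
  define n a b where "n = p + q + 1" and "a = real p + 1" and "b = - real q - 1"
  have h: "hook n a b E" using Suc.prems by (simp add: n_def a_def b_def)
  have h': "hook n b a E" by (rule hook_swap[OF h])
  have ab: "a \<noteq> 0" "b \<noteq> 0" "a \<noteq> b" "a > 0" "b < 0" by (auto simp: a_def b_def)
  have ab1: "a - b = n + 1" by (simp add: a_def b_def n_def)
  have "hook (Suc n) (a + 1) b (hook_step n a b E)"
    by (rule hook_step_hook[OF h ab(1-3)]) (use ab ab1 in auto)
  then have H1: "hook (Suc p + q + 1) (real (Suc p) + 1) (- real q - 1) (hook_step n a b E)"
    by (simp add: n_def a_def b_def add_ac)
  have "hook (Suc n) (b + - 1) a (hook_step n b a E)"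
  proof (rule hook_step_hook[OF h' ab(2,1)])
    show "(- 1 :: real) = 1 \<or> (- 1 :: real) = - 1" by simp
    show "b - a = - 1 * real (n + 1)" using ab1 by simp
    show "b \<noteq> a" using ab(3) by simp
    show "b + - 1 \<noteq> 0" "b + - 1 \<noteq> a" using ab(4,5) by simp_all
  qed
  then have H2: "hook (p + Suc q + 1) (real p + 1) (- real (Suc q) - 1) (hook_step n b a E)"
    using hook_swap[of "Suc n" "b + - 1" a] by (simp add: n_def a_def b_def add_ac)
  let ?g = "lin 0 * \<kappa>"
  have dec: "E * ev ?g (JM n) = sc (poly ?g a) * hook_step n a b E + sc (poly ?g b) * hook_step n b a E"
    by (rule hook_decompose[OF h ab(1-3)]) simp
  have "tau (JMtail ?g E n (Suc r)) = poly ?g a * tau (JMtail ?g (hook_step n a b E) (Suc n) r)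
      + poly ?g b * tau (JMtail ?g (hook_step n b a E) (Suc n) r)"
    unfolding JMtail.simps dec JMtail_linear tau_add tau_sc_mult ..
  also have "tau (JMtail ?g (hook_step n a b E) (Suc n) r)
      = real (Suc n) / real (Suc n + r) * hook_sum \<kappa> r (Suc p) q * (n / (a * Suc n) * tau E)"
    using Suc.IH[OF H1] hook_stepD(5)[OF h ab(1-3)] ab1 by (simp add: n_def add_ac)
  also have "tau (JMtail ?g (hook_step n b a E) (Suc n) r)
      = real (Suc n) / real (Suc n + r) * hook_sum \<kappa> r p (Suc q) * (n / (b * (- real (Suc n))) * tau E)"
  proof -
    have "b - a = - real (Suc n)" using ab1 by simp
    then show ?thesis
      using Suc.IH[OF H2] hook_stepD(5)[OF h' ab(2,1)] ab(3) by (simp add: n_def add_ac)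
  qed
  also have "poly ?g a * (real (Suc n) / real (Suc n + r) * hook_sum \<kappa> r (Suc p) q * (n / (a * Suc n) * tau E))
     + poly ?g b * (real (Suc n) / real (Suc n + r) * hook_sum \<kappa> r p (Suc q) * (n / (b * (- real (Suc n))) * tau E))
     = n / real (Suc n + r) * (poly \<kappa> a * hook_sum \<kappa> r (Suc p) q - poly \<kappa> b * hook_sum \<kappa> r p (Suc q)) * tau E"
    unfolding poly_mult poly_lin diff_zero by (rule hook_arith) (use ab in auto)
  also have "poly \<kappa> a * hook_sum \<kappa> r (Suc p) q - poly \<kappa> b * hook_sum \<kappa> r p (Suc q) = hook_sum \<kappa> (Suc r) p q"
    unfolding hook_sum_Suc a_def b_def ..
  finally show ?case by (simp add: n_def)
qed (simp add: hook_sum_def)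

lemma tau_JMprod_hook:
  "tau (JMprod (\<lambda>k. if k = 0 then \<kappa> else lin 0 * \<kappa>) (Suc l)) = poly \<kappa> 0 * hook_sum \<kappa> l 0 0 / (l + 1)"
proof -
  let ?f = "\<lambda>k::nat. if k = 0 then \<kappa> else lin 0 * \<kappa>"
  \<comment> \<open>\<open>JM 0\<close> is zero, so the first factor is the scalar
    \<open>poly \<kappa> 0\<close>; putting \<open>lin 0\<close> there as well would kill
    everything.\<close>
  have "1 * (0 :: fperm group_alg) = sc 0 * 1" by simp
  from ev_eigen[OF this] have "JMprod ?f 1 = sc (poly \<kappa> 0) * 1 + sc 0 * 1" by simp
  moreover have "JMtail (lin 0 * \<kappa>) (JMprod ?f 1) 1 l = JMprod ?f (1 + l)" by (rule JMtail_JMprod) auto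
  ultimately have "JMprod ?f (Suc l) = sc (poly \<kappa> 0) * JMtail (lin 0 * \<kappa>) 1 1 l"
    using JMtail_linear[of "lin 0 * \<kappa>" "poly \<kappa> 0" 1 0 1 1 l] by simp
  moreover have "tau (JMtail (lin 0 * \<kappa>) 1 1 l) = 1 / (1 + l) * hook_sum \<kappa> l 0 0"
    using tau_JMtail[of 0 0 1 \<kappa> l] hook_1 by simp
  ultimately show ?thesis by (simp add: add.commute)
qed

section \<open>Cycles, and the trace of the central element against a full cycle\<close>

lift_definition cyc :: "nat list \<Rightarrow> fperm" is cycle_of_list by (rule permutation_of_cycle)

lemma cyc_Cons2: "cyc (i # j # cs) = transp i j + cyc (j # cs)" by transfer simp
lemma cyc_single [simp]: "cyc [i] = 0" by transfer simp
lemma fapply_cyc: "fapply (cyc cs) = cycle_of_list cs" by transfer simp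

lemma cyc_conj: "distinct cs \<Longrightarrow> h + cyc cs - h = cyc (map (fapply h) cs)"
  using conjugation_of_cycle[of cs "fapply h"] fapply_bij[of h]
  by (intro fperm_eqI)
     (simp add: fapply_cyc fapply_uminus fun_eq_iff del: add_uminus_conv_diff flip: add_uminus_conv_diff)

lemma cyc_Sym: "set cs \<subseteq> {..<n} \<Longrightarrow> cyc cs \<in> Sym n"
  unfolding Sym_def by (auto simp: fapply_cyc intro!: id_outside_supp)

text \<open>A cycle may be rotated so that it starts with \<open>a\<close>; the transposition then
  inserts \<open>b\<close> in front of \<open>a\<close>.\<close>

lemma transp_cyc:
  assumes "distinct cs" "a \<in> set cs" "b \<notin> set cs"
  obtains ds where "distinct ds" "set ds = insert b (set cs)" "transp b a + cyc cs = cyc ds"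
proof -
  obtain us vs where cs: "cs = us @ a # vs" using assms(2) by (metis split_list)
  have r: "rotate (length us) cs = a # vs @ us" unfolding cs rotate_append by simp
  have "cyc cs = cyc (a # vs @ us)"
    using cycle_of_list_rotate_independent[OF assms(1), of "length us"] unfolding r
    by transfer simp
  then have "transp b a + cyc cs = cyc (b # a # vs @ us)" by (simp add: cyc_Cons2)
  then show ?thesis using assms by (intro that[of "b # a # vs @ us"]) (auto simp: cs)
qed

lemma ex_Sym_map:
  assumes "distinct xs" "distinct ys" "length xs = length ys" "set xs \<subseteq> {..<n}" "set ys \<subseteq> {..<n}"
  shows "\<exists>h\<in>Sym n. map (fapply h) xs = ys"
  using assms
proof (induction xs arbitrary: ys)
  case (Cons x xs)
  then obtain y ys' where ys: "ys = y # ys'" by (cases ys) auto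
  have "\<exists>h\<in>Sym n. map (fapply h) xs = ys'" using Cons.prems ys by (intro Cons.IH) auto
  then obtain h where h: "h \<in> Sym n" "map (fapply h) xs = ys'" by blast
  let ?h = "transp (fapply h x) y + h"
  have "fapply h x < n" using Sym_less_iff[OF h(1)] Cons by simp
  then have "?h \<in> Sym n" using Cons ys by (intro Sym_add transp_Sym h) auto
  moreover have "map (fapply ?h) xs = map (fapply h) xs"
  proof (rule map_cong[OF refl])
    fix i assume i: "i \<in> set xs"
    then have "fapply h i \<in> set ys'" using h by auto
    then have "fapply h i \<noteq> y" using Cons.prems ys by auto
    moreover have "fapply h i \<noteq> fapply h x" using i Cons.prems by auto
    ultimately show "fapply ?h i = fapply h i" by (simp add: Transposition.transpose_def)
  qed
  ultimately show ?case using h ys by (intro bexI[of _ ?h]) auto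
next
  case Nil
  then show ?case by (auto intro: exI[of _ "0 :: fperm"])
qed

text \<open>Cycles of equal length are conjugate within \<open>Sym n\<close>, and centrality makes
  the functional constant on conjugacy classes.\<close>

lemma tau_cyc:
  assumes "distinct xs" "distinct ys" "length xs = length ys" "set xs \<subseteq> {..<n}" "set ys \<subseteq> {..<n}"
  shows "tau (JMprod (\<lambda>_. p) n * delta (cyc xs)) = tau (JMprod (\<lambda>_. p) n * delta (cyc ys))"
proof -
  obtain h where h: "h \<in> Sym n" "map (fapply h) xs = ys" using ex_Sym_map[OF assms] by blast
  show ?thesis using tau_JMprod_conj[OF h(1), of p "cyc xs"] by (simp add: cyc_conj[OF assms(1)] h)
qed

text \<open>Records only how many full cycles on 0, ..., l are summed, not which ones: the trace to
  be applied depends on the length of a cycle alone.\<close>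

inductive cycle_sum :: "nat \<Rightarrow> nat \<Rightarrow> fperm group_alg \<Rightarrow> bool" for l where
  zero: "cycle_sum l 0 0"
| add: "cycle_sum l c a \<Longrightarrow> distinct cs \<Longrightarrow> set cs = {..l} \<Longrightarrow> cycle_sum l (Suc c) (a + delta (cyc cs))"

lemma cycle_sum_add: "cycle_sum l c a \<Longrightarrow> cycle_sum l d b \<Longrightarrow> cycle_sum l (d + c) (b + a)"
proof (induction rule: cycle_sum.induct)
  case (add c a cs)
  then show ?case using cycle_sum.add[of l "d + c" "b + a" cs] by (simp add: add.assoc)
qed simp

lemma JM_cyc_sum:
  assumes "distinct cs" "set cs = {..l}"
  shows "k \<le> Suc l \<Longrightarrow> cycle_sum (Suc l) k (\<Sum>i<k. delta (transp i (Suc l)) * delta (cyc cs))"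
proof (induction k)
  case (Suc k)
  obtain ds where ds: "distinct ds" "set ds = insert (Suc l) (set cs)" "transp (Suc l) k + cyc cs = cyc ds"
    using transp_cyc[of cs k "Suc l"] assms Suc by auto
  then have "set ds = {..Suc l}" using assms by auto
  then have "cycle_sum (Suc l) (Suc k) ((\<Sum>i<k. delta (transp i (Suc l)) * delta (cyc cs)) + delta (cyc ds))"
    using Suc ds by (intro cycle_sum.add) auto
  then show ?case by (simp add: mult_single transp_commute[of k] ds)
qed (simp add: cycle_sum.zero)

lemma cycle_sum_Suc: "cycle_sum l c a \<Longrightarrow> cycle_sum (Suc l) (c * Suc l) (JM (Suc l) * a)"
proof (induction rule: cycle_sum.induct)
  case (add c a cs)
  have "cycle_sum (Suc l) (Suc l) (JM (Suc l) * delta (cyc cs))"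
    using JM_cyc_sum[OF add(2,3), of "Suc l"] by (simp add: JM_def sum_distrib_right del: sum.lessThan_Suc)
  from cycle_sum_add[OF this add(4)] show ?case by (simp add: distrib_left algebra_simps)
qed (simp add: cycle_sum.zero)

text \<open>Multiplying a full cycle by \<open>JM (Suc l)\<close> inserts the new point next to each
  of the \<open>Suc l\<close> old ones in turn. So the product of \<open>JM 1\<close>, ...,
  \<open>JM l\<close> is made of l! full cycles.\<close>

lemma cycle_sum_JMprod:
  "cycle_sum l (fact l) (JMprod (\<lambda>k. if k = 0 then 1 else lin 0) (Suc l))"
proof (induction l)
  case 0
  have "cycle_sum 0 (Suc 0) (0 + delta (cyc [0]))" by (rule cycle_sum.intros)+ auto
  then show ?case by simp
next
  case (Suc l)
  let ?C = "JMprod (\<lambda>k. if k = 0 then 1 else lin 0)"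
  have "JM (Suc l) * ?C (Suc l) = ?C (Suc l) * JM (Suc l)"
    by (rule galg_JM_commute[OF JMprod_galg, symmetric])
  then show ?case using cycle_sum_Suc[OF Suc] by (simp add: algebra_simps)
qed

lemma tau_cycle_sum:
  assumes "cycle_sum l c a" "l < n"
  shows "tau (JMprod (\<lambda>_. p) n * a) = c * tau (JMprod (\<lambda>_. p) n * delta (cyc [0..<Suc l]))"
  using assms
proof (induction rule: cycle_sum.induct)
  case (add c a cs)
  have "length cs = Suc l" using add distinct_card[of cs] by simp
  then have "tau (JMprod (\<lambda>_. p) n * delta (cyc cs)) = tau (JMprod (\<lambda>_. p) n * delta (cyc [0..<Suc l]))"
    using add by (intro tau_cyc) auto
  then show ?case using add by (simp add: distrib_left algebra_simps del: upt_Suc)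
qed simp

text \<open>The l! cycles in the product of \<open>JM 1\<close>, ..., \<open>JM l\<close> have equal
  trace against the central element, so one of them has 1/l! of the trace of the whole product. In
  that product each factor \<open>lin 0\<close> merges with \<open>\<kappa>\<close>, and the hook
  expansion applies.\<close>

theorem tau_full_cycle:
  "tau (JMprod (\<lambda>_. \<kappa>) (Suc l) * delta (cyc [0..<Suc l])) = poly \<kappa> 0 * hook_sum \<kappa> l 0 0 / (fact l * (l + 1))"
proof -
  have "fact l * tau (JMprod (\<lambda>_. \<kappa>) (Suc l) * delta (cyc [0..<Suc l]))
      = tau (JMprod (\<lambda>_. \<kappa>) (Suc l) * JMprod (\<lambda>k. if k = 0 then 1 else lin 0) (Suc l))"
    using tau_cycle_sum[OF cycle_sum_JMprod, of l "Suc l" \<kappa>] by (simp del: upt_Suc JMprod.simps)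
  also have "\<dots> = tau (JMprod (\<lambda>k. if k = 0 then \<kappa> else lin 0 * \<kappa>) (Suc l))"
    unfolding JMprod_mult by (intro arg_cong[where f = tau] JMprod_cong) auto
  finally have 1: "fact l * tau (JMprod (\<lambda>_. \<kappa>) (Suc l) * delta (cyc [0..<Suc l])) = poly \<kappa> 0 * hook_sum \<kappa> l 0 0 / (l + 1)"
    unfolding tau_JMprod_hook .
  have "T = X / (fact l * (l + 1))" if "fact l * T = X / (l + 1)" for T X :: real
  proof -
    have "T = (fact l * T) / fact l" by simp
    also have "\<dots> = X / (fact l * (l + 1))" unfolding that by (simp add: divide_divide_eq_left algebra_simps)
    finally show ?thesis .
  qed
  from this[OF 1] show ?thesis by simp
qed

section \<open>Powers of a single Jucys--Murphy element\<close>

definition star_word :: "nat \<Rightarrow> nat list \<Rightarrow> fperm" where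
  "star_word k xs = sum_list (map (\<lambda>i. transp i k) xs)"

lemma JM_power:
  "JM k ^ l = (\<Sum>xs | set xs \<subseteq> {..<k} \<and> length xs = l. delta (star_word k xs))"
proof (induction l)
  case 0
  have "{xs. set xs \<subseteq> {..<k} \<and> length xs = 0} = {[]}" by auto
  then show ?case by (simp add: star_word_def)
next
  case (Suc l)
  let ?L = "\<lambda>l. {xs. set xs \<subseteq> {..<k} \<and> length xs = l}"
  have "JM k ^ Suc l = (\<Sum>i<k. \<Sum>xs\<in>?L l. delta (star_word k (i # xs)))"
    unfolding power_Suc Suc unfolding JM_def sum_product by (simp add: star_word_def mult_single)
  also have "\<dots> = (\<Sum>(i, xs)\<in>{..<k} \<times> ?L l. delta (star_word k (i # xs)))"
    by (rule sum.cartesian_product)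
  also have "\<dots> = (\<Sum>xs\<in>?L (Suc l). delta (star_word k xs))"
  proof (rule sum.reindex_bij_witness[of _ "\<lambda>xs. (hd xs, tl xs)" "\<lambda>(i, xs). i # xs"])
    fix b assume "b \<in> ?L (Suc l)"
    then show "(case (hd b, tl b) of (i, xs) \<Rightarrow> i # xs) = b" "(hd b, tl b) \<in> {..<k} \<times> ?L l"
      by (cases b; auto)+
  qed auto
  finally show ?case .
qed

lemma star_word_cyc:
  "distinct xs \<Longrightarrow> k \<notin> set xs \<Longrightarrow> \<exists>ds. distinct ds \<and> set ds = insert k (set xs) \<and> star_word k xs = cyc ds"
proof (induction xs)
  case Nil
  then show ?case by (intro exI[of _ "[k]"]) (simp add: star_word_def)
next
  case (Cons x xs)
  then obtain ds where ds: "distinct ds" "set ds = insert k (set xs)" "star_word k xs = cyc ds" by auto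
  then obtain es where "distinct es" "set es = insert x (set ds)" "transp x k + cyc ds = cyc es"
    using Cons.prems transp_cyc[of ds k x] by auto
  then show ?case using ds by (intro exI[of _ es]) (auto simp: star_word_def)
qed

lemma tau_star_word:
  assumes "distinct xs" "set xs \<subseteq> {..<k}" "length xs = l"
  shows "tau (JMprod (\<lambda>_. p) (Suc k) * delta (star_word k xs)) = tau (JMprod (\<lambda>_. p) (Suc k) * delta (cyc [0..<Suc l]))"
proof -
  obtain ds where ds: "distinct ds" "set ds = insert k (set xs)" "star_word k xs = cyc ds"
    using star_word_cyc[of xs k] assms by auto
  have "length ds = card (insert k (set xs))" using ds distinct_card[of ds] by simp
  also have "\<dots> = Suc (length xs)" using assms distinct_card[of xs] by (subst card_insert_disjoint) auto
  finally have len: "length ds = length [0..<Suc l]" using assms by simp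
  have "card (set xs) \<le> card {..<k}" using assms by (intro card_mono) auto
  then have "l \<le> k" using assms distinct_card[of xs] by simp
  then show ?thesis unfolding ds(3) using ds len assms by (intro tau_cyc) auto
qed

text \<open>Words with distinct letters are (l+1)-cycles and all have the same trace; their number
  is a falling factorial. Every other word is estimated by \<open>tau D\<close>, and there are too
  few of them to matter when \<open>k\<close> is large.\<close>

lemma tau_JM_power_bound:
  assumes D: "D = JMprod (\<lambda>_. p) (Suc k)" and bound: "\<And>g. \<bar>tau (D * delta g)\<bar> \<le> tau D" and l: "l \<le> k"
  shows "\<bar>tau (D * JM k ^ l) - real (\<Prod>{k - l + 1..k}) * tau (D * delta (cyc [0..<Suc l]))\<bar>
     \<le> (real k ^ l - real (\<Prod>{k - l + 1..k})) * tau D"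
proof -
  let ?L = "{xs. set xs \<subseteq> {..<k} \<and> length xs = l}" and ?M = "{xs. length xs = l \<and> distinct xs \<and> set xs \<subseteq> {..<k}}"
  have fin: "finite ?L" by (intro finite_lists_length_eq) auto
  have M: "?M \<subseteq> ?L" by auto
  have cM: "card ?M = \<Prod>{k - l + 1..k}" using card_lists_distinct_length_eq[of "{..<k}" l] l by simp
  have cL: "card ?L = k ^ l" using card_lists_length_eq[of "{..<k}" l] by simp
  have "tau (D * JM k ^ l) = (\<Sum>xs\<in>?L. tau (D * delta (star_word k xs)))"
    unfolding JM_power by (simp add: sum_distrib_left tau_sum)
  also have "\<dots> = (\<Sum>xs\<in>?M. tau (D * delta (star_word k xs))) + (\<Sum>xs\<in>?L - ?M. tau (D * delta (star_word k xs)))"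
    using sum.subset_diff[OF M fin] by (simp add: add.commute)
  also have "(\<Sum>xs\<in>?M. tau (D * delta (star_word k xs))) = (\<Sum>xs\<in>?M. tau (D * delta (cyc [0..<Suc l])))"
    unfolding D by (intro sum.cong refl tau_star_word) auto
  also have "\<dots> = real (\<Prod>{k - l + 1..k}) * tau (D * delta (cyc [0..<Suc l]))" using cM by simp
  finally have "\<bar>tau (D * JM k ^ l) - real (\<Prod>{k - l + 1..k}) * tau (D * delta (cyc [0..<Suc l]))\<bar>
     = \<bar>\<Sum>xs\<in>?L - ?M. tau (D * delta (star_word k xs))\<bar>" by simp
  also have "\<dots> \<le> (\<Sum>xs\<in>?L - ?M. tau D)"
    by (rule order.trans[OF sum_abs sum_mono]) (rule bound)
  also have "\<dots> = (real k ^ l - real (\<Prod>{k - l + 1..k})) * tau D"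
  proof -
    have "card (?L - ?M) = k ^ l - \<Prod>{k - l + 1..k}" using card_Diff_subset[OF finite_subset[OF M fin] M] cL cM by simp
    moreover have "\<Prod>{k - l + 1..k} \<le> k ^ l" using card_mono[OF fin M] cL cM by simp
    ultimately show ?thesis by (simp add: of_nat_diff)
  qed
  finally show ?thesis .
qed

lemma falling_ratio_tendsto:
  "(\<lambda>k. real (\<Prod>{k - l + 1..k}) / real (Suc k) ^ l) \<longlonglongrightarrow> 1"
proof (induction l)
  case (Suc l)
  have "(\<lambda>k. real (\<Prod>{k - l + 1..k}) / real (Suc k) ^ l * ((real k - real l) / real (Suc k))) \<longlonglongrightarrow> 1 * 1"
    by (intro tendsto_mult Suc) real_asymp
  moreover have "\<forall>\<^sub>F k in sequentially. real (\<Prod>{k - l + 1..k}) / real (Suc k) ^ l * ((real k - real l) / real (Suc k))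
     = real (\<Prod>{k - Suc l + 1..k}) / real (Suc k) ^ Suc l"
    using eventually_ge_at_top[of "Suc l"]
  proof eventually_elim
    case (elim k)
    then have "{k - Suc l + 1..k} = insert (k - l) {k - l + 1..k}" by auto
    then have "\<Prod>{k - Suc l + 1..k} = (k - l) * \<Prod>{k - l + 1..k}" by simp
    then show ?case using elim by (simp add: of_nat_diff mult.commute)
  qed
  ultimately show ?case by (simp add: filterlim_cong)
qed simp

section \<open>Existence of the measure with the given moments\<close>

text \<open>\<open>t\<close> and \<open>e\<close> stand for \<open>z * z'\<close> and
  \<open>z + z'\<close>, so that \<open>[:t, e, 1:]\<close> is (z + c)(z' + c) as a polynomial in c.
  Both are real for admissible parameters, which allows a group algebra over the reals.\<close>

definition moment_val :: "real \<Rightarrow> real \<Rightarrow> nat \<Rightarrow> real" where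
  "moment_val t e l = t * hook_sum [:t, e, 1:] l 0 0 / (fact l * (l + 1) * pochhammer t (l + 1))"

theorem discrete_moments:
  assumes t: "t > 0" and pos: "\<And>m::int. poly [:t, e, 1:] (of_int m) \<ge> 0"
  obtains w :: "nat \<Rightarrow> real \<Rightarrow> real" where "\<And>n c. c \<in> iset n \<Longrightarrow> w n c \<ge> 0"
    "\<And>n. (\<Sum>c\<in>iset n. w n c) = 1"
    "\<And>l. (\<lambda>n. \<Sum>c\<in>iset n. w n c * (c / (n + 1)) ^ l) \<longlonglongrightarrow> moment_val t e l"
proof -
  define \<kappa> where "\<kappa> = [:t, e, 1:]"
  define D where "D = JMprod (\<lambda>_. \<kappa>)"
  define w where "w n c = tau (D (Suc n) * ev (lagr (iset n) c) (JM n)) / tau (D (Suc n))" for n c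
  have tD: "tau (D n) = pochhammer t n" for n by (simp add: D_def \<kappa>_def tau_JMprod)
  then have tD0: "tau (D n) > 0" for n using t by (simp add: pochhammer_pos)
  have sq: "\<exists>B. D n = B * B \<and> star B = B \<and> (\<forall>m. Suc m = n \<longrightarrow> (\<forall>p. B * ev p (JM m) = ev p (JM m) * B))" for n
  proof -
    obtain r where r: "D n = JMprod r n * JMprod r n"
      unfolding D_def using JMprod_sqrt[of \<kappa> n] pos by (auto simp: \<kappa>_def)
    have "JMprod r (Suc m) * ev p (JM m) = ev p (JM m) * JMprod r (Suc m)" for m p
    proof -
      have 1: "ev (r m) (JM m) * ev p (JM m) = ev p (JM m) * ev (r m) (JM m)" by (rule ev_commute_ev[OF refl])
      have "JMprod r (Suc m) * ev p (JM m) = JMprod r m * (ev (r m) (JM m) * ev p (JM m))" by (simp add: mult.assoc)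
      also have "\<dots> = (JMprod r m * ev p (JM m)) * ev (r m) (JM m)" by (simp only: 1 mult.assoc)
      finally show ?thesis by (simp add: JMprod_commute_ev mult.assoc)
    qed
    then show ?thesis using r by (intro exI[of _ "JMprod r n"]) auto
  qed
  \<comment> \<open>\<open>D (Suc n)\<close> is the square of a self-adjoint \<open>B\<close>
    commuting with the spectral projection, so the weight is the trace of an element times its
    adjoint.\<close>
  have wpos: "w n c \<ge> 0" if c: "c \<in> iset n" for n c
  proof -
    obtain B where B: "D (Suc n) = B * B" "star B = B" "\<And>p. B * ev p (JM n) = ev p (JM n) * B"
      using sq[of "Suc n"] by auto
    let ?e = "ev (lagr (iset n) c) (JM n)"
    have "?e * ?e = ?e"
      using JM_lagr_ev[OF c, of "lagr (iset n) c"] c by (simp add: poly_lagr)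
    have "(B * ?e) * star (B * ?e) = B * (?e * ?e) * B" by (simp add: star_ev B(2) mult.assoc)
    also have "\<dots> = B * (?e * B)" unfolding \<open>?e * ?e = ?e\<close> by (simp add: mult.assoc)
    also have "\<dots> = D (Suc n) * ?e" by (simp add: B(1) B(3)[symmetric] mult.assoc)
    finally have "tau (D (Suc n) * ?e) \<ge> 0" using tau_mult_star_nonneg[of "B * ?e"] by simp
    then show ?thesis using tD0[of "Suc n"] by (simp add: w_def)
  qed
  have wsum: "(\<Sum>c\<in>iset n. poly p c * w n c) = tau (D (Suc n) * ev p (JM n)) / tau (D (Suc n))" for n p
    unfolding w_def JM_ev_eq[of p n] by (simp add: sum_distrib_left mult_sc_left tau_sum sum_divide_distrib)
  have w1: "(\<Sum>c\<in>iset n. w n c) = 1" for n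
    using wsum[where p = 1] tD0[of "Suc n"] by simp
  have bound: "\<bar>tau (D n * delta g)\<bar> \<le> tau (D n)" for n g
    using sq[of n] tau_square_bound[of "D n"] by blast
  \<comment> \<open>By coherence the normalised trace of an (l+1)-cycle equals its value in
    \<open>Sym (Suc l)\<close>, where the cycle is full.\<close>
  have cv: "tau (D (Suc n) * delta (cyc [0..<Suc l])) / tau (D (Suc n)) = moment_val t e l" if "l \<le> n" for n l
  proof -
    have "cyc [0..<Suc l] \<in> Sym (Suc l)" by (rule cyc_Sym) auto
    from tau_JMprod_coherent[OF this, of "Suc n" t e] that
    have "tau (D (Suc n) * delta (cyc [0..<Suc l])) * pochhammer t (Suc l)
        = pochhammer t (Suc n) * tau (D (Suc l) * delta (cyc [0..<Suc l]))"
      by (simp add: D_def \<kappa>_def del: upt_Suc JMprod.simps)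
    also have "tau (D (Suc l) * delta (cyc [0..<Suc l])) = t * hook_sum \<kappa> l 0 0 / (fact l * (real l + 1))"
    proof -
      have "poly \<kappa> 0 = t" by (simp add: \<kappa>_def)
      then show ?thesis
        unfolding D_def tau_full_cycle by (simp only: of_nat_mult of_nat_fact of_nat_add of_nat_1)
    qed
    finally have 1: "tau (D (Suc n) * delta (cyc [0..<Suc l])) * pochhammer t (Suc l)
      = pochhammer t (Suc n) * (t * hook_sum \<kappa> l 0 0 / (fact l * (real l + 1)))" .
    have p: "pochhammer t (Suc l) \<noteq> 0" "pochhammer t (Suc n) \<noteq> 0" using t pochhammer_pos[of t] by (metis less_irrefl)+
    have "X / Q = Y / P" if "X * P = Q * Y" "P \<noteq> 0" "Q \<noteq> 0" for X Y P Q :: real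
      using that by (simp add: frac_eq_eq mult.commute)
    from this[OF 1 p]
    have "tau (D (Suc n) * delta (cyc [0..<Suc l])) / tau (D (Suc n))
      = t * hook_sum \<kappa> l 0 0 / (fact l * (real l + 1)) / pochhammer t (l + 1)"
      unfolding tD by simp
    then show ?thesis unfolding moment_val_def \<kappa>_def divide_divide_eq_left .
  qed
  have lim: "(\<lambda>n. \<Sum>c\<in>iset n. w n c * (c / (n + 1)) ^ l) \<longlonglongrightarrow> moment_val t e l" for l
  proof -
    define N where "N n = real (\<Prod>{n - l + 1..n})" for n
    let ?s = "\<lambda>n. \<Sum>c\<in>iset n. w n c * (c / (n + 1)) ^ l"
    have s: "?s n = tau (D (Suc n) * JM n ^ l) / tau (D (Suc n)) / real (Suc n) ^ l" for n
    proof -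
      have "(\<Sum>c\<in>iset n. poly ([:0, 1:] ^ l) c * w n c) = tau (D (Suc n) * JM n ^ l) / tau (D (Suc n))"
        unfolding wsum ev_power by simp
      then show ?thesis
        by (simp add: power_divide sum_divide_distrib[symmetric] mult.commute add.commute)
    qed
    have bd: "\<bar>?s n - N n / real (Suc n) ^ l * moment_val t e l\<bar> \<le> (real n / real (Suc n)) ^ l - N n / real (Suc n) ^ l"
      if n: "l \<le> n" for n
    proof -
      let ?T = "tau (D (Suc n))" and ?Q = "real (Suc n) ^ l"
      have b: "\<bar>tau (D (Suc n) * JM n ^ l) - N n * tau (D (Suc n) * delta (cyc [0..<Suc l]))\<bar> \<le> (real n ^ l - N n) * ?T"
        unfolding N_def by (rule tau_JM_power_bound[OF _ bound n]) (simp add: D_def)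
      have pos: "?T * ?Q > 0" using tD0 by simp
      have "?s n - N n / ?Q * moment_val t e l = (tau (D (Suc n) * JM n ^ l) - N n * tau (D (Suc n) * delta (cyc [0..<Suc l]))) / (?T * ?Q)"
        unfolding s cv[OF n, symmetric] by (simp add: diff_divide_distrib mult_ac del: upt_Suc)
      then have "\<bar>?s n - N n / ?Q * moment_val t e l\<bar> \<le> ((real n ^ l - N n) * ?T) / (?T * ?Q)"
        using b pos by (simp only: abs_divide abs_of_pos divide_right_mono)
      also have "\<dots> = (real n / real (Suc n)) ^ l - N n / ?Q"
        using tD0[of "Suc n"] by (simp add: power_divide diff_divide_distrib[symmetric])
      finally show ?thesis .
    qed
    have "(\<lambda>n. (real n / real (Suc n)) ^ l - N n / real (Suc n) ^ l) \<longlonglongrightarrow> 1 ^ l - 1"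
      unfolding N_def by (intro tendsto_diff tendsto_power falling_ratio_tendsto) real_asymp
    then have z: "(\<lambda>n. (real n / real (Suc n)) ^ l - N n / real (Suc n) ^ l) \<longlonglongrightarrow> 0" by simp
    have "(\<lambda>n. ?s n - N n / real (Suc n) ^ l * moment_val t e l) \<longlonglongrightarrow> 0"
    proof (rule Lim_null_comparison[OF _ z])
      show "\<forall>\<^sub>F n in sequentially. norm (?s n - N n / real (Suc n) ^ l * moment_val t e l)
          \<le> (real n / real (Suc n)) ^ l - N n / real (Suc n) ^ l"
        unfolding real_norm_def by (rule eventually_sequentiallyI[of l]) (rule bd)
    qed
    moreover have "(\<lambda>n. N n / real (Suc n) ^ l * moment_val t e l) \<longlonglongrightarrow> 1 * moment_val t e l"
      unfolding N_def by (intro tendsto_mult falling_ratio_tendsto tendsto_const)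
    ultimately have "(\<lambda>n. (?s n - N n / real (Suc n) ^ l * moment_val t e l) + N n / real (Suc n) ^ l * moment_val t e l)
       \<longlonglongrightarrow> 0 + 1 * moment_val t e l" by (rule tendsto_add)
    then show ?thesis by simp
  qed
  show ?thesis by (rule that[of w]) (use wpos w1 lim in auto)
qed

theorem moment_measure_exists:
  assumes t: "t > 0" and pos: "\<And>m::int. poly [:t, e, 1:] (of_int m) \<ge> 0"
  obtains M :: "real measure" where "sets M = sets borel" "finite_measure M"
    "emeasure M (UNIV - {-1..1}) = 0" "\<And>l. (\<integral>x. x ^ l \<partial>M) = moment_val t e l"
proof -
  obtain w :: "nat \<Rightarrow> real \<Rightarrow> real" where w: "\<And>n c. c \<in> iset n \<Longrightarrow> w n c \<ge> 0"
    "\<And>n. (\<Sum>c\<in>iset n. w n c) = 1"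
    "\<And>l. (\<lambda>n. \<Sum>c\<in>iset n. w n c * (c / (n + 1)) ^ l) \<longlonglongrightarrow> moment_val t e l"
    by (rule discrete_moments[OF assms]) blast
  define p where "p n = embed_pmf (\<lambda>c. if c \<in> iset n then w n c else 0)" for n
  have pm: "pmf (p n) c = (if c \<in> iset n then w n c else 0)" for n c
    unfolding p_def
  proof (rule pmf_embed_pmf)
    have "(\<integral>\<^sup>+ c. ennreal (if c \<in> iset n then w n c else 0) \<partial>count_space UNIV) = (\<Sum>c\<in>iset n. ennreal (w n c))"
      by (subst nn_integral_count_space'[of "iset n"]) auto
    also have "\<dots> = 1" using w(1,2) by (simp add: sum_ennreal)
    finally show "(\<integral>\<^sup>+ c. ennreal (if c \<in> iset n then w n c else 0) \<partial>count_space UNIV) = 1" .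
  qed (use w in auto)
  have sp: "set_pmf (p n) \<subseteq> iset n" for n by (auto simp: set_pmf_eq pm)
  define \<mu> where "\<mu> n = distr (measure_pmf (p n)) borel (\<lambda>c. c / (real n + 1))" for n
  have rd: "real_distribution (\<mu> n)" for n
    unfolding \<mu>_def real_distribution_def real_distribution_axioms_def
    by (auto intro!: prob_space.prob_space_distr measure_pmf.prob_space_axioms)
  have int: "(\<integral>x. h x \<partial>\<mu> n) = (\<Sum>c\<in>iset n. w n c * h (c / (n + 1)))"
    if [measurable]: "h \<in> borel_measurable borel" for h :: "real \<Rightarrow> real" and n
  proof -
    have "(\<integral>x. h x \<partial>\<mu> n) = (\<integral>c. h (c / (n + 1)) \<partial>measure_pmf (p n))"
      unfolding \<mu>_def by (subst integral_distr) (auto simp: add.commute)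
    also have "\<dots> = (\<Sum>c\<in>iset n. h (c / (n + 1)) * pmf (p n) c)"
      by (rule integral_measure_pmf_real[of "iset n"]) (use sp in auto)
    also have "\<dots> = (\<Sum>c\<in>iset n. w n c * h (c / (n + 1)))" by (intro sum.cong) (auto simp: pm)
    finally show ?thesis .
  qed
  have inI: "\<bar>c / (n + 1)\<bar> \<le> 1" if "c \<in> iset n" for c and n :: nat
    using that by (auto simp: iset_def abs_le_iff divide_simps)
  \<comment> \<open>Tightness is phrased with intervals open on the left; the margin around [-1, 1]
    keeps the point -1 inside.\<close>
  have m1: "measure (\<mu> n) {-2<..2} = 1" for n
  proof -
    have "measure (\<mu> n) {-2<..2} = (\<integral>x. indicator {-2<..2} x \<partial>\<mu> n)" by (simp add: \<mu>_def)
    also have "\<dots> = (\<Sum>c\<in>iset n. w n c * indicator {-2<..2} (c / (n + 1)))" by (rule int) simp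
    also have "\<dots> = (\<Sum>c\<in>iset n. w n c)"
    proof (intro sum.cong refl)
      fix c assume "c \<in> iset n"
      have "y \<in> {-2<..2}" if "\<bar>y\<bar> \<le> 1" for y :: real using that by auto
      from this[OF inI[OF \<open>c \<in> iset n\<close>]] have "c / (n + 1) \<in> {-2<..2}" .
      then show "w n c * indicator {-2<..2} (c / (n + 1)) = w n c" by simp
    qed
    finally show ?thesis by (simp add: w)
  qed
  have "tight \<mu>" unfolding tight_def
  proof (intro conjI allI impI rd)
    fix \<epsilon> :: real assume "\<epsilon> > 0"
    then show "\<exists>a b. a < b \<and> (\<forall>n. 1 - \<epsilon> < measure (\<mu> n) {a<..b})"
      by (intro exI[of _ "-2"] exI[of _ 2]) (simp add: m1)
  qed
  from tight_imp_convergent_subsubsequence[OF this strict_mono_id] obtain r M where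
    r: "strict_mono (r :: nat \<Rightarrow> nat)" and M: "real_distribution M" and wc: "weak_conv_m (\<mu> \<circ> id \<circ> r) M" by blast
  interpret M: real_distribution M by (rule M)
  have lim: "(\<lambda>n. integral\<^sup>L (\<mu> (r n)) h) \<longlonglongrightarrow> integral\<^sup>L M h"
    if "\<And>x. isCont h x" "\<And>x. \<bar>h x\<bar> \<le> 1" for h :: "real \<Rightarrow> real"
    using weak_conv_imp_integral_bdd_continuous_conv[of "\<lambda>n. \<mu> (r n)" M h 1] rd M wc that by (simp add: comp_def)
  \<comment> \<open>A bounded continuous function vanishing exactly on [-1, 1]. Its integrals
    against the approximating measures are 0, hence so is that against the limit, which therefore
    has no mass outside.\<close>
  define bump where "bump x = min 1 (max 0 (\<bar>x\<bar> - 1))" for x :: real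
  have [measurable]: "bump \<in> borel_measurable borel" unfolding bump_def by measurable
  have "(\<lambda>n. integral\<^sup>L (\<mu> (r n)) bump) \<longlonglongrightarrow> integral\<^sup>L M bump"
  proof (rule lim)
    show "isCont bump x" for x unfolding bump_def by (intro continuous_intros)
  qed (auto simp: bump_def)
  moreover have "integral\<^sup>L (\<mu> n) bump = 0" for n
    unfolding int[OF \<open>bump \<in> _\<close>] by (intro sum.neutral ballI) (use inI in \<open>auto simp: bump_def\<close>)
  ultimately have "(\<lambda>n::nat. 0) \<longlonglongrightarrow> integral\<^sup>L M bump" by simp
  from LIMSEQ_unique[OF this tendsto_const] have b0: "integral\<^sup>L M bump = 0" .
  have "AE x in M. bump x = 0"
  proof (subst integral_nonneg_eq_0_iff_AE[symmetric])
    show "integrable M bump"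
      by (rule M.integrable_const_bound[of _ 1]) (auto simp: bump_def)
  qed (use b0 in \<open>auto simp: bump_def\<close>)
  then have ae: "AE x in M. x \<in> {-1..1}"
    by eventually_elim (auto simp: bump_def min_def max_def split: if_splits)
  have null: "emeasure M (UNIV - {-1..1}) = 0"
  proof (subst AE_iff_measurable[symmetric, where P = "\<lambda>x. x \<in> {-1..1}"])
    show "UNIV - {-1..1} \<in> sets M" by simp
    show "{x \<in> space M. x \<notin> {- 1..1}} = UNIV - {- 1..1}" by auto
    show "AE x in M. x \<in> {-1..1}" by (rule ae)
  qed
  have mom: "(\<integral>x. x ^ l \<partial>M) = moment_val t e l" for l
  proof -
    \<comment> \<open>The power is clamped outside [-1, 1] to become a bounded test function; all
      the measures involved live where the clamping has no effect.\<close>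
    define h where "h x = (max (-1) (min 1 x)) ^ l" for x :: real
    have [measurable]: "h \<in> borel_measurable borel" unfolding h_def by measurable
    have "(\<lambda>n. integral\<^sup>L (\<mu> (r n)) h) \<longlonglongrightarrow> integral\<^sup>L M h"
    proof (rule lim)
      show "isCont h x" for x unfolding h_def by (intro continuous_intros)
      have "\<bar>max (-1) (min 1 x)\<bar> \<le> 1" for x :: real by auto
      then show "\<bar>h x\<bar> \<le> 1" for x unfolding h_def power_abs by (intro power_le_one) auto
    qed
    moreover have "integral\<^sup>L (\<mu> n) h = (\<Sum>c\<in>iset n. w n c * (c / (n + 1)) ^ l)" for n
      unfolding int[OF \<open>h \<in> _\<close>]
    proof (intro sum.cong refl)
      fix c assume "c \<in> iset n"
      have "max (-1) (min 1 y) = y" if "\<bar>y\<bar> \<le> 1" for y :: real using that by auto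
      from this[OF inI[OF \<open>c \<in> iset n\<close>]] have "max (-1) (min 1 (c / (n + 1))) = c / (n + 1)" .
      then show "w n c * h (c / (n + 1)) = w n c * (c / (n + 1)) ^ l" by (simp add: h_def)
    qed
    moreover have "(\<lambda>n. \<Sum>c\<in>iset (r n). w (r n) c * (c / (r n + 1)) ^ l) \<longlonglongrightarrow> moment_val t e l"
      using LIMSEQ_subseq_LIMSEQ[OF w(3) r] by (simp add: comp_def)
    ultimately have "integral\<^sup>L M h = moment_val t e l"
      by (intro LIMSEQ_unique[of "\<lambda>n. integral\<^sup>L (\<mu> (r n)) h"]) simp_all
    moreover have "integral\<^sup>L M h = (\<integral>x. x ^ l \<partial>M)"
    proof (rule integral_cong_AE)
      show "AE x in M. h x = x ^ l" using ae by eventually_elim (auto simp: h_def)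
    qed auto
    ultimately show ?thesis by simp
  qed
  show ?thesis by (rule that[of M]) (use null mom M.finite_measure_axioms in auto)
qed

lemma pochhammer_prod_minus:
  fixes z :: complex
  shows "(\<Prod>j<i. z - 1 - of_nat j) = (- 1) ^ i * pochhammer (- z + 1) i"
proof -
  have "(\<Prod>j<i. z - 1 - of_nat j) = (\<Prod>j<i. (- 1) * (- z + 1 + of_nat j))" by (intro prod.cong) auto
  also have "\<dots> = (- 1) ^ i * (\<Prod>j<i. - z + 1 + of_nat j)" by (simp only: prod.distrib prod_constant) simp
  finally show ?thesis by (simp add: pochhammer_prod atLeast0LessThan)
qed

lemma sigma_moment_moment_val:
  assumes t: "z * z' = of_real t" and e: "z + z' = of_real e"
  shows "sigma_moment z z' l = of_real (moment_val t e l)"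
proof -
  have k: "of_real (poly [:t, e, 1:] c) = (z + of_real c) * (z' + of_real c)" for c
    by (simp add: t[symmetric] e[symmetric] algebra_simps)
  have P: "(\<Prod>j<m. of_real (poly [:t, e, 1:] (real 0 + 1 + real j))) = pochhammer (z + 1) m * pochhammer (z' + 1) m" for m
    unfolding k by (simp add: pochhammer_prod atLeast0LessThan prod.distrib add_ac)
  have Q: "(\<Prod>j<m. of_real (poly [:t, e, 1:] (- real 0 - 1 - real j))) = pochhammer (- z + 1) m * pochhammer (- z' + 1) m" for m
  proof -
    have "(\<Prod>j<m. of_real (poly [:t, e, 1:] (- real 0 - 1 - real j))) = (\<Prod>j<m. z - 1 - of_nat j) * (\<Prod>j<m. z' - 1 - of_nat j)"
      unfolding k prod.distrib[symmetric] by (simp add: algebra_simps)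
    also have "\<dots> = ((- 1) ^ m * (- 1) ^ m) * (pochhammer (- z + 1) m * pochhammer (- z' + 1) m)"
      unfolding pochhammer_prod_minus by (simp only: mult_ac)
    finally show ?thesis by (simp add: power_add[symmetric])
  qed
  have "of_real (moment_val t e l) = of_real t * (\<Sum>i\<le>l. of_nat (l choose i) * (- 1) ^ i *
     ((pochhammer (z + 1) (l - i) * pochhammer (z' + 1) (l - i)) * (pochhammer (- z + 1) i * pochhammer (- z' + 1) i)))
     / (fact l * (of_nat l + 1) * pochhammer (of_real t) (l + 1))"
    unfolding moment_val_def hook_sum_def of_real_divide of_real_mult of_real_sum of_real_prod P Q
    by (simp add: pochhammer_of_real)
  also have "\<dots> = (\<Sum>i\<le>l. (- 1) ^ i * of_real t * pochhammer (z + 1) (l - i) * pochhammer (- z + 1) i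
          * pochhammer (z' + 1) (l - i) * pochhammer (- z' + 1) i
        / (pochhammer (of_real t) (l + 1) * of_nat (l + 1) * fact (l - i) * fact i))"
    unfolding sum_distrib_left sum_divide_distrib
  proof (intro sum.cong refl)
    fix i assume "i \<in> {..l}"
    then have b: "(of_nat (l choose i) :: complex) = fact l / (fact i * fact (l - i))"
      using binomial_fact[of i l] by simp
    show "of_real t * (of_nat (l choose i) * (- 1) ^ i *
     ((pochhammer (z + 1) (l - i) * pochhammer (z' + 1) (l - i)) * (pochhammer (- z + 1) i * pochhammer (- z' + 1) i)))
     / (fact l * (of_nat l + 1) * pochhammer (of_real t) (l + 1)) = (- 1) ^ i * of_real t * pochhammer (z + 1) (l - i) * pochhammer (- z + 1) i
          * pochhammer (z' + 1) (l - i) * pochhammer (- z' + 1) i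
        / (pochhammer (of_real t) (l + 1) * of_nat (l + 1) * fact (l - i) * fact i)"
      unfolding b by (simp add: divide_simps add.commute)
  qed
  also have "\<dots> = sigma_moment z z' l"
    unfolding sigma_moment_def Let_def t
    by (rule sum.reindex_bij_witness[of _ "\<lambda>p. l - p" "\<lambda>i. l - i"]) auto
  finally show ?thesis by simp
qed

section \<open>Moments determine densities on a compact interval\<close>

text \<open>Two weights on two measures, because this serves twice: for uniqueness of a measure, and
  to compare a weighted \<open>sigma1\<close> with a weight on Lebesgue measure. The weights are
  complex, since the analytic formula for the density is not known to be real in advance.\<close>

context
  fixes M N :: "real measure" and h k :: "real \<Rightarrow> complex"
  assumes sM [measurable_cong]: "sets M = sets borel" and sN [measurable_cong]: "sets N = sets borel"
    and h: "integrable M h" and k: "integrable N k"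
    and h0: "\<And>x. x \<notin> {-1..1} \<Longrightarrow> h x = 0" and k0: "\<And>x. x \<notin> {-1..1} \<Longrightarrow> k x = 0"
    and mom: "\<And>l. (\<integral>x. of_real (x ^ l) * h x \<partial>M) = (\<integral>x. of_real (x ^ l) * k x \<partial>N)"
begin

lemma bdd_mult_integrable:
  assumes "g \<in> borel_measurable borel" "\<And>x. x \<in> {-1..1} \<Longrightarrow> \<bar>g x\<bar> \<le> B"
  shows "integrable M (\<lambda>x. of_real (g x) * h x)" "integrable N (\<lambda>x. of_real (g x) * k x)"
proof -
  note [measurable] = assms(1) borel_measurable_integrable[OF h] borel_measurable_integrable[OF k]
  show "integrable M (\<lambda>x. of_real (g x) * h x)"
  proof (rule Bochner_Integration.integrable_bound[OF integrable_mult_right[OF integrable_norm[OF h], of B]])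
    show "AE x in M. norm (of_real (g x) * h x) \<le> norm (B * norm (h x))"
    proof (rule AE_I2)
      fix x show "norm (of_real (g x) * h x) \<le> norm (B * norm (h x))"
      proof (cases "x \<in> {-1..1}")
        case True
        then have "\<bar>g x\<bar> * norm (h x) \<le> B * norm (h x)" using assms(2) by (intro mult_right_mono) auto
        then show ?thesis by (simp add: norm_mult)
      qed (simp add: h0)
    qed
  qed measurable
  show "integrable N (\<lambda>x. of_real (g x) * k x)"
  proof (rule Bochner_Integration.integrable_bound[OF integrable_mult_right[OF integrable_norm[OF k], of B]])
    show "AE x in N. norm (of_real (g x) * k x) \<le> norm (B * norm (k x))"
    proof (rule AE_I2)
      fix x show "norm (of_real (g x) * k x) \<le> norm (B * norm (k x))"
      proof (cases "x \<in> {-1..1}")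
        case True
        then have "\<bar>g x\<bar> * norm (k x) \<le> B * norm (k x)" using assms(2) by (intro mult_right_mono) auto
        then show ?thesis by (simp add: norm_mult)
      qed (simp add: k0)
    qed
  qed measurable
qed

lemma moments_poly:
  "(\<integral>x. of_real (\<Sum>i\<le>n. a i * x ^ i) * h x \<partial>M) = (\<integral>x. of_real (\<Sum>i\<le>n. a i * x ^ i) * k x \<partial>N)"
proof -
  have b: "\<bar>x ^ i\<bar> \<le> 1" if "x \<in> {-1..1}" for x :: real and i
    unfolding power_abs using that by (intro power_le_one) auto
  note I = bdd_mult_integrable[of "\<lambda>x. x ^ i" 1 for i, OF _ b, simplified]
  have "(\<integral>x. of_real (\<Sum>i\<le>n. a i * x ^ i) * h x \<partial>M) = (\<integral>x. (\<Sum>i\<le>n. of_real (a i) * (of_real (x ^ i) * h x)) \<partial>M)"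
    by (simp add: sum_distrib_right mult.assoc)
  also have "\<dots> = (\<Sum>i\<le>n. of_real (a i) * (\<integral>x. of_real (x ^ i) * h x \<partial>M))"
    using I by (subst Bochner_Integration.integral_sum) auto
  also have "\<dots> = (\<Sum>i\<le>n. of_real (a i) * (\<integral>x. of_real (x ^ i) * k x \<partial>N))"
    unfolding mom ..
  also have "\<dots> = (\<integral>x. (\<Sum>i\<le>n. of_real (a i) * (of_real (x ^ i) * k x)) \<partial>N)"
    using I by (subst Bochner_Integration.integral_sum) auto
  also have "\<dots> = (\<integral>x. of_real (\<Sum>i\<le>n. a i * x ^ i) * k x \<partial>N)"
    by (simp add: sum_distrib_right mult.assoc)
  finally show ?thesis .
qed

lemma moments_continuous:
  assumes g: "continuous_on UNIV g"
  shows "(\<integral>x. of_real (g x) * h x \<partial>M) = (\<integral>x. of_real (g x) * k x \<partial>N)"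
proof -
  have [measurable]: "g \<in> borel_measurable borel" using g by (rule borel_measurable_continuous_onI)
  have gc: "continuous_on {-1..1} g" using g continuous_on_subset by blast
  from compact_continuous_image[OF gc] have "bounded (g ` {-1..1})" by (simp add: compact_imp_bounded)
  then obtain B where B: "\<And>x. x \<in> {-1..1} \<Longrightarrow> \<bar>g x\<bar> \<le> B"
    unfolding bounded_iff by (metis image_eqI real_norm_def)
  let ?D = "(\<integral>x. of_real (g x) * h x \<partial>M) - (\<integral>x. of_real (g x) * k x \<partial>N)"
  define H where "H = (\<integral>x. norm (h x) \<partial>M) + (\<integral>x. norm (k x) \<partial>N)"
  have H0: "H \<ge> 0" unfolding H_def by (intro add_nonneg_nonneg integral_nonneg) auto
  have "norm ?D \<le> e * H" if e: "e > 0" for e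
  proof -
    obtain p where p: "real_polynomial_function p" "\<And>x. x \<in> {-1..1} \<Longrightarrow> \<bar>g x - p x\<bar> < e"
      by (rule Stone_Weierstrass_real_polynomial_function[OF compact_Icc gc e]) blast
    obtain a n where pe: "p = (\<lambda>x. \<Sum>i\<le>n. a i * x ^ i)" using p(1) unfolding real_polynomial_function_iff_sum by blast
    have [measurable]: "p \<in> borel_measurable borel" unfolding pe by measurable
    have pB: "\<bar>p x\<bar> \<le> B + e" if "x \<in> {-1..1}" for x using B[OF that] p(2)[OF that] by linarith
    note Ig = bdd_mult_integrable[of g B, OF _ B, simplified]
    note Ip = bdd_mult_integrable[of p "B + e", OF _ pB, simplified]
    have dB: "\<bar>g x - p x\<bar> \<le> e" if "x \<in> {-1..1}" for x using p(2)[OF that] by simp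
    note Id = bdd_mult_integrable[of "\<lambda>x. g x - p x" e, OF _ dB, simplified]
    have pp: "(\<integral>x. of_real (p x) * h x \<partial>M) = (\<integral>x. of_real (p x) * k x \<partial>N)" unfolding pe by (rule moments_poly)
    have 1: "(\<integral>x. of_real (g x) * h x \<partial>M) - (\<integral>x. of_real (p x) * h x \<partial>M) = (\<integral>x. of_real (g x - p x) * h x \<partial>M)"
      using Ig Ip by (subst Bochner_Integration.integral_diff[symmetric]) (auto simp: left_diff_distrib)
    have 2: "(\<integral>x. of_real (g x) * k x \<partial>N) - (\<integral>x. of_real (p x) * k x \<partial>N) = (\<integral>x. of_real (g x - p x) * k x \<partial>N)"
      using Ig Ip by (subst Bochner_Integration.integral_diff[symmetric]) (auto simp: left_diff_distrib)
    have n1: "norm (\<integral>x. of_real (g x - p x) * h x \<partial>M) \<le> e * (\<integral>x. norm (h x) \<partial>M)"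
    proof -
      have "norm (\<integral>x. of_real (g x - p x) * h x \<partial>M) \<le> (\<integral>x. e * norm (h x) \<partial>M)"
      proof (rule Bochner_Integration.integral_norm_bound_integral)
        fix x show "norm (of_real (g x - p x) * h x) \<le> e * norm (h x)"
        proof (cases "x \<in> {-1..1}")
          case True
          then show ?thesis unfolding norm_mult norm_of_real by (intro mult_right_mono dB) auto
        qed (simp add: h0)
      qed (use Id h in auto)
      then show ?thesis by simp
    qed
    have n2: "norm (\<integral>x. of_real (g x - p x) * k x \<partial>N) \<le> e * (\<integral>x. norm (k x) \<partial>N)"
    proof -
      have "norm (\<integral>x. of_real (g x - p x) * k x \<partial>N) \<le> (\<integral>x. e * norm (k x) \<partial>N)"
      proof (rule Bochner_Integration.integral_norm_bound_integral)
        fix x show "norm (of_real (g x - p x) * k x) \<le> e * norm (k x)"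
        proof (cases "x \<in> {-1..1}")
          case True
          then show ?thesis unfolding norm_mult norm_of_real by (intro mult_right_mono dB) auto
        qed (simp add: k0)
      qed (use Id k in auto)
      then show ?thesis by simp
    qed
    have "?D = (\<integral>x. of_real (g x - p x) * h x \<partial>M) - (\<integral>x. of_real (g x - p x) * k x \<partial>N)"
      unfolding 1[symmetric] 2[symmetric] using pp by simp
    then have "norm ?D \<le> norm (\<integral>x. of_real (g x - p x) * h x \<partial>M) + norm (\<integral>x. of_real (g x - p x) * k x \<partial>N)"
      by (simp only: norm_triangle_ineq4)
    then show ?thesis using n1 n2 by (simp add: H_def distrib_left)
  qed note le = this
  have "norm ?D \<le> 0 + e" if "e > 0" for e
  proof -
    have "norm ?D \<le> (e / (H + 1)) * H" by (rule le) (use that H0 in auto)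
    also have "\<dots> \<le> e" using that H0 by (simp add: divide_simps)
    finally show ?thesis by simp
  qed
  then have "norm ?D \<le> 0" by (rule field_le_epsilon)
  then show ?thesis by simp
qed

text \<open>Continuous ramps starting at \<open>a\<close> with slope \<open>n\<close> converge
  pointwise to the indicator of the open ray, also at \<open>a\<close> itself, and dominated
  convergence passes to the limit.\<close>

theorem moments_tail:
  "(\<integral>x. of_real (indicator {a<..} x) * h x \<partial>M) = (\<integral>x. of_real (indicator {a<..} x) * k x \<partial>N)"
proof -
  note [measurable] = borel_measurable_integrable[OF h] borel_measurable_integrable[OF k]
  define g where "g n x = min 1 (max 0 (real n * (x - a)))" for n x
  have gc: "continuous_on UNIV (g n)" for n unfolding g_def by (intro continuous_intros)
  have [measurable]: "g n \<in> borel_measurable borel" for n using gc by (rule borel_measurable_continuous_onI)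
  have glim: "(\<lambda>n. g n x) \<longlonglongrightarrow> indicator {a<..} x" for x
  proof (cases "x > a")
    case True
    have "\<forall>\<^sub>F n in sequentially. real n \<ge> 1 / (x - a)"
      by (meson eventually_at_top_linorder real_arch_simple of_nat_le_iff order_trans)
    then have "\<forall>\<^sub>F n in sequentially. g n x = 1"
      by eventually_elim (use True in \<open>auto simp: g_def min_def max_def field_simps\<close>)
    then show ?thesis using True by (simp add: tendsto_eventually)
  next
    case False
    then have "real n * (x - a) \<le> 0" for n by (simp add: mult_nonneg_nonpos)
    then show ?thesis using False by (simp add: g_def)
  qed
  have gb: "norm (of_real (g n x) * w) \<le> norm w" for n x and w :: complex
  proof -
    have "\<bar>g n x\<bar> \<le> 1" by (auto simp: g_def)
    then show ?thesis unfolding norm_mult norm_of_real using mult_right_mono[of "\<bar>g n x\<bar>" 1 "norm w"] by simp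
  qed
  have 1: "(\<lambda>n. \<integral>x. of_real (g n x) * h x \<partial>M) \<longlonglongrightarrow> (\<integral>x. of_real (indicator {a<..} x) * h x \<partial>M)"
  proof (rule integral_dominated_convergence[where w = "\<lambda>x. norm (h x)"])
    show "AE x in M. (\<lambda>n. of_real (g n x) * h x) \<longlonglongrightarrow> of_real (indicator {a<..} x) * h x"
      by (intro AE_I2 tendsto_intros glim)
  qed (use h gb in auto)
  have 2: "(\<lambda>n. \<integral>x. of_real (g n x) * k x \<partial>N) \<longlonglongrightarrow> (\<integral>x. of_real (indicator {a<..} x) * k x \<partial>N)"
  proof (rule integral_dominated_convergence[where w = "\<lambda>x. norm (k x)"])
    show "AE x in N. (\<lambda>n. of_real (g n x) * k x) \<longlonglongrightarrow> of_real (indicator {a<..} x) * k x"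
      by (intro AE_I2 tendsto_intros glim)
  qed (use k gb in auto)
  show ?thesis using LIMSEQ_unique[OF 1] 2 unfolding moments_continuous[OF gc] by blast
qed

end

lemma finite_measure_moments:
  fixes M :: "real measure"
  assumes s: "sets M = sets borel" and f: "finite_measure M" and n: "emeasure M (UNIV - {-1..1}) = 0"
  shows "integrable M (\<lambda>x. indicator {-1..1} x :: complex)"
    "(\<integral>x. of_real (x ^ l) * indicator {-1..1} x \<partial>M) = complex_of_real (\<integral>x. x ^ l \<partial>M)"
    "(\<integral>x. of_real (indicator {a<..} x) * indicator {-1..1} x \<partial>M) = complex_of_real (measure M {a<..})"
proof -
  interpret finite_measure M by fact
  note [measurable_cong] = s
  have ae: "AE x in M. x \<in> {-1..1}"
    by (rule AE_I[of _ _ "UNIV - {-1..1}"]) (use n s in auto)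
  show "integrable M (\<lambda>x. indicator {-1..1} x :: complex)"
    by (rule integrable_const_bound[of _ 1]) (auto simp: indicator_def)
  have "(\<integral>x. of_real (x ^ l) * indicator {-1..1} x \<partial>M) = (\<integral>x. complex_of_real (x ^ l) \<partial>M)"
    by (rule integral_cong_AE) (use ae in auto)
  then show "(\<integral>x. of_real (x ^ l) * indicator {-1..1} x \<partial>M) = complex_of_real (\<integral>x. x ^ l \<partial>M)"
    by (simp only: integral_complex_of_real)
  have "(\<integral>x. of_real (indicator {a<..} x) * indicator {-1..1} x \<partial>M) = (\<integral>x. complex_of_real (indicator {a<..} x) \<partial>M)"
    by (rule integral_cong_AE) (use ae in auto)
  then show "(\<integral>x. of_real (indicator {a<..} x) * indicator {-1..1} x \<partial>M) = complex_of_real (measure M {a<..})"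
    using sets_eq_imp_space_eq[OF s] by simp
qed

theorem moments_unique:
  fixes M N :: "real measure"
  assumes "sets M = sets borel" "finite_measure M" "emeasure M (UNIV - {-1..1}) = 0"
    and "sets N = sets borel" "finite_measure N" "emeasure N (UNIV - {-1..1}) = 0"
    and mom: "\<And>l. (\<integral>x. x ^ l \<partial>M) = (\<integral>x. x ^ l \<partial>N)"
  shows "M = N"
proof (rule measure_eqI_lessThan)
  interpret M: finite_measure M by fact
  interpret N: finite_measure N by fact
  fix a :: real
  show "emeasure M {a<..} < \<infinity>" by (simp add: M.emeasure_eq_measure)
  have "complex_of_real (measure M {a<..}) = complex_of_real (measure N {a<..})"
    unfolding finite_measure_moments(3)[OF assms(1-3), symmetric] finite_measure_moments(3)[OF assms(4-6), symmetric]
    by (rule moments_tail) (use assms finite_measure_moments in auto)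
  then show "emeasure M {a<..} = emeasure N {a<..}"
    by (simp add: M.emeasure_eq_measure N.emeasure_eq_measure)
qed (use assms in auto)

section \<open>The pairing as a power series\<close>

lemma phi_alt: "phi a u = (if u > 0 then exp (a * of_real (ln u)) / Gamma (a + 1) else 0)"
  by (simp add: phi_def powr_def Ln_of_real)

lemma phi_measurable [measurable]: "phi a \<in> borel_measurable borel"
  unfolding phi_alt[abs_def] by measurable

lemma norm_phi: "norm (phi a u) = (if u > 0 then u powr Re a / norm (Gamma (a + 1)) else 0)"
  by (simp add: phi_def norm_divide norm_powr_real_powr)

lemma Gamma_nz: "Re a > - 1 \<Longrightarrow> Gamma (a + 1) \<noteq> 0"
proof -
  assume "Re a > - 1"
  then have "a + 1 \<notin> \<int>\<^sub>\<le>\<^sub>0" by (auto elim!: nonpos_Ints_cases simp: complex_eq_iff)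
  then show ?thesis by (simp add: Gamma_eq_zero_iff)
qed

lemma phi_scale: "w > 0 \<Longrightarrow> phi a (w * u) = of_real w powr a * phi a u"
  by (auto simp: phi_alt powr_def Ln_of_real ln_mult zero_less_mult_iff distrib_left exp_add)

text \<open>The factor 1/Gamma(a+1) is exactly what normalises the integral against the exponential.
  This later fixes the constant in the convolution formula.\<close>

lemma phi_exp:
  assumes a: "Re a > - 1"
  shows "integrable lborel (\<lambda>u. of_real (exp (- u)) * phi a u)"
    and "(\<integral>u. of_real (exp (- u)) * phi a u \<partial>lborel) = 1"
proof -
  let ?g = "\<lambda>t. of_real t powr (a + 1 - 1) / of_real (exp t) :: complex"
  have eq: "of_real (exp (- u)) * phi a u = (indicator {0<..} u *\<^sub>R ?g u) / Gamma (a + 1)" for u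
    by (auto simp: phi_def exp_minus field_simps)
  have Re: "Re (a + 1) > 0" using a by simp
  have m: "(\<lambda>u. indicator {0<..} u *\<^sub>R ?g u) \<in> borel_measurable lborel"
  proof -
    have "(\<lambda>u. indicator {0<..} u *\<^sub>R ?g u) = (\<lambda>u. (of_real (exp (- u)) * phi a u) * Gamma (a + 1))"
    proof -
      have "y / Gamma (a + 1) * Gamma (a + 1) = y" for y using Gamma_nz[OF a] by simp
      then show ?thesis by (intro ext) (simp only: eq)
    qed
    then show ?thesis by simp
  qed
  have "set_integrable lebesgue {0<..} ?g"
    using absolutely_integrable_Gamma_integral'[OF Re] by simp
  then have "integrable lborel (\<lambda>u. indicator {0<..} u *\<^sub>R ?g u)"
    unfolding set_integrable_def using m by (simp add: integrable_completion)
  then have si: "set_integrable lborel {0<..} ?g" by (simp add: set_integrable_def)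
  have "(LINT u:{0<..}|lborel. ?g u) = integral {0<..} ?g" by (rule set_borel_integral_eq_integral[OF si])
  also have "\<dots> = Gamma (a + 1)" by (rule integral_unique[OF Gamma_integral_complex'[OF Re]])
  finally have v: "(\<integral>u. indicator {0<..} u *\<^sub>R ?g u \<partial>lborel) = Gamma (a + 1)"
    by (simp add: set_lebesgue_integral_def)
  show "integrable lborel (\<lambda>u. of_real (exp (- u)) * phi a u)"
    unfolding eq using si by (simp add: set_integrable_def)
  show "(\<integral>u. of_real (exp (- u)) * phi a u \<partial>lborel) = 1"
    unfolding eq using v Gamma_nz[OF a] by simp
qed

lemma phi_conv_zero: "w \<le> 0 \<Longrightarrow> phi a x * phi b (w - x) = 0"
  by (auto simp: phi_def)

lemma phi_conv_integrable:
  assumes a: "Re a > - 1" and b: "Re b > - 1"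
  shows "integrable lborel (\<lambda>x. phi a x * phi b (w - x))"
proof (cases "w > 0")
  case False
  then show ?thesis by (simp add: phi_conv_zero)
next
  case True
  have "integrable lborel (\<lambda>x. indicator {0..1} x *\<^sub>R (x powr Re a * (1 - x) powr Re b))"
    using integrable_Beta[of "Re a + 1" "Re b + 1"] a b by (simp add: set_integrable_def)
  then have "integrable lborel (\<lambda>x. (1 / (norm (Gamma (a + 1)) * norm (Gamma (b + 1)))) * (indicator {0..1} x *\<^sub>R (x powr Re a * (1 - x) powr Re b)))"
    by (rule integrable_mult_right)
  then have 1: "integrable lborel (\<lambda>x. phi a x * phi b (1 - x))"
  proof (rule Bochner_Integration.integrable_bound, simp, intro AE_I2)
    fix x :: real
    show "norm (phi a x * phi b (1 - x)) \<le> norm ((1 / (norm (Gamma (a + 1)) * norm (Gamma (b + 1)))) * (indicator {0..1} x *\<^sub>R (x powr Re a * (1 - x) powr Re b)))"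
      by (cases "0 < x \<and> x < 1") (simp_all add: norm_mult norm_phi abs_mult)
  qed
  have "integrable lborel (\<lambda>x. phi a (0 + w * x) * phi b (w - (0 + w * x)))"
  proof -
    have "phi a (0 + w * x) * phi b (w - (0 + w * x)) = (of_real w powr a * of_real w powr b) * (phi a x * phi b (1 - x))" for x
      using phi_scale[OF True, of a x] phi_scale[OF True, of b "1 - x"] by (simp add: right_diff_distrib)
    then show ?thesis using 1 by simp
  qed
  then show ?thesis using True by (subst (asm) lborel_integrable_real_affine_iff) auto
qed

lemma phi_conv_scale:
  assumes w: "w > 0"
  shows "(\<integral>x. phi a x * phi b (w - x) \<partial>lborel) = of_real w powr (a + b + 1) * (\<integral>x. phi a x * phi b (1 - x) \<partial>lborel)"
    and "(\<integral>x. norm (phi a x * phi b (w - x)) \<partial>lborel) = w powr (Re a + Re b + 1) * (\<integral>x. norm (phi a x * phi b (1 - x)) \<partial>lborel)"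
proof -
  have eq: "phi a (0 + w * x) * phi b (w - (0 + w * x)) = (of_real w powr a * of_real w powr b) * (phi a x * phi b (1 - x))" for x
    using phi_scale[OF w, of a x] phi_scale[OF w, of b "1 - x"] by (simp add: right_diff_distrib)
  have p: "of_real w * (of_real w powr a * of_real w powr b) = (of_real w :: complex) powr (a + b + 1)"
    using w by (simp add: powr_add)
  have "(\<integral>x. phi a x * phi b (w - x) \<partial>lborel) = \<bar>w\<bar> *\<^sub>R (\<integral>x. phi a (0 + w * x) * phi b (w - (0 + w * x)) \<partial>lborel)"
    by (rule lborel_integral_real_affine) (use w in simp)
  also have "\<dots> = of_real w powr (a + b + 1) * (\<integral>x. phi a x * phi b (1 - x) \<partial>lborel)"
    unfolding eq using w by (simp add: p[symmetric] scaleR_conv_of_real mult.assoc)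
  finally show "(\<integral>x. phi a x * phi b (w - x) \<partial>lborel) = of_real w powr (a + b + 1) * (\<integral>x. phi a x * phi b (1 - x) \<partial>lborel)" .
  have "(\<integral>x. norm (phi a x * phi b (w - x)) \<partial>lborel) = \<bar>w\<bar> *\<^sub>R (\<integral>x. norm (phi a (0 + w * x) * phi b (w - (0 + w * x))) \<partial>lborel)"
    by (rule lborel_integral_real_affine) (use w in simp)
  also have "\<dots> = w * norm ((of_real w :: complex) powr a * of_real w powr b) * (\<integral>x. norm (phi a x * phi b (1 - x)) \<partial>lborel)"
    unfolding eq norm_mult[of "of_real w powr a * of_real w powr b"] integral_mult_right_zero using w by simp
  also have "w * norm ((of_real w :: complex) powr a * of_real w powr b) = w powr (Re a + Re b + 1)"
    using w by (simp add: norm_mult norm_powr_real_powr powr_add)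
  finally show "(\<integral>x. norm (phi a x * phi b (w - x)) \<partial>lborel) = w powr (Re a + Re b + 1) * (\<integral>x. norm (phi a x * phi b (1 - x)) \<partial>lborel)" .
qed

text \<open>Convolutions of homogeneous functions are homogeneous, so a comparison at
  \<open>w = 1\<close> suffices. The version with norms supplies the inner integral needed for
  Fubini's theorem.\<close>

lemma phi_conv_phi_prop:
  assumes a: "Re a > - 1" and b: "Re b > - 1"
  shows "(\<integral>x. phi a x * phi b (w - x) \<partial>lborel)
     = (\<integral>x. phi a x * phi b (1 - x) \<partial>lborel) * Gamma (a + b + 2) * phi (a + b + 1) w"
    and "(\<integral>x. norm (phi a x * phi b (w - x)) \<partial>lborel)
     = (\<integral>x. norm (phi a x * phi b (1 - x)) \<partial>lborel) * norm (Gamma (a + b + 2)) * norm (phi (a + b + 1) w)"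
proof -
  have G: "Gamma (a + b + 2) \<noteq> 0" using Gamma_nz[of "a + b + 1"] a b by (simp add: add.assoc)
  have s: "a + b + 1 + 1 = a + b + 2" by simp
  show "(\<integral>x. phi a x * phi b (w - x) \<partial>lborel)
     = (\<integral>x. phi a x * phi b (1 - x) \<partial>lborel) * Gamma (a + b + 2) * phi (a + b + 1) w"
  proof (cases "w > 0")
    case True
    then show ?thesis unfolding phi_conv_scale(1)[OF True] using G by (simp add: phi_def s)
  next
    case False
    then have z: "phi a x * phi b (w - x) = 0" for x by (intro phi_conv_zero) simp
    show ?thesis unfolding z using False by (simp add: phi_def[of "a + b + 1"])
  qed
  show "(\<integral>x. norm (phi a x * phi b (w - x)) \<partial>lborel)
     = (\<integral>x. norm (phi a x * phi b (1 - x)) \<partial>lborel) * norm (Gamma (a + b + 2)) * norm (phi (a + b + 1) w)"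
  proof (cases "w > 0")
    case True
    then show ?thesis unfolding phi_conv_scale(2)[OF True] using G by (simp add: norm_phi s)
  next
    case False
    then have z: "phi a x * phi b (w - x) = 0" for x by (intro phi_conv_zero) simp
    show ?thesis unfolding z using False by (simp add: norm_phi)
  qed
qed

text \<open>By homogeneity the two sides differ by a constant \<open>K\<close>. Integrating both
  against the exponential and exchanging the order of integration yields \<open>K = 1\<close> from
  \<open>phi_exp\<close>. This is the Beta integral, valid here for complex exponents.\<close>

theorem phi_convolution:
  assumes a: "Re a > - 1" and b: "Re b > - 1"
  shows "(\<integral>x. phi a x * phi b (w - x) \<partial>lborel) = phi (a + b + 1) w"
proof -
  define F where "F x w = of_real (exp (- w)) * (phi a x * phi b (w - x))" for x w :: real
  have F1: "F x (x + 1 * y) = (of_real (exp (- x)) * phi a x) * (of_real (exp (- y)) * phi b y)" for x y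
    by (simp add: F_def exp_diff exp_minus field_simps exp_add)
  have int2: "integrable lborel (\<lambda>w. F x w)" for x
  proof -
    have "integrable lborel (\<lambda>y. F x (x + 1 * y))"
      unfolding F1 using phi_exp(1)[OF b] by (rule integrable_mult_right)
    then show ?thesis by (subst (asm) lborel_integrable_real_affine_iff) auto
  qed
  have Fw: "(\<integral>w. F x w \<partial>lborel) = of_real (exp (- x)) * phi a x" for x
    using lborel_integral_real_affine[of 1 "F x" x] phi_exp(2)[OF b] unfolding F1 by simp
  have Fwn: "(\<integral>w. norm (F x w) \<partial>lborel) = norm (of_real (exp (- x)) * phi a x) * (\<integral>y. norm (of_real (exp (- y)) * phi b y) \<partial>lborel)" for x
    using lborel_integral_real_affine[of 1 "\<lambda>w. norm (F x w)" x] unfolding F1 by (simp add: norm_mult)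
  have FI: "integrable (lborel \<Otimes>\<^sub>M lborel) (case_prod F)"
  proof (rule lborel_pair.Fubini_integrable)
    show "case_prod F \<in> borel_measurable (lborel \<Otimes>\<^sub>M lborel)" unfolding F_def by measurable
    show "integrable lborel (\<lambda>x. \<integral>y. norm (case (x, y) of (x, y) \<Rightarrow> F x y) \<partial>lborel)"
      unfolding case_prod_conv Fwn by (intro integrable_mult_left integrable_norm phi_exp a)
  qed (use int2 in simp)
  have "(\<integral>w. (\<integral>x. F x w \<partial>lborel) \<partial>lborel) = (\<integral>x. (\<integral>w. F x w \<partial>lborel) \<partial>lborel)"
    by (rule lborel_pair.Fubini_integral[OF FI])
  also have "\<dots> = 1" unfolding Fw by (rule phi_exp(2)[OF a])
  finally have 1: "(\<integral>w. (\<integral>x. F x w \<partial>lborel) \<partial>lborel) = 1" .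
  define K where "K = (\<integral>x. phi a x * phi b (1 - x) \<partial>lborel) * Gamma (a + b + 2)"
  have "(\<integral>x. F x w \<partial>lborel) = K * (of_real (exp (- w)) * phi (a + b + 1) w)" for w
    unfolding F_def K_def integral_mult_right_zero phi_conv_phi_prop(1)[OF a b, of w] by simp
  then have "K * 1 = 1" using 1 phi_exp(2)[of "a + b + 1"] a b by simp
  then show ?thesis unfolding phi_conv_phi_prop(1)[OF a b, of w] K_def[symmetric] by simp
qed

section \<open>Dirichlet integrals over the triangle\<close>

definition Adens :: "complex \<Rightarrow> complex \<Rightarrow> complex \<Rightarrow> real \<times> real \<Rightarrow> complex" where
  "Adens a b c uv = phi a (fst uv) * phi b (snd uv) * phi c (1 - fst uv - snd uv)"

lemma Adens_measurable [measurable]: "Adens a b c \<in> borel_measurable borel"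
proof -
  have "Adens a b c \<in> borel_measurable (borel \<Otimes>\<^sub>M borel)" unfolding Adens_def[abs_def] by measurable
  then show ?thesis by (simp add: borel_prod)
qed

lemma Adens_eq_0: "uv \<notin> triangle \<Longrightarrow> Adens a b c uv = 0"
  by (cases uv) (auto simp: Adens_def triangle_def phi_def)

lemma pairing_int_eq: "pairing_int a b c F = (\<integral>uv. Adens a b c uv * F uv \<partial>lborel)"
  unfolding pairing_int_def set_lebesgue_integral_def Adens_def[symmetric]
  by (rule Bochner_Integration.integral_cong) (auto simp: indicator_def Adens_eq_0)

text \<open>Dirichlet's integral, obtained as two successive convolutions evaluated at 1. The value
  is written with \<open>rGamma\<close> because that function is entire, so the right-hand side is
  already its own continuation.\<close>

theorem Adens_integral:
  assumes a: "Re a > - 1" and b: "Re b > - 1" and c: "Re c > - 1"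
  shows "integrable lborel (Adens a b c)"
    and "(\<integral>uv. Adens a b c uv \<partial>lborel) = rGamma (a + b + c + 3)"
proof -
  have A: "Adens a b c (u, v) = phi a u * (phi b v * phi c (1 - u - v))" for u v by (simp add: Adens_def)
  have I: "integrable (lborel \<Otimes>\<^sub>M lborel) (Adens a b c)"
  proof (rule lborel_pair.Fubini_integrable)
    show "Adens a b c \<in> borel_measurable (lborel \<Otimes>\<^sub>M lborel)" unfolding lborel_prod by simp
    have bc: "Re (b + c + 1) > - 1" using b c by simp
    define K where "K = (\<integral>x. norm (phi b x * phi c (1 - x)) \<partial>lborel) * norm (Gamma (b + c + 2))"
    have "(\<integral>y. norm (Adens a b c (x, y)) \<partial>lborel) = K * norm (phi a x * phi (b + c + 1) (1 - x))" for x
      unfolding A norm_mult[of "phi a _"] integral_mult_right_zero phi_conv_phi_prop(2)[OF b c, of "1 - x"] K_def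
      by (simp only: mult_ac)
    moreover have "integrable lborel (\<lambda>x. K * norm (phi a x * phi (b + c + 1) (1 - x)))"
      by (intro integrable_mult_right integrable_norm phi_conv_integrable a bc)
    ultimately show "integrable lborel (\<lambda>x. \<integral>y. norm (Adens a b c (x, y)) \<partial>lborel)"
      by (simp only:)
    show "AE x in lborel. integrable lborel (\<lambda>y. Adens a b c (x, y))"
      unfolding A by (intro AE_I2 integrable_mult_right phi_conv_integrable b c)
  qed
  then show "integrable lborel (Adens a b c)" by (simp add: lborel_prod)
  have "(\<integral>uv. Adens a b c uv \<partial>lborel) = (\<integral>u. (\<integral>v. Adens a b c (u, v) \<partial>lborel) \<partial>lborel)"
    using lborel_pair.integral_fst'[OF I] by (simp add: lborel_prod)
  also have "\<dots> = (\<integral>u. phi a u * phi (b + c + 1) (1 - u) \<partial>lborel)"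
    unfolding A by (simp add: phi_convolution[OF b c])
  also have "\<dots> = phi (a + (b + c + 1) + 1) 1" by (rule phi_convolution) (use a b c in auto)
  also have "\<dots> = rGamma (a + b + c + 3)" by (simp add: phi_def rGamma_inverse_Gamma inverse_eq_divide add_ac)
  finally show "(\<integral>uv. Adens a b c uv \<partial>lborel) = rGamma (a + b + c + 3)" .
qed

lemma phi_shift:
  assumes "Re a > - 1"
  shows "phi a u * of_real u ^ i = pochhammer (a + 1) i * phi (a + of_nat i) u"
proof (cases "u > 0")
  case True
  have "a + 1 \<notin> \<int>\<^sub>\<le>\<^sub>0" using assms by (auto elim!: nonpos_Ints_cases simp: complex_eq_iff)
  then have "pochhammer (a + 1) i = Gamma (a + 1 + of_nat i) / Gamma (a + 1)" by (rule pochhammer_Gamma)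
  moreover have "Gamma (a + of_nat i + 1) \<noteq> 0" by (rule Gamma_nz) (use assms in auto)
  moreover have "of_real u powr (a + of_nat i) = of_real u powr a * (of_real u :: complex) ^ i"
    using True by (simp add: powr_add powr_nat)
  ultimately show ?thesis using True by (simp add: phi_def add_ac)
qed (simp add: phi_def)

lemma Adens_shift:
  assumes a: "Re a > - 1" and b: "Re b > - 1"
  shows "Adens a b c (u, v) * (of_real u ^ i * of_real v ^ j)
    = pochhammer (a + 1) i * pochhammer (b + 1) j * Adens (a + of_nat i) (b + of_nat j) c (u, v)"
proof -
  have "Adens a b c (u, v) * (of_real u ^ i * of_real v ^ j) = (phi a u * of_real u ^ i) * (phi b v * of_real v ^ j) * phi c (1 - u - v)"
    by (simp only: Adens_def fst_conv snd_conv mult_ac)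
  then show ?thesis unfolding phi_shift[OF a] phi_shift[OF b] Adens_def by (simp only: fst_conv snd_conv mult_ac)
qed

text \<open>\<open>Pcoef\<close> gives the Taylor coefficients of \<open>\<Psi>\<^sub>x\<close> in \<open>1 - x\<close>; \<open>dcoef\<close> arises from it by integrating each
  monomial with \<open>u \<phi>\<^sub>a(u) = (a + 1) \<phi>\<^sub>a\<^sub>+\<^sub>1(u)\<close>.\<close>

definition Pcoef :: "complex \<Rightarrow> complex \<Rightarrow> complex \<Rightarrow> nat \<Rightarrow> complex \<Rightarrow> complex \<Rightarrow> complex" where
  "Pcoef \<zeta> \<zeta>' t k u v = (\<Sum>m\<le>k. (\<Sum>i\<le>m. (pochhammer (- \<zeta>) i / fact i * u ^ i)
     * (pochhammer (- \<zeta>') (m - i) / fact (m - i) * v ^ (m - i)))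
     * (pochhammer t (k - m) / fact (k - m) * (u + v) ^ (k - m)))"

definition dcoef :: "complex \<Rightarrow> complex \<Rightarrow> complex \<Rightarrow> complex \<Rightarrow> complex \<Rightarrow> nat \<Rightarrow> complex" where
  "dcoef \<zeta> \<zeta>' t a b k = (\<Sum>m\<le>k. (\<Sum>i\<le>m. (pochhammer (- \<zeta>) i / fact i * pochhammer (a + 1) i)
     * (pochhammer (- \<zeta>') (m - i) / fact (m - i) * pochhammer (b + 1) (m - i)))
     * (pochhammer t (k - m) / fact (k - m) * pochhammer (a + b + 2 + of_nat m) (k - m)))"

section \<open>Growth of the coefficients\<close>

lemma norm_pochhammer_le:
  fixes x :: complex
  assumes "norm x \<le> r"
  shows "norm (pochhammer x n) \<le> pochhammer r n"
proof -
  have "norm (pochhammer x n) = (\<Prod>j<n. norm (x + of_nat j))"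
    by (simp add: pochhammer_prod atLeast0LessThan prod_norm)
  also have "\<dots> \<le> (\<Prod>j<n. r + of_nat j)"
  proof (rule prod_mono)
    fix j show "0 \<le> norm (x + of_nat j) \<and> norm (x + of_nat j) \<le> r + of_nat j"
      using norm_triangle_ineq[of x "of_nat j"] assms by simp
  qed
  finally show ?thesis by (simp add: pochhammer_prod atLeast0LessThan)
qed

lemma pochhammer_real_le: "pochhammer (real r) n \<le> fact n * (real n + 1) ^ r"
proof (induction n)
  case (Suc n)
  have "(real n + 1) ^ r * (real r + real n) \<le> (real n + 1) * (real n + 2) ^ r"
  proof -
    have "1 + real r * (1 / (real n + 1)) \<le> (1 + 1 / (real n + 1)) ^ r"
      by (rule Bernoulli_inequality) (auto intro: order.trans[of _ 0])
    also have "(1 + 1 / (real n + 1)) = (real n + 2) / (real n + 1)" by (simp add: field_simps)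
    finally have "(real n + 1) ^ r * (1 + real r * (1 / (real n + 1))) \<le> (real n + 1) ^ r * ((real n + 2) / (real n + 1)) ^ r"
      by (intro mult_left_mono) auto
    also have "\<dots> = (real n + 2) ^ r" by (simp add: power_divide)
    finally have "(real n + 1) * ((real n + 1) ^ r * (1 + real r * (1 / (real n + 1)))) \<le> (real n + 1) * (real n + 2) ^ r"
      by (intro mult_left_mono) auto
    also have "(real n + 1) * ((real n + 1) ^ r * (1 + real r * (1 / (real n + 1)))) = (real n + 1) ^ r * (real n + 1 + real r)"
      by (simp add: field_simps)
    finally have "(real n + 1) ^ r * (real n + 1 + real r) \<le> (real n + 1) * (real n + 2) ^ r" .
    moreover have "(real n + 1) ^ r * (real r + real n) \<le> (real n + 1) ^ r * (real n + 1 + real r)"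
      by (intro mult_left_mono) auto
    ultimately show ?thesis by (rule order.trans[rotated])
  qed
  then have "fact n * ((real n + 1) ^ r * (real r + real n)) \<le> fact n * ((real n + 1) * (real n + 2) ^ r)"
    by (intro mult_left_mono) auto
  moreover have "pochhammer (real r) (Suc n) \<le> fact n * ((real n + 1) ^ r * (real r + real n))"
    unfolding pochhammer_Suc mult.assoc[symmetric] using Suc by (intro mult_right_mono) auto
  ultimately have "pochhammer (real r) (Suc n) \<le> fact n * ((real n + 1) * (real n + 2) ^ r)"
    by (rule order.trans[rotated])
  also have "\<dots> = fact (Suc n) * (real (Suc n) + 1) ^ r" by (simp add: algebra_simps)
  finally show ?case .
qed simp

lemma norm_pochhammer_bound:
  fixes x :: complex
  assumes "norm x \<le> real r"
  shows "norm (pochhammer x n) \<le> fact n * (real n + 1) ^ r"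
  using norm_pochhammer_le[OF assms] pochhammer_real_le[of r n] by (rule order.trans)

lemma pochhammer_ge_fact: "1 \<le> r \<Longrightarrow> fact m \<le> pochhammer (real r) m"
  unfolding pochhammer_fact pochhammer_prod by (intro prod_mono) auto

text \<open>The shifted symbol is a quotient (r)_(m+n)/(r)_m. Keeping the denominator matters: its
  \<open>fact m\<close> cancels the factorials \<open>fact i * fact (m - i)\<close> left by the
  other two symbols in \<open>dcoef\<close>.\<close>

lemma norm_pochhammer_shift_bound:
  fixes x :: complex
  assumes "norm x \<le> real r" "1 \<le> r"
  shows "norm (pochhammer (x + of_nat m) n) \<le> fact (m + n) * (real (m + n) + 1) ^ r / fact m"
proof -
  have "norm (x + of_nat m) \<le> real r + real m"
    using norm_triangle_ineq[of x "of_nat m"] assms by simp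
  then have "norm (pochhammer (x + of_nat m) n) \<le> pochhammer (real r + real m) n" by (rule norm_pochhammer_le)
  also have "\<dots> = pochhammer (real r) (m + n) / pochhammer (real r) m"
    using pochhammer_product'[of "real r" m n] pochhammer_pos[of "real r" m] assms by simp
  also have "\<dots> \<le> pochhammer (real r) (m + n) / fact m"
    using pochhammer_ge_fact[OF assms(2), of m] assms pochhammer_nonneg[of "real r" "m + n"] by (intro divide_left_mono) (auto intro!: mult_pos_pos pochhammer_pos)
  also have "\<dots> \<le> fact (m + n) * (real (m + n) + 1) ^ r / fact m"
    by (intro divide_right_mono pochhammer_real_le) auto
  finally show ?thesis .
qed

lemma fact_mult_le: "i \<le> m \<Longrightarrow> fact i * fact (m - i) \<le> (fact m :: real)"
proof -
  assume "i \<le> m"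
  then have "fact i * fact (m - i) * (m choose i) = fact m" by (rule binomial_fact_lemma)
  moreover have "m choose i \<ge> 1" using \<open>i \<le> m\<close> by (simp add: Suc_le_eq)
  ultimately have "fact i * fact (m - i) \<le> (fact m :: nat)" by (metis mult_le_mono2 mult.right_neutral)
  then have "real (fact i * fact (m - i)) \<le> real (fact m)" by (rule of_nat_mono)
  then show ?thesis by simp
qed

lemma term_bound:
  assumes "norm y \<le> real r" "n \<le> k"
  shows "norm (pochhammer y n / fact n :: complex) \<le> (real k + 1) ^ r"
proof -
  have "norm (pochhammer y n / fact n) \<le> (real n + 1) ^ r"
    using norm_pochhammer_bound[OF assms(1), of n] by (simp add: norm_divide divide_simps mult.commute)
  also have "\<dots> \<le> (real k + 1) ^ r" using assms by (intro power_mono) auto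
  finally show ?thesis .
qed

lemma norm_double_sum_le:
  assumes "\<And>m i. i \<le> m \<Longrightarrow> m \<le> k \<Longrightarrow> norm (f m i * g m i) * norm (h m) \<le> B" "B \<ge> 0"
  shows "norm (\<Sum>m\<le>k. (\<Sum>i\<le>m. f m i * g m i) * h m :: complex) \<le> (real k + 1)\<^sup>2 * B"
proof -
  have "norm (\<Sum>m\<le>k. (\<Sum>i\<le>m. f m i * g m i) * h m) \<le> (\<Sum>m\<le>k. (real k + 1) * B)"
  proof (rule order.trans[OF norm_sum sum_mono])
    fix m assume m: "m \<in> {..k}"
    have "norm ((\<Sum>i\<le>m. f m i * g m i) * h m) \<le> (\<Sum>i\<le>m. norm (f m i * g m i)) * norm (h m)"
      unfolding norm_mult[of _ "h m"] by (intro mult_right_mono norm_sum) auto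
    also have "\<dots> = (\<Sum>i\<le>m. norm (f m i * g m i) * norm (h m))" by (rule sum_distrib_right)
    also have "\<dots> \<le> (\<Sum>i\<le>m. B)" using m by (intro sum_mono assms) auto
    also have "\<dots> \<le> (real k + 1) * B" using m assms(2) by (auto intro!: mult_right_mono)
    finally show "norm ((\<Sum>i\<le>m. f m i * g m i) * h m) \<le> (real k + 1) * B" .
  qed
  also have "\<dots> = (real k + 1)\<^sup>2 * B" by (simp add: power2_eq_square add.commute)
  finally show ?thesis .
qed

lemma Pcoef_bound:
  assumes r: "norm \<zeta> \<le> real r" "norm \<zeta>' \<le> real r" "norm t \<le> real r"
    and uv: "norm u \<le> 1" "norm v \<le> 1" "norm (u + v) \<le> 1"
  shows "norm (Pcoef \<zeta> \<zeta>' t k u v) \<le> (real k + 1) ^ (3 * r + 2)"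
proof -
  have b: "norm (pochhammer y n / fact n * w ^ n) \<le> (real k + 1) ^ r"
    if "norm y \<le> real r" "n \<le> k" "norm w \<le> 1" for y w :: complex and n
  proof -
    have "norm (pochhammer y n / fact n * w ^ n) \<le> (real k + 1) ^ r * 1"
      unfolding norm_mult norm_power using that by (intro mult_mono term_bound power_le_one) auto
    then show ?thesis by simp
  qed
  have "norm (Pcoef \<zeta> \<zeta>' t k u v) \<le> (real k + 1)\<^sup>2 * ((real k + 1) ^ r * (real k + 1) ^ r * (real k + 1) ^ r)"
    unfolding Pcoef_def
  proof (rule norm_double_sum_le)
    fix m i assume mi: "i \<le> m" "m \<le> k"
    show "norm (pochhammer (- \<zeta>) i / fact i * u ^ i * (pochhammer (- \<zeta>') (m - i) / fact (m - i) * v ^ (m - i)))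
        * norm (pochhammer t (k - m) / fact (k - m) * (u + v) ^ (k - m))
        \<le> (real k + 1) ^ r * (real k + 1) ^ r * (real k + 1) ^ r"
      unfolding norm_mult[of "pochhammer (- \<zeta>) i / fact i * u ^ i"]
      by (intro mult_mono b) (use r uv mi in auto)
  qed simp
  also have "\<dots> = (real k + 1) ^ (3 * r + 2)"
    by (simp only: power_add[symmetric]) (rule arg_cong[where f = "power _"], simp)
  finally show ?thesis .
qed

text \<open>Each of the six Pochhammer symbols costs a power \<open>r\<close> of
  \<open>k + 1\<close>, and the double sum costs two more. The factorials collapse to one
  \<open>fact k\<close>, which the reciprocal Gamma factor compensates.\<close>

lemma dcoef_bound:
  assumes r: "norm \<zeta> \<le> real r" "norm \<zeta>' \<le> real r" "norm t \<le> real r" "norm (a + 1) \<le> real r" "norm (b + 1) \<le> real r"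
    "norm (a + b + 2) \<le> real r" "1 \<le> r"
  shows "norm (dcoef \<zeta> \<zeta>' t a b k) \<le> fact k * (real k + 1) ^ (6 * r + 2)"
proof -
  define Q where "Q = (real k + 1) ^ r"
  have Q: "Q \<ge> 0" by (simp add: Q_def)
  have p: "norm (pochhammer y n) \<le> fact n * Q" if "norm y \<le> real r" "n \<le> k" for y :: complex and n
  proof -
    have "(real n + 1) ^ r \<le> Q" unfolding Q_def using that by (intro power_mono) auto
    then have "fact n * (real n + 1) ^ r \<le> fact n * Q" by (intro mult_left_mono) auto
    with norm_pochhammer_bound[OF that(1), of n] show ?thesis by (rule order.trans)
  qed
  have "norm (dcoef \<zeta> \<zeta>' t a b k) \<le> (real k + 1)\<^sup>2 * (fact k * Q ^ 6)"
    unfolding dcoef_def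
  proof (rule norm_double_sum_le)
    fix m i assume mi: "i \<le> m" "m \<le> k"
    have "norm (pochhammer (- \<zeta>) i / fact i * pochhammer (a + 1) i * (pochhammer (- \<zeta>') (m - i) / fact (m - i) * pochhammer (b + 1) (m - i)))
       * norm (pochhammer t (k - m) / fact (k - m) * pochhammer (a + b + 2 + of_nat m) (k - m))
      \<le> ((Q * (fact i * Q)) * (Q * (fact (m - i) * Q))) * (Q * (fact k * Q / fact m))"
    proof -
      have 1: "norm (pochhammer (a + b + 2 + of_nat m) (k - m)) \<le> fact k * Q / fact m"
        using norm_pochhammer_shift_bound[OF r(6,7), of m "k - m"] mi by (simp add: Q_def)
      have 2: "norm (pochhammer y n / fact n) \<le> Q" if "norm y \<le> real r" "n \<le> k" for y :: complex and n
        unfolding Q_def by (rule term_bound[OF that])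
      show ?thesis
        unfolding norm_mult using mi r Q
        by (intro mult_mono p 1 2 mult_nonneg_nonneg divide_nonneg_nonneg) auto
    qed
    also have "\<dots> = (fact i * fact (m - i)) / fact m * (fact k * Q ^ 6)"
      by (simp add: power_numeral_reduce)
    also have "\<dots> \<le> 1 * (fact k * Q ^ 6)"
      using fact_mult_le[OF mi(1)] Q by (intro mult_right_mono) (auto simp: divide_simps)
    finally show "norm (pochhammer (- \<zeta>) i / fact i * pochhammer (a + 1) i * (pochhammer (- \<zeta>') (m - i) / fact (m - i) * pochhammer (b + 1) (m - i)))
       * norm (pochhammer t (k - m) / fact (k - m) * pochhammer (a + b + 2 + of_nat m) (k - m)) \<le> fact k * Q ^ 6" by simp
  qed (use Q in simp)
  also have "\<dots> = fact k * (real k + 1) ^ (6 * r + 2)"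
    unfolding Q_def by (simp add: power_add power_mult[symmetric] mult.commute power2_eq_square)
  finally show ?thesis .
qed

text \<open>For \<open>k \<le> M\<close> compactness bounds the function. Beyond \<open>M\<close>
  the functional equation divides by a Pochhammer symbol whose factors have modulus at least 1 + j,
  since \<open>M\<close> exceeds \<open>W\<close> by at least one; this produces the
  factorial.\<close>

lemma rGamma_bound:
  obtains C :: real and M :: nat where "C \<ge> 0" "\<And>w k. norm w \<le> W \<Longrightarrow> norm (rGamma (w + of_nat k) :: complex) \<le> C * (real k + 1) ^ M / fact k"
proof -
  define M where "M = nat \<lceil>W\<rceil> + 1"
  have M: "real M \<ge> W + 1" unfolding M_def by linarith
  have "compact (rGamma ` cball (0::complex) (\<bar>W\<bar> + M))"
    by (intro compact_continuous_image holomorphic_on_imp_continuous_on holomorphic_rGamma) auto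
  from compact_imp_bounded[OF this] obtain C0 where "\<forall>x\<in>rGamma ` cball (0::complex) (\<bar>W\<bar> + M). norm x \<le> C0"
    unfolding bounded_iff by blast
  then have C0: "norm (rGamma (w :: complex)) \<le> C0" if "norm w \<le> \<bar>W\<bar> + M" for w using that by auto
  have C0_0: "C0 \<ge> 0" using order.trans[OF norm_ge_zero C0[of 0]] by simp
  have wn: "norm (w + of_nat n) \<le> \<bar>W\<bar> + M" if "norm w \<le> W" "n \<le> M" for w :: complex and n
    using norm_triangle_ineq[of w "of_nat n"] that by (simp add: norm_of_nat)
  show ?thesis
  proof (rule that[of "C0 * fact M" M])
    fix w :: complex and k assume w: "norm w \<le> W"
    show "norm (rGamma (w + of_nat k)) \<le> C0 * fact M * (real k + 1) ^ M / fact k"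
    proof (cases "k \<le> M")
      case True
      have "norm (rGamma (w + of_nat k)) \<le> C0 * 1" using C0[OF wn[OF w True]] by simp
      also have "\<dots> \<le> C0 * (fact M / fact k * (real k + 1) ^ M)"
      proof (intro mult_left_mono C0_0)
        have "1 * 1 \<le> fact M / fact k * (real k + 1) ^ M"
          using True by (intro mult_mono one_le_power) (auto simp: divide_simps fact_mono)
        then show "1 \<le> fact M / fact k * (real k + 1) ^ M" by simp
      qed
      finally show ?thesis by (simp add: mult_ac)
    next
      case False
      define n where "n = k - M"
      have kn: "k = M + n" using False by (simp add: n_def)
      have "fact n \<le> norm (pochhammer (w + of_nat M) n)"
      proof -
        have "fact n = (\<Prod>j<n. 1 + real j)" by (simp add: pochhammer_fact pochhammer_prod atLeast0LessThan)
        also have "\<dots> \<le> (\<Prod>j<n. norm (w + of_nat M + of_nat j))"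
        proof (rule prod_mono)
          fix j
          have "1 + real j \<le> Re (w + of_nat M + of_nat j)"
            using abs_Re_le_cmod[of w] w M by simp
          also have "\<dots> \<le> norm (w + of_nat M + of_nat j)" by (rule complex_Re_le_cmod)
          finally show "0 \<le> 1 + real j \<and> 1 + real j \<le> norm (w + of_nat M + of_nat j)" by simp
        qed
        finally show ?thesis by (simp add: pochhammer_prod atLeast0LessThan prod_norm)
      qed
      moreover have "rGamma (w + of_nat M) = pochhammer (w + of_nat M) n * rGamma (w + of_nat k)"
        using pochhammer_rGamma[of "w + of_nat M" n] by (simp add: kn add.assoc)
      then have "norm (pochhammer (w + of_nat M) n) * norm (rGamma (w + of_nat k)) \<le> C0"
        using C0[OF wn[OF w order.refl]] by (simp add: norm_mult)
      ultimately have "fact n * norm (rGamma (w + of_nat k)) \<le> C0"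
        by (meson mult_right_mono norm_ge_zero order.trans)
      then have 1: "norm (rGamma (w + of_nat k)) \<le> C0 / fact n" by (simp add: divide_simps mult.commute)
      have "fact k \<le> fact n * (real k + 1) ^ M"
      proof -
        have "fact (m + n) \<le> fact n * (real (m + n) + 1) ^ m" for m
        proof (induction m)
          case (Suc m)
          have "fact (Suc m + n) = (real (m + n) + 1) * fact (m + n)" by (simp add: add_ac)
          also have "\<dots> \<le> (real (m + n) + 1) * (fact n * (real (m + n) + 1) ^ m)"
            using Suc by (intro mult_left_mono) auto
          also have "\<dots> = fact n * (real (m + n) + 1) ^ Suc m" by simp
          also have "\<dots> \<le> fact n * (real (Suc m + n) + 1) ^ Suc m"
            by (intro mult_left_mono power_mono) auto
          finally show ?case .
        qed simp
        then show ?thesis by (simp add: kn)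
      qed
      then have "C0 / fact n \<le> C0 * ((real k + 1) ^ M / fact k)"
        unfolding divide_inverse using C0_0 by (intro mult_left_mono) (auto simp: field_simps)
      also have "\<dots> \<le> C0 * fact M * ((real k + 1) ^ M / fact k)"
        using C0_0 by (intro mult_right_mono) (auto simp: mult_le_cancel_left1 fact_ge_1)
      finally show ?thesis using 1 by simp
    qed
  qed (use C0_0 in simp)
qed

lemma summable_poly_geometric:
  assumes s: "0 \<le> s" "s < 1"
  shows "summable (\<lambda>k. (real k + 1) ^ B * s ^ k)"
proof -
  define c where "c = (1 + s) / 2"
  have c: "c < 1" "s < c" using s by (auto simp: c_def)
  have "(\<lambda>k. ((real k + 2) / (real k + 1)) ^ B * s) \<longlonglongrightarrow> 1 ^ B * s"
    by (intro tendsto_mult tendsto_power tendsto_const) real_asymp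
  then have "\<forall>\<^sub>F k in sequentially. ((real k + 2) / (real k + 1)) ^ B * s < c"
    using c by (intro order_tendstoD(2)) auto
  then obtain N where N: "\<And>k. k \<ge> N \<Longrightarrow> ((real k + 2) / (real k + 1)) ^ B * s < c"
    by (auto simp: eventually_sequentially)
  show ?thesis
  proof (rule summable_ratio_test[OF c(1), of N])
    fix k assume k: "N \<le> k"
    have "(real (Suc k) + 1) ^ B * s ^ Suc k = (((real k + 2) / (real k + 1)) ^ B * s) * ((real k + 1) ^ B * s ^ k)"
      by (simp add: power_divide field_simps)
    also have "\<dots> \<le> c * ((real k + 1) ^ B * s ^ k)"
      using N[OF k] s by (intro mult_right_mono) auto
    finally show "norm ((real (Suc k) + 1) ^ B * s ^ Suc k) \<le> c * norm ((real k + 1) ^ B * s ^ k)"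
      using s by simp
  qed
qed

section \<open>Expansion of the test function and termwise integration\<close>

lemma binomial_series_minus:
  assumes "norm (y :: complex) < 1"
  shows "(\<lambda>n. pochhammer (- \<alpha>) n / fact n * y ^ n) sums (1 - y) powr \<alpha>"
proof -
  have "(\<lambda>n. (\<alpha> gchoose n) * (- y) ^ n) sums (1 + - y) powr \<alpha>"
    by (rule gen_binomial_complex) (use assms in simp)
  moreover have "(\<alpha> gchoose n) * (- y) ^ n = pochhammer (- \<alpha>) n / fact n * y ^ n" for n
  proof -
    have "(\<alpha> gchoose n) * (- y) ^ n = ((-1) ^ n * (-1) ^ n) * (pochhammer (- \<alpha>) n / fact n * y ^ n)"
      unfolding gbinomial_pochhammer power_minus[of y] by simp
    then show ?thesis by (simp add: power_mult_distrib[symmetric])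
  qed
  ultimately show ?thesis by simp
qed

lemma binomial_series_norm_summable:
  assumes "norm (y :: complex) < 1"
  shows "summable (\<lambda>n. norm (pochhammer \<alpha> n / fact n * y ^ n))"
proof -
  obtain r :: nat where r: "norm \<alpha> \<le> real r" using real_arch_simple by blast
  show ?thesis
  proof (rule summable_comparison_test'[OF summable_poly_geometric[of "norm y" r], of 0])
    fix n
    show "norm (norm (pochhammer \<alpha> n / fact n * y ^ n)) \<le> (real n + 1) ^ r * norm y ^ n"
      using mult_right_mono[OF term_bound[OF r order.refl, of n], of "norm y ^ n"]
      by (simp only: norm_mult[of "pochhammer \<alpha> n / fact n"] norm_power real_norm_def abs_mult abs_norm_cancel power_abs zero_le_power norm_ge_zero)
  qed (use assms in auto)
qed

lemma Psi_series:
  assumes x: "0 < x" "x < 1" and uv: "(u, v) \<in> triangle"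
  shows "(\<lambda>k. of_real (1 - x) ^ k * Pcoef \<zeta> \<zeta>' t k (of_real u) (of_real v)) sums Psi \<zeta> \<zeta>' t x (u, v)"
proof -
  define s where "s = 1 - x"
  have s: "0 < s" "s < 1" using x by (auto simp: s_def)
  have uv': "0 \<le> u" "0 \<le> v" "u + v \<le> 1" using uv by (auto simp: triangle_def)
  have lt: "norm (of_real (s * w) :: complex) < 1" if "0 \<le> w" "w \<le> 1" for w
  proof -
    have "s * w \<le> s * 1" using s that by (intro mult_left_mono) auto
    moreover have "0 \<le> s * w" using s that by simp
    ultimately show ?thesis unfolding norm_of_real using s by linarith
  qed
  define A where "A i = pochhammer (- \<zeta>) i / fact i * of_real (s * u) ^ i" for i
  define B where "B i = pochhammer (- \<zeta>') i / fact i * of_real (s * v) ^ i" for i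
  define C where "C i = pochhammer t i / fact i * of_real (s * (u + v)) ^ i" for i
  have sA: "A sums of_real (1 - s * u) powr \<zeta>" "summable (\<lambda>i. norm (A i))"
    unfolding A_def using binomial_series_minus[OF lt[of u], of \<zeta>] binomial_series_norm_summable[OF lt[of u]] uv'
    by (auto simp: of_real_diff)
  have sB: "B sums of_real (1 - s * v) powr \<zeta>'" "summable (\<lambda>i. norm (B i))"
    unfolding B_def using binomial_series_minus[OF lt[of v], of \<zeta>'] binomial_series_norm_summable[OF lt[of v]] uv'
    by (auto simp: of_real_diff)
  have sC: "C sums of_real (1 - s * (u + v)) powr (- t)" "summable (\<lambda>i. norm (C i))"
    unfolding C_def using binomial_series_minus[OF lt[of "u + v"], of "- t"] binomial_series_norm_summable[OF lt[of "u + v"]] uv'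
    by (auto simp: of_real_diff)
  define AB where "AB m = (\<Sum>i\<le>m. A i * B (m - i))" for m
  have "AB sums (suminf A * suminf B)" unfolding AB_def[abs_def] by (rule Cauchy_product_sums) fact+
  then have AB: "AB sums (of_real (1 - s * u) powr \<zeta> * of_real (1 - s * v) powr \<zeta>')"
    using sA(1) sB(1) by (simp add: sums_iff)
  have "summable (\<lambda>m. \<Sum>i\<le>m. norm (A i) * norm (B (m - i)))"
    by (rule summable_Cauchy_product) (use sA sB in auto)
  then have ABn: "summable (\<lambda>m. norm (AB m))"
    by (rule summable_comparison_test'[of _ 0])
       (auto simp: AB_def norm_mult[symmetric] intro: order.trans[OF norm_sum])
  have "(\<lambda>k. \<Sum>m\<le>k. AB m * C (k - m)) sums (suminf AB * suminf C)"
    by (rule Cauchy_product_sums) fact+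
  then have 1: "(\<lambda>k. \<Sum>m\<le>k. AB m * C (k - m)) sums Psi \<zeta> \<zeta>' t x (u, v)"
    using AB sC(1) by (simp add: sums_iff Psi_def s_def)
  have "(\<Sum>m\<le>k. AB m * C (k - m)) = of_real (1 - x) ^ k * Pcoef \<zeta> \<zeta>' t k (of_real u) (of_real v)" for k
    unfolding Pcoef_def AB_def sum_distrib_left sum_distrib_right s_def[symmetric]
  proof (intro sum.cong refl)
    fix m i assume "m \<in> {..k}" "i \<in> {..m}"
    then have e: "k = i + (m - i) + (k - m)" by auto
    have "(of_real s :: complex) ^ k = of_real s ^ i * of_real s ^ (m - i) * of_real s ^ (k - m)"
      by (subst e) (simp only: power_add)
    then show "A i * B (m - i) * C (k - m) = of_real s ^ k *
      (pochhammer (- \<zeta>) i / fact i * of_real u ^ i * (pochhammer (- \<zeta>') (m - i) / fact (m - i) * of_real v ^ (m - i)) *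
      (pochhammer t (k - m) / fact (k - m) * (of_real u + of_real v) ^ (k - m)))"
      unfolding A_def B_def C_def of_real_mult power_mult_distrib of_real_add by (simp only: mult_ac times_divide_eq_left times_divide_eq_right)
  qed
  then show ?thesis using 1 by simp
qed

lemma Adens_monomial:
  assumes a: "Re a > - 1" and b: "Re b > - 1" and c: "Re c > - 1"
  shows "integrable lborel (\<lambda>uv. Adens a b c uv * (of_real (fst uv) ^ i * of_real (snd uv) ^ j))"
    and "(\<integral>uv. Adens a b c uv * (of_real (fst uv) ^ i * of_real (snd uv) ^ j) \<partial>lborel)
      = pochhammer (a + 1) i * pochhammer (b + 1) j * rGamma (a + b + c + 3 + of_nat (i + j))"
proof -
  have e: "Adens a b c uv * (of_real (fst uv) ^ i * of_real (snd uv) ^ j)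
    = pochhammer (a + 1) i * pochhammer (b + 1) j * Adens (a + of_nat i) (b + of_nat j) c uv" for uv
    using Adens_shift[OF a b, of c "fst uv" "snd uv" i j] by simp
  have ab: "Re (a + of_nat i) > - 1" "Re (b + of_nat j) > - 1" using a b by simp_all
  show "integrable lborel (\<lambda>uv. Adens a b c uv * (of_real (fst uv) ^ i * of_real (snd uv) ^ j))"
    unfolding e using Adens_integral(1)[OF ab c] by simp
  show "(\<integral>uv. Adens a b c uv * (of_real (fst uv) ^ i * of_real (snd uv) ^ j) \<partial>lborel)
      = pochhammer (a + 1) i * pochhammer (b + 1) j * rGamma (a + b + c + 3 + of_nat (i + j))"
    unfolding e using Adens_integral(2)[OF ab c] by (simp add: algebra_simps)
qed

text \<open>Expanding the power of u + v gives a Vandermonde sum of Pochhammer symbols, which closes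
  up because the reciprocal Gamma factor depends only on the total degree.\<close>

lemma Adens_monomial_power:
  assumes a: "Re a > - 1" and b: "Re b > - 1" and c: "Re c > - 1"
  shows "integrable lborel (\<lambda>uv. Adens a b c uv * (of_real (fst uv) ^ i * of_real (snd uv) ^ j * (of_real (fst uv) + of_real (snd uv)) ^ n))"
    and "(\<integral>uv. Adens a b c uv * (of_real (fst uv) ^ i * of_real (snd uv) ^ j * (of_real (fst uv) + of_real (snd uv)) ^ n) \<partial>lborel)
      = pochhammer (a + 1) i * pochhammer (b + 1) j * pochhammer (a + b + 2 + of_nat (i + j)) n * rGamma (a + b + c + 3 + of_nat (i + j + n))"
proof -
  have e: "Adens a b c uv * (of_real (fst uv) ^ i * of_real (snd uv) ^ j * (of_real (fst uv) + of_real (snd uv)) ^ n)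
    = (\<Sum>p\<le>n. of_nat (n choose p) * (Adens a b c uv * (of_real (fst uv) ^ (i + p) * of_real (snd uv) ^ (j + (n - p)))))" for uv
    unfolding binomial_ring sum_distrib_left
    by (intro sum.cong refl) (simp only: power_add mult_ac)
  note M = Adens_monomial[OF a b c]
  show "integrable lborel (\<lambda>uv. Adens a b c uv * (of_real (fst uv) ^ i * of_real (snd uv) ^ j * (of_real (fst uv) + of_real (snd uv)) ^ n))"
    unfolding e by (intro Bochner_Integration.integrable_sum integrable_mult_right M)
  have "(\<integral>uv. Adens a b c uv * (of_real (fst uv) ^ i * of_real (snd uv) ^ j * (of_real (fst uv) + of_real (snd uv)) ^ n) \<partial>lborel)
    = (\<Sum>p\<le>n. of_nat (n choose p) * (pochhammer (a + 1) (i + p) * pochhammer (b + 1) (j + (n - p)) * rGamma (a + b + c + 3 + of_nat (i + p + (j + (n - p))))))"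
    unfolding e by (subst Bochner_Integration.integral_sum) (auto intro!: integrable_mult_right M simp: M(2))
  also have "\<dots> = (\<Sum>p\<le>n. (pochhammer (a + 1) i * pochhammer (b + 1) j * rGamma (a + b + c + 3 + of_nat (i + j + n))) *
      (of_nat (n choose p) * pochhammer (a + 1 + of_nat i) p * pochhammer (b + 1 + of_nat j) (n - p)))"
  proof (intro sum.cong refl)
    fix p assume "p \<in> {..n}"
    then have ix: "i + p + (j + (n - p)) = i + j + n" by simp
    show "of_nat (n choose p) * (pochhammer (a + 1) (i + p) * pochhammer (b + 1) (j + (n - p)) * rGamma (a + b + c + 3 + of_nat (i + p + (j + (n - p)))))
      = (pochhammer (a + 1) i * pochhammer (b + 1) j * rGamma (a + b + c + 3 + of_nat (i + j + n))) *
      (of_nat (n choose p) * pochhammer (a + 1 + of_nat i) p * pochhammer (b + 1 + of_nat j) (n - p))"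
      unfolding ix pochhammer_product' by (simp only: mult_ac)
  qed
  also have "\<dots> = (pochhammer (a + 1) i * pochhammer (b + 1) j * rGamma (a + b + c + 3 + of_nat (i + j + n))) *
      pochhammer ((a + 1 + of_nat i) + (b + 1 + of_nat j)) n"
    unfolding pochhammer_binomial_sum sum_distrib_left ..
  also have "(a + 1 + of_nat i) + (b + 1 + of_nat j) = a + b + 2 + of_nat (i + j)" by simp
  finally show "(\<integral>uv. Adens a b c uv * (of_real (fst uv) ^ i * of_real (snd uv) ^ j * (of_real (fst uv) + of_real (snd uv)) ^ n) \<partial>lborel)
      = pochhammer (a + 1) i * pochhammer (b + 1) j * pochhammer (a + b + 2 + of_nat (i + j)) n * rGamma (a + b + c + 3 + of_nat (i + j + n))"
    by (simp only: mult_ac)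
qed

lemma Adens_Pcoef:
  assumes a: "Re a > - 1" and b: "Re b > - 1" and c: "Re c > - 1"
  shows "integrable lborel (\<lambda>uv. Adens a b c uv * Pcoef \<zeta> \<zeta>' t k (of_real (fst uv)) (of_real (snd uv)))"
    and "(\<integral>uv. Adens a b c uv * Pcoef \<zeta> \<zeta>' t k (of_real (fst uv)) (of_real (snd uv)) \<partial>lborel)
       = dcoef \<zeta> \<zeta>' t a b k * rGamma (a + b + c + 3 + of_nat k)"
proof -
  define q where "q m i = pochhammer (- \<zeta>) i / fact i * (pochhammer (- \<zeta>') (m - i) / fact (m - i)) * (pochhammer t (k - m) / fact (k - m))" for m i
  have e: "Adens a b c uv * Pcoef \<zeta> \<zeta>' t k (of_real (fst uv)) (of_real (snd uv)) =
    (\<Sum>m\<le>k. \<Sum>i\<le>m. q m i * (Adens a b c uv * (of_real (fst uv) ^ i * of_real (snd uv) ^ (m - i) * (of_real (fst uv) + of_real (snd uv)) ^ (k - m))))" for uv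
    unfolding Pcoef_def sum_distrib_left sum_distrib_right q_def
    by (intro sum.cong refl) (simp only: mult_ac)
  note M = Adens_monomial_power[OF a b c]
  show "integrable lborel (\<lambda>uv. Adens a b c uv * Pcoef \<zeta> \<zeta>' t k (of_real (fst uv)) (of_real (snd uv)))"
    unfolding e by (intro Bochner_Integration.integrable_sum integrable_mult_right M)
  have "(\<integral>uv. Adens a b c uv * Pcoef \<zeta> \<zeta>' t k (of_real (fst uv)) (of_real (snd uv)) \<partial>lborel)
    = (\<Sum>m\<le>k. \<Sum>i\<le>m. q m i * (pochhammer (a + 1) i * pochhammer (b + 1) (m - i) * pochhammer (a + b + 2 + of_nat (i + (m - i))) (k - m) * rGamma (a + b + c + 3 + of_nat (i + (m - i) + (k - m)))))"
    unfolding e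
    by (subst Bochner_Integration.integral_sum, intro Bochner_Integration.integrable_sum integrable_mult_right M,
        intro sum.cong refl, subst Bochner_Integration.integral_sum, intro integrable_mult_right M)
       (simp only: integral_mult_right_zero M(2))
  also have "\<dots> = dcoef \<zeta> \<zeta>' t a b k * rGamma (a + b + c + 3 + of_nat k)"
    unfolding dcoef_def sum_distrib_right q_def
  proof (intro sum.cong refl)
    fix m i assume "m \<in> {..k}" "i \<in> {..m}"
    then have ix: "i + (m - i) = m" "m + (k - m) = k" by auto
    show "pochhammer (- \<zeta>) i / fact i * (pochhammer (- \<zeta>') (m - i) / fact (m - i)) * (pochhammer t (k - m) / fact (k - m)) *
      (pochhammer (a + 1) i * pochhammer (b + 1) (m - i) * pochhammer (a + b + 2 + of_nat (i + (m - i))) (k - m) * rGamma (a + b + c + 3 + of_nat (i + (m - i) + (k - m))))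
      = pochhammer (- \<zeta>) i / fact i * pochhammer (a + 1) i * (pochhammer (- \<zeta>') (m - i) / fact (m - i) * pochhammer (b + 1) (m - i))
      * (pochhammer t (k - m) / fact (k - m) * pochhammer (a + b + 2 + of_nat m) (k - m)) * rGamma (a + b + c + 3 + of_nat k)"
      unfolding ix by (simp only: mult_ac)
  qed
  finally show "(\<integral>uv. Adens a b c uv * Pcoef \<zeta> \<zeta>' t k (of_real (fst uv)) (of_real (snd uv)) \<partial>lborel)
       = dcoef \<zeta> \<zeta>' t a b k * rGamma (a + b + c + 3 + of_nat k)" .
qed

text \<open>The parameters of the test function are separate from the exponents \<open>a\<close>,
  \<open>b\<close>, \<open>c\<close>: the pairing continues in the exponents only, with the test
  function held fixed.\<close>

definition Aseries :: "complex \<Rightarrow> complex \<Rightarrow> complex \<Rightarrow> complex \<Rightarrow> complex \<Rightarrow> complex \<Rightarrow> complex \<Rightarrow> complex" where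
  "Aseries \<zeta> \<zeta>' t s a b c = (suminf (\<lambda>k. dcoef \<zeta> \<zeta>' t a b k * rGamma (a + b + c + 3 + of_nat k) * s ^ k))"

text \<open>Polynomial growth of the Taylor coefficients on the triangle against the geometric
  factor (1 - x)^k justifies termwise integration. The range goes beyond positive real parts down to
  -1, which is what the positivity argument at real parameters uses.\<close>

theorem pairing_int_series:
  assumes a: "Re a > - 1" and b: "Re b > - 1" and c: "Re c > - 1" and x: "0 < x" "x < 1"
  shows "integrable lborel (\<lambda>uv. Adens a b c uv * Psi \<zeta> \<zeta>' t x uv)"
    and "pairing_int a b c (Psi \<zeta> \<zeta>' t x) = Aseries \<zeta> \<zeta>' t (of_real (1 - x)) a b c"
proof -
  define f where "f k uv = of_real (1 - x) ^ k * (Adens a b c uv * Pcoef \<zeta> \<zeta>' t k (of_real (fst uv)) (of_real (snd uv)))" for k uv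
  obtain r :: nat where "max (norm \<zeta>) (max (norm \<zeta>') (norm t)) \<le> real r" using real_arch_simple by blast
  then have r: "norm \<zeta> \<le> real r" "norm \<zeta>' \<le> real r" "norm t \<le> real r" by auto
  define B where "B = 3 * r + 2"
  have fi: "integrable lborel (f k)" for k
    unfolding f_def by (intro integrable_mult_right Adens_Pcoef a b c)
  have fb: "norm (f k uv) \<le> ((real k + 1) ^ B * (1 - x) ^ k) * norm (Adens a b c uv)" for k uv
  proof (cases "uv \<in> triangle")
    case True
    then have "norm (Pcoef \<zeta> \<zeta>' t k (of_real (fst uv)) (of_real (snd uv))) \<le> (real k + 1) ^ B"
      unfolding B_def by (intro Pcoef_bound r) (auto simp: triangle_def simp flip: of_real_add)
    then have "(1 - x) ^ k * norm (Adens a b c uv) * norm (Pcoef \<zeta> \<zeta>' t k (of_real (fst uv)) (of_real (snd uv)))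
      \<le> (1 - x) ^ k * norm (Adens a b c uv) * (real k + 1) ^ B"
      using x by (intro mult_left_mono) auto
    moreover have "norm (f k uv) = (1 - x) ^ k * norm (Adens a b c uv) * norm (Pcoef \<zeta> \<zeta>' t k (of_real (fst uv)) (of_real (snd uv)))"
      unfolding f_def norm_mult norm_power norm_of_real using x by simp
    ultimately show ?thesis by (simp only: mult_ac)
  qed (simp add: f_def Adens_eq_0)
  have sg: "summable (\<lambda>k. (real k + 1) ^ B * (1 - x) ^ k)" by (rule summable_poly_geometric) (use x in auto)
  have fs: "(\<lambda>k. f k uv) sums (Adens a b c uv * Psi \<zeta> \<zeta>' t x uv)" for uv
  proof (cases "uv \<in> triangle")
    case True
    then have "(fst uv, snd uv) \<in> triangle" by simp
    from sums_mult[OF Psi_series[OF x this], of "Adens a b c uv" \<zeta> \<zeta>' t]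
    show ?thesis unfolding f_def by (simp only: prod.collapse mult.left_commute)
  qed (simp add: f_def Adens_eq_0)
  have ae: "AE uv in lborel. summable (\<lambda>k. norm (f k uv))"
  proof (rule AE_I2)
    fix uv
    show "summable (\<lambda>k. norm (f k uv))"
      by (rule summable_comparison_test'[OF summable_mult2[OF sg, of "norm (Adens a b c uv)"], of 0]) (use fb in simp)
  qed
  have "summable (\<lambda>k. ((real k + 1) ^ B * (1 - x) ^ k) * (\<integral>uv. norm (Adens a b c uv) \<partial>lborel))"
    by (rule summable_mult2[OF sg])
  then have si: "summable (\<lambda>k. \<integral>uv. norm (f k uv) \<partial>lborel)"
  proof (rule summable_comparison_test'[of _ 0])
    fix k
    have "(\<integral>uv. norm (f k uv) \<partial>lborel) \<le> (\<integral>uv. ((real k + 1) ^ B * (1 - x) ^ k) * norm (Adens a b c uv) \<partial>lborel)"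
      by (intro integral_mono integrable_norm fi integrable_mult_right Adens_integral a b c fb)
    then show "norm (\<integral>uv. norm (f k uv) \<partial>lborel) \<le> ((real k + 1) ^ B * (1 - x) ^ k) * (\<integral>uv. norm (Adens a b c uv) \<partial>lborel)"
      by simp
  qed
  have sf: "(suminf (\<lambda>k. f k uv)) = Adens a b c uv * Psi \<zeta> \<zeta>' t x uv" for uv using fs[of uv] by (simp add: sums_iff)
  show "integrable lborel (\<lambda>uv. Adens a b c uv * Psi \<zeta> \<zeta>' t x uv)"
    using integrable_suminf[OF fi ae si] unfolding sf .
  have "pairing_int a b c (Psi \<zeta> \<zeta>' t x) = (\<integral>uv. (suminf (\<lambda>k. f k uv)) \<partial>lborel)"
    unfolding pairing_int_eq sf ..
  also have "\<dots> = (suminf (\<lambda>k. \<integral>uv. f k uv \<partial>lborel))" by (rule integral_suminf[OF fi ae si])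
  also have "\<dots> = Aseries \<zeta> \<zeta>' t (of_real (1 - x)) a b c"
    unfolding f_def Aseries_def integral_mult_right_zero Adens_Pcoef(2)[OF a b c] by (simp only: mult_ac)
  finally show "pairing_int a b c (Psi \<zeta> \<zeta>' t x) = Aseries \<zeta> \<zeta>' t (of_real (1 - x)) a b c" .
qed

section \<open>Entire dependence on the exponents and uniqueness of the continuation\<close>

lemma holomorphic_series_ball:
  fixes f :: "nat \<Rightarrow> complex \<Rightarrow> complex"
  assumes h: "\<And>k. f k holomorphic_on ball 0 R"
    and b: "\<And>k z. norm z < R \<Longrightarrow> norm (f k z) \<le> M k" and s: "summable M"
  shows "(\<lambda>z. suminf (\<lambda>k. f k z)) holomorphic_on ball 0 R"
proof (rule holomorphic_uniform_sequence[of _ "\<lambda>n z. \<Sum>k<n. f k z"])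
  have u: "uniform_limit (ball 0 R) (\<lambda>n z. \<Sum>k<n. f k z) (\<lambda>z. suminf (\<lambda>k. f k z)) sequentially"
    by (rule Weierstrass_m_test[OF _ s]) (use b in auto)
  fix z :: complex assume "z \<in> ball 0 R"
  then obtain d where "d > 0" "cball z d \<subseteq> ball 0 R"
    using open_contains_cball[of "ball (0::complex) R"] open_ball by blast
  then show "\<exists>d>0. cball z d \<subseteq> ball 0 R \<and> uniform_limit (cball z d) (\<lambda>n z. \<Sum>k<n. f k z) (\<lambda>z. suminf (\<lambda>k. f k z)) sequentially"
    using uniform_limit_on_subset[OF u] by blast
qed (auto intro!: holomorphic_intros h)

lemma holomorphic_series_UNIV:
  fixes f :: "nat \<Rightarrow> complex \<Rightarrow> complex"
  assumes h: "\<And>k. f k holomorphic_on UNIV"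
    and b: "\<And>R. \<exists>M. summable M \<and> (\<forall>k z. norm z < R \<longrightarrow> norm (f k z) \<le> M k)"
  shows "(\<lambda>z. suminf (\<lambda>k. f k z)) holomorphic_on UNIV"
proof -
  have "(\<lambda>z. suminf (\<lambda>k. f k z)) holomorphic_on ball 0 R" for R
  proof -
    obtain M where "summable M" "\<forall>k z. norm z < R \<longrightarrow> norm (f k z) \<le> M k" using b by blast
    then show ?thesis by (intro holomorphic_series_ball[of f R M] holomorphic_on_subset[OF h]) auto
  qed
  then have "(\<lambda>z. suminf (\<lambda>k. f k z)) field_differentiable at z" for z
    using holomorphic_on_imp_differentiable_at[of _ "ball 0 (norm z + 1)" z] by auto
  then show ?thesis by (simp add: holomorphic_on_def field_differentiable_at_within)
qed

lemma fact_add_ge: "fact k * (real k + 1) ^ n \<le> fact (k + n)"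
proof (induction n)
  case (Suc n)
  have "fact k * (real k + 1) ^ Suc n = (fact k * (real k + 1) ^ n) * (real k + 1)" by simp
  also have "\<dots> \<le> fact (k + n) * (real (k + n) + 1)" using Suc by (intro mult_mono) auto
  also have "\<dots> = fact (k + Suc n)" by (simp add: algebra_simps)
  finally show ?case .
qed simp

text \<open>The factorial in \<open>dcoef\<close> meets one with index \<open>k + n\<close> in the
  reciprocal Gamma factor; their quotient gains n powers of \<open>k + 1\<close>. With
  \<open>n = 0\<close> this bounds the series in 1 - x, with \<open>n = l + 2\<close> the series for
  a moment.\<close>

lemma term_bounds:
  obtains C :: real and B M :: nat where "C \<ge> 0"
    "\<And>\<zeta> \<zeta>' t a b c k n. norm \<zeta> \<le> R \<Longrightarrow> norm \<zeta>' \<le> R \<Longrightarrow> norm t \<le> R \<Longrightarrow> norm a \<le> R \<Longrightarrow> norm b \<le> R \<Longrightarrow> norm c \<le> R \<Longrightarrow>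
      norm (dcoef \<zeta> \<zeta>' t a b k * rGamma (a + b + c + 3 + of_nat (k + n)))
        \<le> C * (real (k + n) + 1) ^ M * (real k + 1) ^ B / (real k + 1) ^ n"
proof -
  obtain r0 :: nat where "2 * R + 3 \<le> real r0" using real_arch_simple by blast
  then obtain r :: nat where r: "2 * R + 3 \<le> real r" "1 \<le> r" by (intro that[of "max 1 r0"]) auto
  obtain C M where C: "C \<ge> 0" "\<And>w k. norm w \<le> 3 * R + 3 \<Longrightarrow> norm (rGamma (w + of_nat k) :: complex) \<le> C * (real k + 1) ^ M / fact k"
    using rGamma_bound[of "3 * R + 3"] by metis
  show ?thesis
  proof (rule that[of C M "6 * r + 2"])
    fix \<zeta> \<zeta>' t a b c :: complex and k n :: nat
    assume n: "norm \<zeta> \<le> R" "norm \<zeta>' \<le> R" "norm t \<le> R" "norm a \<le> R" "norm b \<le> R" "norm c \<le> R"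
    have R: "R \<ge> 0" using n(1) norm_ge_zero order.trans by blast
    have "norm (dcoef \<zeta> \<zeta>' t a b k) \<le> fact k * (real k + 1) ^ (6 * r + 2)"
    proof (rule dcoef_bound[OF _ _ _ _ _ _ r(2)])
      show "norm (a + 1) \<le> real r" "norm (b + 1) \<le> real r"
        using norm_triangle_ineq[of a 1] norm_triangle_ineq[of b 1] n r R by auto
      have "norm (a + b + 2) \<le> norm a + norm b + 2"
        using norm_triangle_ineq[of "a + b" 2] norm_triangle_ineq[of a b] by simp
      then show "norm (a + b + 2) \<le> real r" using n r R by linarith
    qed (use n r R in auto)
    moreover have "norm (a + b + c + 3) \<le> norm a + norm b + norm c + 3"
      using norm_triangle_ineq[of "a + b + c" 3] norm_triangle_ineq[of "a + b" c] norm_triangle_ineq[of a b] by simp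
    then have "norm (rGamma (a + b + c + 3 + of_nat (k + n))) \<le> C * (real (k + n) + 1) ^ M / fact (k + n)"
      using n by (intro C) linarith
    ultimately have "norm (dcoef \<zeta> \<zeta>' t a b k * rGamma (a + b + c + 3 + of_nat (k + n)))
       \<le> (fact k * (real k + 1) ^ (6 * r + 2)) * (C * (real (k + n) + 1) ^ M / fact (k + n))"
      unfolding norm_mult by (intro mult_mono) auto
    also have "\<dots> = (C * (real (k + n) + 1) ^ M * (real k + 1) ^ (6 * r + 2)) * (fact k / fact (k + n))"
      by (simp only: times_divide_eq_right times_divide_eq_left mult_ac)
    also have "\<dots> \<le> (C * (real (k + n) + 1) ^ M * (real k + 1) ^ (6 * r + 2)) * (1 / (real k + 1) ^ n)"
    proof (rule mult_left_mono)
      show "fact k / fact (k + n) \<le> 1 / (real k + 1) ^ n"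
        using fact_add_ge[of k n] by (simp add: divide_simps)
    qed (use C in simp)
    finally show "norm (dcoef \<zeta> \<zeta>' t a b k * rGamma (a + b + c + 3 + of_nat (k + n)))
        \<le> C * (real (k + n) + 1) ^ M * (real k + 1) ^ (6 * r + 2) / (real k + 1) ^ n" by simp
  qed (use C in simp)
qed

lemma term_bounds_geometric:
  assumes s: "norm s < 1"
  obtains F :: "nat \<Rightarrow> real" where "summable F"
    "\<And>\<zeta> \<zeta>' t a b c k. norm \<zeta> \<le> R \<Longrightarrow> norm \<zeta>' \<le> R \<Longrightarrow> norm t \<le> R \<Longrightarrow> norm a \<le> R \<Longrightarrow> norm b \<le> R \<Longrightarrow> norm c \<le> R \<Longrightarrow>
      norm (dcoef \<zeta> \<zeta>' t a b k * rGamma (a + b + c + 3 + of_nat k) * s ^ k) \<le> F k"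
proof -
  obtain C :: real and B M :: nat where C: "C \<ge> 0"
    "\<And>\<zeta> \<zeta>' t a b c k n. norm \<zeta> \<le> R \<Longrightarrow> norm \<zeta>' \<le> R \<Longrightarrow> norm t \<le> R \<Longrightarrow> norm a \<le> R \<Longrightarrow> norm b \<le> R \<Longrightarrow> norm c \<le> R \<Longrightarrow>
      norm (dcoef \<zeta> \<zeta>' t a b k * rGamma (a + b + c + 3 + of_nat (k + n)))
        \<le> C * (real (k + n) + 1) ^ M * (real k + 1) ^ B / (real k + 1) ^ n"
    using term_bounds[of R] by metis
  show ?thesis
  proof (rule that[of "\<lambda>k. C * ((real k + 1) ^ (M + B) * norm s ^ k)"])
    show "summable (\<lambda>k. C * ((real k + 1) ^ (M + B) * norm s ^ k))"
      by (intro summable_mult summable_poly_geometric) (use s in auto)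
    fix \<zeta> \<zeta>' t a b c :: complex and k :: nat
    assume n: "norm \<zeta> \<le> R" "norm \<zeta>' \<le> R" "norm t \<le> R" "norm a \<le> R" "norm b \<le> R" "norm c \<le> R"
    have "norm (dcoef \<zeta> \<zeta>' t a b k * rGamma (a + b + c + 3 + of_nat k)) \<le> C * (real k + 1) ^ (M + B)"
      using C(2)[OF n, of k 0] by (simp add: power_add mult.assoc)
    then have "norm (dcoef \<zeta> \<zeta>' t a b k * rGamma (a + b + c + 3 + of_nat k)) * norm s ^ k \<le> C * (real k + 1) ^ (M + B) * norm s ^ k"
      by (intro mult_right_mono) auto
    then show "norm (dcoef \<zeta> \<zeta>' t a b k * rGamma (a + b + c + 3 + of_nat k) * s ^ k) \<le> C * ((real k + 1) ^ (M + B) * norm s ^ k)"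
      unfolding norm_mult[of _ "s ^ k"] norm_power by (simp only: mult.assoc)
  qed
qed

lemma Aseries_entire:
  assumes s: "norm s < 1"
  shows "sep_entire (Aseries \<zeta> \<zeta>' t s)"
proof -
  \<comment> \<open>One argument for all three variables: two of \<open>f\<close>, \<open>g\<close>,
    \<open>h\<close> will be constant and the third the identity. The bounds by
    \<open>K + norm z\<close> keep the arguments in a fixed ball.\<close>
  have "(\<lambda>z. Aseries \<zeta> \<zeta>' t s (f z) (g z) (h z)) holomorphic_on UNIV"
    if fgh: "f holomorphic_on UNIV" "g holomorphic_on UNIV" "h holomorphic_on UNIV"
      and bd: "\<And>z. norm (f z) \<le> K + norm z" "\<And>z. norm (g z) \<le> K + norm z" "\<And>z. norm (h z) \<le> K + norm z"
    for f g h :: "complex \<Rightarrow> complex" and K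
    unfolding Aseries_def
  proof (rule holomorphic_series_UNIV)
    fix k
    show "(\<lambda>z. dcoef \<zeta> \<zeta>' t (f z) (g z) k * rGamma (f z + g z + h z + 3 + of_nat k) * s ^ k) holomorphic_on UNIV"
      unfolding dcoef_def by (auto intro!: holomorphic_intros fgh)
  next
    fix R
    define R' where "R' = max (norm \<zeta>) (max (norm \<zeta>') (max (norm t) (K + R)))"
    obtain F where F: "summable F" "\<And>\<zeta> \<zeta>' t a b c k. norm \<zeta> \<le> R' \<Longrightarrow> norm \<zeta>' \<le> R' \<Longrightarrow> norm t \<le> R' \<Longrightarrow> norm a \<le> R' \<Longrightarrow> norm b \<le> R' \<Longrightarrow> norm c \<le> R' \<Longrightarrow>
      norm (dcoef \<zeta> \<zeta>' t a b k * rGamma (a + b + c + 3 + of_nat k) * s ^ k) \<le> F k"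
      using term_bounds_geometric[OF s, of R'] by metis
    have le: "norm (f z) \<le> R'" "norm (g z) \<le> R'" "norm (h z) \<le> R'" if "norm z < R" for z
      using bd[of z] that unfolding R'_def by (simp_all add: le_max_iff_disj)
    show "\<exists>M. summable M \<and> (\<forall>k z. norm z < R \<longrightarrow> norm (dcoef \<zeta> \<zeta>' t (f z) (g z) k * rGamma (f z + g z + h z + 3 + of_nat k) * s ^ k) \<le> M k)"
      by (intro exI[of _ F] conjI allI impI F le) (auto simp: R'_def)
  qed
  note H = this
  show ?thesis unfolding sep_entire_def
  proof (intro conjI allI)
    fix b c show "(\<lambda>a. Aseries \<zeta> \<zeta>' t s a b c) holomorphic_on UNIV"
      by (rule H[where K = "norm b + norm c"]) (auto intro!: holomorphic_intros)
  next
    fix a c show "(\<lambda>b. Aseries \<zeta> \<zeta>' t s a b c) holomorphic_on UNIV"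
      by (rule H[where K = "norm a + norm c"]) (auto intro!: holomorphic_intros)
  next
    fix a b show "(\<lambda>c. Aseries \<zeta> \<zeta>' t s a b c) holomorphic_on UNIV"
      by (rule H[where K = "norm a + norm b"]) (auto intro!: holomorphic_intros)
  qed
qed

lemma entire_eq_half_plane:
  assumes "f holomorphic_on UNIV" "g holomorphic_on UNIV" "\<And>z. 0 < Re z \<Longrightarrow> f z = g z"
  shows "f z = (g z :: complex)"
  by (rule analytic_continuation_open[of "{z. 0 < Re z}" UNIV])
     (use assms in \<open>auto simp: open_halfspace_Re_gt intro: exI[of _ 1]\<close>)

text \<open>The half-plane restriction is removed one variable at a time, each time by the identity
  theorem in that variable with the other two fixed.\<close>

lemma sep_entire_unique:
  assumes G: "sep_entire G" and H: "sep_entire H"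
    and eq: "\<And>a b c. 0 < Re a \<Longrightarrow> 0 < Re b \<Longrightarrow> 0 < Re c \<Longrightarrow> G a b c = H a b c"
  shows "G a b c = H a b c"
proof -
  have 1: "G a b c = H a b c" if "0 < Re b" "0 < Re c" for a b c
    by (rule entire_eq_half_plane[of "\<lambda>a. G a b c" "\<lambda>a. H a b c"]) (use G H eq that in \<open>auto simp: sep_entire_def\<close>)
  have 2: "G a b c = H a b c" if "0 < Re c" for a b c
    by (rule entire_eq_half_plane[of "\<lambda>b. G a b c" "\<lambda>b. H a b c"]) (use G H 1 that in \<open>auto simp: sep_entire_def\<close>)
  show ?thesis
    by (rule entire_eq_half_plane[of "\<lambda>c. G a b c" "\<lambda>c. H a b c"]) (use G H 2 in \<open>auto simp: sep_entire_def\<close>)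
qed

theorem pairing_Psi:
  assumes x: "0 < x" "x < 1"
  shows "pairing a b c (Psi \<zeta> \<zeta>' t x) = Aseries \<zeta> \<zeta>' t (of_real (1 - x)) a b c"
proof -
  define G where "G = Aseries \<zeta> \<zeta>' t (of_real (1 - x))"
  have "norm (of_real (1 - x) :: complex) < 1" unfolding norm_of_real using x by simp
  then have 1: "sep_entire G" unfolding G_def by (rule Aseries_entire)
  have 2: "G a b c = pairing_int a b c (Psi \<zeta> \<zeta>' t x)" if "0 < Re a" "0 < Re b" "0 < Re c" for a b c
    unfolding G_def by (rule pairing_int_series(2)[symmetric]) (use x that in auto)
  have "pairing a b c (Psi \<zeta> \<zeta>' t x) = G a b c"
    unfolding pairing_def
  proof (rule the_equality)
    show "\<exists>Ga. sep_entire Ga \<and> (\<forall>a b c. 0 < Re a \<and> 0 < Re b \<and> 0 < Re c \<longrightarrow> Ga a b c = pairing_int a b c (Psi \<zeta> \<zeta>' t x)) \<and> G a b c = Ga a b c"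
      using 1 2 by blast
    fix w assume "\<exists>Ga. sep_entire Ga \<and> (\<forall>a b c. 0 < Re a \<and> 0 < Re b \<and> 0 < Re c \<longrightarrow> Ga a b c = pairing_int a b c (Psi \<zeta> \<zeta>' t x)) \<and> w = Ga a b c"
    then obtain H where H: "sep_entire H" "\<And>a b c. 0 < Re a \<Longrightarrow> 0 < Re b \<Longrightarrow> 0 < Re c \<Longrightarrow> H a b c = pairing_int a b c (Psi \<zeta> \<zeta>' t x)" "w = H a b c"
      by blast
    show "w = G a b c" unfolding H(3) by (rule sep_entire_unique[OF H(1) 1]) (simp add: H(2) 2)
  qed
  then show ?thesis by (simp add: G_def)
qed

text \<open>Up to the factor (l+1)!, the moment of order l + 1 of (1-x)^g \<open>Kser\<close>, where
  g = t - z - z'. The Beta integral of the k-th term divides by the Pochhammer symbol (g+k+1)_(l+2),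
  and this shifts the argument of \<open>rGamma\<close> by \<open>l + 2\<close>.\<close>

definition Nser :: "complex \<Rightarrow> complex \<Rightarrow> complex \<Rightarrow> nat \<Rightarrow> complex" where
  "Nser z z' t l = (suminf (\<lambda>k. dcoef z z' t (- z) (- z') k * rGamma (t - z - z' + 1 + of_nat (k + (l + 2)))))"

text \<open>The pairing of the theorem as a function of s = 1 - x, with t not yet tied to the
  product of \<open>z\<close> and \<open>z'\<close>.\<close>

definition Kser :: "complex \<Rightarrow> complex \<Rightarrow> complex \<Rightarrow> complex \<Rightarrow> complex" where
  "Kser z z' t s = Aseries z z' t s (- z) (- z') (t - 2)"

text \<open>Among the \<open>l + 2\<close> gained powers of \<open>k + 1\<close>, \<open>l\<close>
  of them absorb the polynomial growth as soon as \<open>l \<ge> L\<close>, and two remain for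
  summability. The bounds are uniform in the parameters, as continuation requires.\<close>

lemma moment_bounds:
  obtains L :: nat and C :: real and Q :: nat where
    "\<And>z z' t k. norm z \<le> R \<Longrightarrow> norm z' \<le> R \<Longrightarrow> norm t \<le> R \<Longrightarrow>
      norm (dcoef z z' t (- z) (- z') k * rGamma (t - z - z' + 1 + of_nat k)) \<le> C * (real k + 1) ^ Q"
    "C \<ge> 0" "Q \<le> L"
    "\<And>z z' t k l. norm z \<le> R \<Longrightarrow> norm z' \<le> R \<Longrightarrow> norm t \<le> R \<Longrightarrow> L \<le> l \<Longrightarrow>
      norm (dcoef z z' t (- z) (- z') k * rGamma (t - z - z' + 1 + of_nat (k + (l + 2))))
        \<le> C * (real l + 3) ^ L * (1 / (real k + 1)\<^sup>2)"
proof -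
  \<comment> \<open>The radius is enlarged by 2 because the third exponent is
    \<open>t - 2\<close>.\<close>
  obtain C :: real and B M :: nat where C: "C \<ge> 0"
    "\<And>\<zeta> \<zeta>' t a b c k n. norm \<zeta> \<le> R + 2 \<Longrightarrow> norm \<zeta>' \<le> R + 2 \<Longrightarrow> norm t \<le> R + 2 \<Longrightarrow> norm a \<le> R + 2 \<Longrightarrow> norm b \<le> R + 2 \<Longrightarrow> norm c \<le> R + 2 \<Longrightarrow>
      norm (dcoef \<zeta> \<zeta>' t a b k * rGamma (a + b + c + 3 + of_nat (k + n)))
        \<le> C * (real (k + n) + 1) ^ M * (real k + 1) ^ B / (real k + 1) ^ n"
    using term_bounds[of "R + 2"] by metis
  have C': "norm (dcoef z z' t (- z) (- z') k * rGamma (t - z - z' + 1 + of_nat (k + n)))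
      \<le> C * (real (k + n) + 1) ^ M * (real k + 1) ^ B / (real k + 1) ^ n"
    if "norm z \<le> R" "norm z' \<le> R" "norm t \<le> R" for z z' t :: complex and k n :: nat
  proof -
    have "norm (t - 2) \<le> R + 2" using norm_triangle_ineq4[of t 2] that by simp
    moreover have "- z + - z' + (t - 2) + 3 = t - z - z' + 1" by simp
    ultimately show ?thesis using C(2)[of z z' t "- z" "- z'" "t - 2" k n] that
      by (simp only: norm_minus_cancel)
  qed
  show ?thesis
  proof (rule that[where L = "M + B" and C = C and Q = "M + B"])
    fix z z' t :: complex and k :: nat
    assume zt: "norm z \<le> R" "norm z' \<le> R" "norm t \<le> R"
    show "norm (dcoef z z' t (- z) (- z') k * rGamma (t - z - z' + 1 + of_nat k)) \<le> C * (real k + 1) ^ (M + B)"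
      using C'[OF zt, of k 0] by (simp add: power_add mult.assoc)
  next
    fix z z' t :: complex and k l :: nat
    assume zt: "norm z \<le> R" "norm z' \<le> R" "norm t \<le> R" and l: "M + B \<le> l"
    have a: "real (k + (l + 2)) + 1 \<le> (real l + 3) * (real k + 1)"
      by (simp add: algebra_simps)
    have "norm (dcoef z z' t (- z) (- z') k * rGamma (t - z - z' + 1 + of_nat (k + (l + 2))))
      \<le> C * (real (k + (l + 2)) + 1) ^ M * (real k + 1) ^ B / (real k + 1) ^ (l + 2)"
      by (rule C'[OF zt])
    also have "\<dots> \<le> C * ((real l + 3) * (real k + 1)) ^ M * (real k + 1) ^ B / (real k + 1) ^ (l + 2)"
      using C(1) by (intro divide_right_mono mult_right_mono mult_left_mono power_mono a) auto
    also have "\<dots> = C * (real l + 3) ^ M * ((real k + 1) ^ (M + B) / (real k + 1) ^ l) * (1 / (real k + 1)\<^sup>2)"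
      by (simp add: power_mult_distrib power_add power2_eq_square mult_ac)
    also have "\<dots> \<le> C * (real l + 3) ^ (M + B) * 1 * (1 / (real k + 1)\<^sup>2)"
    proof (rule mult_right_mono, rule mult_mono)
      show "C * (real l + 3) ^ M \<le> C * (real l + 3) ^ (M + B)"
        using C(1) by (intro mult_left_mono power_increasing) auto
      have "(real k + 1) ^ (M + B) \<le> (real k + 1) ^ l" using l by (intro power_increasing) auto
      then show "(real k + 1) ^ (M + B) / (real k + 1) ^ l \<le> 1" by (simp add: divide_simps)
    qed (use C(1) in auto)
    finally show "norm (dcoef z z' t (- z) (- z') k * rGamma (t - z - z' + 1 + of_nat (k + (l + 2))))
      \<le> C * (real l + 3) ^ (M + B) * (1 / (real k + 1)\<^sup>2)" by simp
  qed (use C in auto)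
qed

section \<open>Moments of the analytic density\<close>

lemma summable_inverse_Suc_sq: "summable (\<lambda>k. 1 / (real k + 1)\<^sup>2)"
proof -
  have "summable (\<lambda>n. inverse ((real n)\<^sup>2))" by (rule inverse_power_summable) simp
  then have "summable (\<lambda>n. inverse ((real (Suc n))\<^sup>2))" by (subst summable_Suc_iff)
  then show ?thesis by (simp add: inverse_eq_divide add.commute)
qed

text \<open>The Beta integrand x^l (1-x)^g on (0, 1), written through \<open>phi\<close> so that its
  integral is an instance of \<open>phi_convolution\<close>.\<close>

definition bfun :: "complex \<Rightarrow> nat \<Rightarrow> real \<Rightarrow> complex" where
  "bfun g l x = (fact l * phi (of_nat l) x) * (Gamma (g + 1) * phi g (1 - x))"

lemma bfun_eq:
  assumes g: "Re g > - 1"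
  shows "bfun g l x = (if 0 < x \<and> x < 1 then of_real x ^ l * of_real (1 - x) powr g else 0)"
proof -
  have "Gamma (of_nat l + 1 :: complex) = fact l" using Gamma_fact[of l, where 'a = complex] by (simp add: add.commute)
  then show ?thesis using Gamma_nz[OF g] by (auto simp: bfun_def phi_def powr_nat)
qed

lemma bfun_integral:
  assumes g: "Re g > - 1"
  shows "integrable lborel (bfun g l)"
    and "(\<integral>x. bfun g l x \<partial>lborel) = fact l / pochhammer (g + 1) (l + 1)"
proof -
  have l: "Re (of_nat l :: complex) > - 1" by (simp add: order.strict_trans2[of _ 0])
  have e: "bfun g l x = (fact l * Gamma (g + 1)) * (phi (of_nat l) x * phi g (1 - x))" for x
    by (simp add: bfun_def)
  show "integrable lborel (bfun g l)"
    unfolding e[abs_def] by (intro integrable_mult_right phi_conv_integrable l g)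
  have p: "g + 1 \<notin> \<int>\<^sub>\<le>\<^sub>0" using g by (auto elim!: nonpos_Ints_cases simp: complex_eq_iff)
  have "(\<integral>x. bfun g l x \<partial>lborel) = (fact l * Gamma (g + 1)) * phi (of_nat l + g + 1) 1"
    unfolding e integral_mult_right_zero phi_convolution[OF l g] ..
  also have "phi (of_nat l + g + 1) 1 = 1 / Gamma (g + 1 + of_nat (l + 1))" by (simp add: phi_def add_ac)
  also have "(fact l * Gamma (g + 1)) * (1 / Gamma (g + 1 + of_nat (l + 1))) = fact l / pochhammer (g + 1) (l + 1)"
    using pochhammer_Gamma[OF p, of "l + 1"] by simp
  finally show "(\<integral>x. bfun g l x \<partial>lborel) = fact l / pochhammer (g + 1) (l + 1)" .
qed

lemma bfun_norm_integral:
  assumes g: "Re g > - 1"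
  shows "(\<integral>x. norm (bfun g l x) \<partial>lborel) = fact l / pochhammer (Re g + 1) (l + 1)"
proof -
  have n: "of_real (norm (bfun g l x)) = bfun (of_real (Re g)) l x" for x
    using g by (simp add: bfun_eq norm_mult norm_power norm_powr_real_powr flip: powr_of_real)
  have "complex_of_real (\<integral>x. norm (bfun g l x) \<partial>lborel) = (\<integral>x. bfun (of_real (Re g)) l x \<partial>lborel)"
    unfolding n[symmetric] by (rule integral_complex_of_real[symmetric])
  also have "\<dots> = of_real (fact l / pochhammer (Re g + 1) (l + 1))"
    using g by (subst bfun_integral(2)) (auto simp flip: pochhammer_of_real)
  finally show ?thesis by (simp only: of_real_eq_iff)
qed

text \<open>The exponent is \<open>l + 1\<close> and not \<open>l\<close> because \<open>\<rho>\<^sub>1\<close> carries the factor \<open>\<bar>x\<bar>\<^sup>-\<^sup>1\<close> relative to \<open>\<sigma>\<^sub>1\<close>.\<close>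

definition wfun :: "complex \<Rightarrow> complex \<Rightarrow> complex \<Rightarrow> nat \<Rightarrow> real \<Rightarrow> complex" where
  "wfun z z' t l x = (if 0 < x \<and> x < 1
     then of_real x ^ (l + 1) * of_real (1 - x) powr (t - z - z') * Kser z z' t (of_real (1 - x)) else 0)"

lemma Kser_sums:
  assumes s: "norm s < 1"
  shows "(\<lambda>k. dcoef z z' t (- z) (- z') k * rGamma (t - z - z' + 1 + of_nat k) * s ^ k) sums Kser z z' t s"
proof -
  define R where "R = max (norm z) (max (norm z') (max (norm t) (norm (t - 2))))"
  obtain F where F: "summable F" "\<And>\<zeta> \<zeta>' t a b c k. norm \<zeta> \<le> R \<Longrightarrow> norm \<zeta>' \<le> R \<Longrightarrow> norm t \<le> R \<Longrightarrow> norm a \<le> R \<Longrightarrow> norm b \<le> R \<Longrightarrow> norm c \<le> R \<Longrightarrow>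
      norm (dcoef \<zeta> \<zeta>' t a b k * rGamma (a + b + c + 3 + of_nat k) * s ^ k) \<le> F k"
    using term_bounds_geometric[OF s, of R] by metis
  have e: "- z + - z' + (t - 2) + 3 = t - z - z' + 1" by simp
  have "summable (\<lambda>k. dcoef z z' t (- z) (- z') k * rGamma (- z + - z' + (t - 2) + 3 + of_nat k) * s ^ k)"
    by (rule summable_comparison_test'[OF F(1), of 0]) (intro F(2), auto simp: R_def)
  then show ?thesis unfolding Kser_def Aseries_def e by (rule summable_sums)
qed

text \<open>\<open>L\<close> depends on \<open>R\<close> alone. The first claim integrates the
  series term by term. The second keeps the sum holomorphic along any holomorphic path of
  parameters, without the restriction on the real part of t - z - z' that the integral
  needs.\<close>

theorem moment_integral:
  fixes R :: real
  obtains L :: nat where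
    "\<And>z z' t l. norm z \<le> R \<Longrightarrow> norm z' \<le> R \<Longrightarrow> norm t \<le> R \<Longrightarrow> L \<le> l \<Longrightarrow> Re (t - z - z') > - 1 \<Longrightarrow>
      integrable lborel (wfun z z' t l) \<and> (\<integral>x. wfun z z' t l x \<partial>lborel) = fact (l + 1) * Nser z z' t l"
    "\<And>l f g h. L \<le> l \<Longrightarrow> f holomorphic_on ball 0 R \<Longrightarrow> g holomorphic_on ball 0 R \<Longrightarrow> h holomorphic_on ball 0 R \<Longrightarrow>
      (\<And>x. norm x < R \<Longrightarrow> norm (f x) \<le> R \<and> norm (g x) \<le> R \<and> norm (h x) \<le> R) \<Longrightarrow>
      (\<lambda>x. Nser (f x) (g x) (h x) l) holomorphic_on ball 0 R"
proof -
  obtain L :: nat and C :: real and Q :: nat where LC: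
    "\<And>z z' t k. norm z \<le> R \<Longrightarrow> norm z' \<le> R \<Longrightarrow> norm t \<le> R \<Longrightarrow>
      norm (dcoef z z' t (- z) (- z') k * rGamma (t - z - z' + 1 + of_nat k)) \<le> C * (real k + 1) ^ Q"
    "C \<ge> 0" "Q \<le> L"
    "\<And>z z' t k l. norm z \<le> R \<Longrightarrow> norm z' \<le> R \<Longrightarrow> norm t \<le> R \<Longrightarrow> L \<le> l \<Longrightarrow>
      norm (dcoef z z' t (- z) (- z') k * rGamma (t - z - z' + 1 + of_nat (k + (l + 2))))
        \<le> C * (real l + 3) ^ L * (1 / (real k + 1)\<^sup>2)"
    using moment_bounds[of R] by metis
  show ?thesis
  proof (rule that[of L])
    fix z z' t :: complex and l :: nat
    assume zt: "norm z \<le> R" "norm z' \<le> R" "norm t \<le> R" and l: "L \<le> l"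
    define g where "g = t - z - z'"
    assume g: "Re (t - z - z') > - 1"
    define c where "c k = dcoef z z' t (- z) (- z') k * rGamma (g + 1 + of_nat k)" for k
    have gk: "Re (g + of_nat k) > - 1" for k using g by (simp add: g_def)
    define f where "f k x = c k * bfun (g + of_nat k) (l + 1) x" for k x
    have fi: "integrable lborel (f k)" for k unfolding f_def by (intro integrable_mult_right bfun_integral gk)
    have fs: "(\<lambda>k. f k x) sums wfun z z' t l x" for x
    proof (cases "0 < x \<and> x < 1")
      case True
      then have "norm (of_real (1 - x) :: complex) < 1" unfolding norm_of_real by simp
      from sums_mult[OF Kser_sums[OF this, of z z' t], of "of_real x ^ (l + 1) * of_real (1 - x) powr g"]
      have "(\<lambda>k. of_real x ^ (l + 1) * of_real (1 - x) powr g * (c k * of_real (1 - x) ^ k)) sums wfun z z' t l x"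
        using True by (simp add: wfun_def g_def c_def)
      moreover have "f k x = of_real x ^ (l + 1) * of_real (1 - x) powr g * (c k * of_real (1 - x) ^ k)" for k
      proof -
        have "of_real (1 - x) powr (g + of_nat k) = of_real (1 - x) powr g * (of_real (1 - x) :: complex) ^ k"
          using True by (simp add: powr_add powr_nat del: of_real_diff)
        then show ?thesis unfolding f_def bfun_eq[OF gk] using True by (simp only: if_True simp_thms mult_ac)
      qed
      ultimately show ?thesis by simp
    next
      case False
      then have "f k x = 0" for k unfolding f_def bfun_eq[OF gk] by (simp only: if_False mult_zero_right)
      moreover have "wfun z z' t l x = 0" using False by (auto simp: wfun_def)
      ultimately show ?thesis by simp
    qed
    have sf: "(suminf (\<lambda>k. f k x)) = wfun z z' t l x" for x using fs[of x] by (simp add: sums_iff)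
    have fn: "norm (f k x) = norm (c k) * norm (bfun (g + of_nat k) (l + 1) x)" for k x by (simp add: f_def norm_mult)
    have fint: "(\<integral>x. norm (f k x) \<partial>lborel) = norm (c k) * (fact (l + 1) / pochhammer (Re g + 1 + real k) (l + 2))" for k
      unfolding fn integral_mult_right_zero bfun_norm_integral[OF gk] by (simp add: add_ac)
    have si: "summable (\<lambda>k. \<integral>x. norm (f k x) \<partial>lborel)"
    \<comment> \<open>The comparison starts at k = 1: from \<open>Re g > - 1\<close> every factor of
      the Pochhammer symbol exceeds k, which is at least (k+1)/2 only from there on.\<close>
    proof (rule summable_comparison_test'[OF summable_mult[OF summable_inverse_Suc_sq], of 1 _ "C * fact (l + 1) * 2 ^ (l + 2)"])
      fix k :: nat assume k: "k \<ge> 1"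
      have "((real k + 1) / 2) ^ (l + 2) \<le> pochhammer (Re g + 1 + real k) (l + 2)"
      proof -
        have "((real k + 1) / 2) ^ (l + 2) = (\<Prod>j<l + 2. (real k + 1) / 2)" by simp
        also have "\<dots> \<le> (\<Prod>j<l + 2. Re g + 1 + real k + real j)"
          by (rule prod_mono) (use k g in \<open>auto simp: g_def\<close>)
        finally show ?thesis by (simp add: pochhammer_prod atLeast0LessThan)
      qed
      moreover have pp: "0 < pochhammer (Re g + 1 + real k) (l + 2)"
        by (rule pochhammer_pos) (use k g in \<open>auto simp: g_def\<close>)
      ultimately have "fact (l + 1) / pochhammer (Re g + 1 + real k) (l + 2) \<le> fact (l + 1) / ((real k + 1) / 2) ^ (l + 2)"
        using pp by (intro divide_left_mono mult_pos_pos) auto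
      moreover have "norm (c k) \<le> C * (real k + 1) ^ Q" unfolding c_def g_def by (rule LC(1)[OF zt])
      ultimately have "norm (c k) * (fact (l + 1) / pochhammer (Re g + 1 + real k) (l + 2))
        \<le> (C * (real k + 1) ^ Q) * (fact (l + 1) / ((real k + 1) / 2) ^ (l + 2))"
        using LC(2) g by (intro mult_mono) (auto intro!: divide_nonneg_nonneg pochhammer_nonneg simp: g_def)
      also have "\<dots> = (C * fact (l + 1) * 2 ^ (l + 2)) * ((real k + 1) ^ Q / (real k + 1) ^ l * (1 / (real k + 1)\<^sup>2))"
        by (simp add: power_divide power_add power2_eq_square mult_ac)
      also have "\<dots> \<le> (C * fact (l + 1) * 2 ^ (l + 2)) * (1 * (1 / (real k + 1)\<^sup>2))"
      proof (intro mult_left_mono mult_right_mono)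
        have "(real k + 1) ^ Q \<le> (real k + 1) ^ l" using l LC(3) by (intro power_increasing) auto
        then show "(real k + 1) ^ Q / (real k + 1) ^ l \<le> 1" by (simp add: divide_simps)
      qed (use LC(2) in auto)
      finally show "norm (\<integral>x. norm (f k x) \<partial>lborel) \<le> (C * fact (l + 1) * 2 ^ (l + 2)) * (1 / (real k + 1)\<^sup>2)"
        unfolding fint using g by (simp add: abs_of_nonneg divide_nonneg_nonneg pochhammer_nonneg g_def)
    qed
    have ae: "AE x in lborel. summable (\<lambda>k. norm (f k x))"
    proof (rule AE_I2)
      fix x :: real
      show "summable (\<lambda>k. norm (f k x))"
      proof (cases "0 < x \<and> x < 1")
        case True
        have "summable (\<lambda>k. C * ((real k + 1) ^ Q * (1 - x) ^ k) * norm (of_real x ^ (l + 1) * of_real (1 - x) powr g :: complex))"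
          by (intro summable_mult2 summable_mult summable_poly_geometric) (use True in auto)
        then show ?thesis
        proof (rule summable_comparison_test'[of _ 0])
          fix k
          have n: "norm (c k) \<le> C * (real k + 1) ^ Q" unfolding c_def g_def by (rule LC(1)[OF zt])
          have "norm (bfun (g + of_nat k) (l + 1) x) = (1 - x) ^ k * norm (of_real x ^ (l + 1) * of_real (1 - x) powr g :: complex)"
            unfolding bfun_eq[OF gk] using True by (simp add: norm_mult norm_powr_real_powr powr_add powr_realpow norm_power del: of_real_diff)
          then have "norm (f k x) \<le> (C * (real k + 1) ^ Q) * ((1 - x) ^ k * norm (of_real x ^ (l + 1) * of_real (1 - x) powr g :: complex))"
            unfolding fn using n True by (simp only:) (intro mult_right_mono, auto)
          then show "norm (norm (f k x)) \<le> C * ((real k + 1) ^ Q * (1 - x) ^ k) * norm (of_real x ^ (l + 1) * of_real (1 - x) powr g :: complex)"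
            by (simp only: mult.assoc real_norm_def abs_norm_cancel)
        qed
      next
        case False
        then have "f k x = 0" for k unfolding f_def bfun_eq[OF gk] by (simp only: if_False mult_zero_right)
        then show ?thesis by simp
      qed
    qed
    have "(\<integral>x. wfun z z' t l x \<partial>lborel) = (suminf (\<lambda>k. \<integral>x. f k x \<partial>lborel))"
      unfolding sf[symmetric] by (rule integral_suminf[OF fi ae si])
    also have "\<dots> = (suminf (\<lambda>k. fact (l + 1) * (dcoef z z' t (- z) (- z') k * rGamma (t - z - z' + 1 + of_nat (k + (l + 2))))))"
    proof (intro suminf_cong)
      fix k
      have "(\<integral>x. f k x \<partial>lborel) = c k * (fact (l + 1) / pochhammer (g + of_nat k + 1) (l + 2))"
        unfolding f_def integral_mult_right_zero bfun_integral(2)[OF gk] by simp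
      moreover have "rGamma (g + 1 + of_nat k) = pochhammer (g + of_nat k + 1) (l + 2) * rGamma (g + 1 + of_nat (k + (l + 2)))"
        using pochhammer_rGamma[of "g + of_nat k + 1" "l + 2"] by (simp add: add_ac)
      moreover have "pochhammer (g + of_nat k + 1) (l + 2) \<noteq> 0"
      proof
        assume "pochhammer (g + of_nat k + 1) (l + 2) = 0"
        then obtain n where "g + of_nat k + 1 = - of_nat n" unfolding pochhammer_eq_0_iff by blast
        then have "Re (g + of_nat k + 1) = Re (- of_nat n)" by (rule arg_cong)
        with gk[of k] show False by simp
      qed
      ultimately show "(\<integral>x. f k x \<partial>lborel) = fact (l + 1) * (dcoef z z' t (- z) (- z') k * rGamma (t - z - z' + 1 + of_nat (k + (l + 2))))"
        unfolding c_def g_def by simp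
    qed
    also have "\<dots> = fact (l + 1) * Nser z z' t l"
      unfolding Nser_def
      by (rule suminf_mult, rule summable_norm_cancel, rule summable_comparison_test'[OF summable_mult[OF summable_inverse_Suc_sq], of 0 _ "C * (real l + 3) ^ L"])
         (use LC(4)[OF zt l] in simp)
    finally show "integrable lborel (wfun z z' t l) \<and> (\<integral>x. wfun z z' t l x \<partial>lborel) = fact (l + 1) * Nser z z' t l"
      using integrable_suminf[OF fi ae si] unfolding sf by simp
  next
    fix l f g h assume l: "L \<le> l" and fgh: "f holomorphic_on ball 0 R" "g holomorphic_on ball 0 R" "h holomorphic_on ball 0 R"
      and b: "\<And>x. norm x < R \<Longrightarrow> norm (f x) \<le> R \<and> norm (g x) \<le> R \<and> norm (h x) \<le> R"
    show "(\<lambda>x. Nser (f x) (g x) (h x) l) holomorphic_on ball 0 R"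
      unfolding Nser_def
    proof (rule holomorphic_series_ball)
      show "summable (\<lambda>k. C * (real l + 3) ^ L * (1 / (real k + 1)\<^sup>2))"
        by (rule summable_mult[OF summable_inverse_Suc_sq])
      fix k
      show "(\<lambda>x. dcoef (f x) (g x) (h x) (- f x) (- g x) k * rGamma (h x - f x - g x + 1 + of_nat (k + (l + 2)))) holomorphic_on ball 0 R"
        unfolding dcoef_def by (auto intro!: holomorphic_intros fgh)
      fix x :: complex assume "norm x < R"
      then show "norm (dcoef (f x) (g x) (h x) (- f x) (- g x) k * rGamma (h x - f x - g x + 1 + of_nat (k + (l + 2))))
        \<le> C * (real l + 3) ^ L * (1 / (real k + 1)\<^sup>2)"
        using b[of x] by (intro LC(4) l) auto
    qed
  qed
qed

section \<open>Nonnegative integrals at real parameters\<close>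

definition rphi :: "real \<Rightarrow> real \<Rightarrow> real" where
  "rphi a u = (if u > 0 then u powr a / Gamma (a + 1) else 0)"

lemma phi_of_real: "phi (of_real a) u = of_real (rphi a u)"
  using Gamma_complex_of_real[of "a + 1"] by (simp add: phi_def rphi_def powr_of_real)

lemma rphi_nonneg: "a > - 1 \<Longrightarrow> 0 \<le> rphi a u"
  by (simp add: rphi_def Gamma_real_nonneg)

lemma rphi_measurable [measurable]: "rphi a \<in> borel_measurable borel"
  unfolding rphi_def[abs_def] by measurable

lemma rphi_scale: "w > 0 \<Longrightarrow> rphi a (w * u) = w powr a * rphi a u"
  by (simp add: rphi_def powr_mult zero_less_mult_iff)

lemma rphi_nn_convolution:
  assumes a: "a > - 1" and b: "b > - 1"
  shows "(\<integral>\<^sup>+x. ennreal (rphi a x * rphi b (w - x)) \<partial>lborel) = ennreal (rphi (a + b + 1) w)"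
proof -
  have "integrable lborel (\<lambda>x. complex_of_real (rphi a x * rphi b (w - x)))"
    using phi_conv_integrable[of "of_real a" "of_real b" w] a b by (simp add: phi_of_real)
  then have i: "integrable lborel (\<lambda>x. rphi a x * rphi b (w - x))" by (simp only: complex_of_real_integrable_eq)
  have "complex_of_real (\<integral>x. rphi a x * rphi b (w - x) \<partial>lborel) = (\<integral>x. phi (of_real a) x * phi (of_real b) (w - x) \<partial>lborel)"
    unfolding phi_of_real of_real_mult[symmetric] by (rule integral_complex_of_real[symmetric])
  also have "\<dots> = phi (of_real (a + b + 1)) w" using phi_convolution[of "of_real a" "of_real b" w] a b by simp
  also have "\<dots> = of_real (rphi (a + b + 1) w)" by (rule phi_of_real)
  finally have "(\<integral>x. rphi a x * rphi b (w - x) \<partial>lborel) = rphi (a + b + 1) w" by (simp only: of_real_eq_iff)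
  then show ?thesis using i a b by (subst nn_integral_eq_integral) (auto simp: rphi_nonneg)
qed

definition rA :: "real \<Rightarrow> real \<Rightarrow> real \<Rightarrow> real \<Rightarrow> real \<Rightarrow> real" where
  "rA z z' t u v = rphi (- z) u * rphi (- z') v * rphi (t - 2) (1 - u - v)"

definition rPsi :: "real \<Rightarrow> real \<Rightarrow> real \<Rightarrow> real \<Rightarrow> real \<Rightarrow> real \<Rightarrow> real" where
  "rPsi z z' t s u v = (1 - s * u) powr z * (1 - s * v) powr z' * (1 - s * (u + v)) powr (- t)"

text \<open>In the coordinates \<open>U = (1 - x) u\<close>, \<open>V = (1 - x) v\<close> the prefactor \<open>(1 - x) powr (t - z - z')\<close> is absorbed
  by the Jacobian and the homogeneity of the integrand.\<close>

definition Hfun :: "real \<Rightarrow> real \<Rightarrow> real \<Rightarrow> nat \<Rightarrow> real \<Rightarrow> real \<Rightarrow> real \<Rightarrow> real" where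
  "Hfun z z' t l x U V = (if x > 0 then x ^ (l + 1) * (rphi (- z) U * rphi (- z') V * rphi (t - 2) (1 - x - U - V)
      * ((1 - U) powr z * (1 - V) powr z' * (1 - U - V) powr (- t))) else 0)"

lemma Hfun_scale:
  assumes x: "0 < x" "x < 1"
  shows "(1 - x) * ((1 - x) * Hfun z z' t l x ((1 - x) * u) ((1 - x) * v))
    = x ^ (l + 1) * (1 - x) powr (t - z - z') * (rA z z' t u v * rPsi z z' t (1 - x) u v)"
proof -
  define s where "s = 1 - x"
  have s: "s > 0" using x by (simp add: s_def)
  have 1: "s - s * u - s * v = s * (1 - u - v)" by (simp add: algebra_simps)
  have 2: "1 - s * u - s * v = 1 - s * (u + v)" by (simp add: algebra_simps)
  have p: "s powr (t - z - z') = s * s * (s powr (- z) * s powr (- z') * s powr (t - 2))"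
  proof -
    have "s * s = s powr 2" using s by (simp add: powr_numeral power2_eq_square)
    moreover have "t - z - z' = 2 + (- z + - z' + (t - 2))" by simp
    ultimately show ?thesis by (simp only: powr_add)
  qed
  show ?thesis
    unfolding Hfun_def s_def[symmetric] 1 2 rphi_scale[OF s] rA_def rPsi_def p by (simp only: x(1) if_True mult_ac)
qed

text \<open>The integral in x convolves x^(l+1) with the factor of exponent t - 2 and gives a
  multiple of w^(l+t), where w = 1 - U - V. The factor w^(-t) reduces this to w^l, so t survives
  only in the Gamma constant.\<close>

lemma Hfun_inner:
  assumes t: "t > 1" and z: "z < 1" "z' < 1"
  shows "(\<integral>\<^sup>+x. ennreal (Hfun z z' t l x U V) \<partial>lborel) = ennreal (fact (l + 1) / Gamma (t + l + 1)
     * (if 1 - U - V > 0 then rphi (- z) U * (1 - U) powr z * (rphi (- z') V * (1 - V) powr z') * (1 - U - V) ^ l else 0))"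
proof -
  define w where "w = 1 - U - V"
  define K where "K = rphi (- z) U * rphi (- z') V * ((1 - U) powr z * (1 - V) powr z' * w powr (- t))"
  have K: "K \<ge> 0" unfolding K_def using z by (simp add: rphi_nonneg)
  have G: "Gamma (real (l + 1) + 1) = fact (l + 1)" using Gamma_fact[of "l + 1", where 'a = real] by (simp add: add_ac)
  have e: "Hfun z z' t l x U V = fact (l + 1) * K * (rphi (real (l + 1)) x * rphi (t - 2) (w - x))" for x
  proof (cases "x > 0")
    case True
    have "rphi (real (l + 1)) x = x ^ (l + 1) / fact (l + 1)"
      unfolding rphi_def G using True by (simp add: powr_realpow del: fact_Suc power_Suc of_nat_Suc)
    moreover have "1 - x - U - V = w - x" by (simp add: w_def)
    then have "Hfun z z' t l x U V = x ^ (l + 1) * (K * rphi (t - 2) (w - x))"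
      using True unfolding Hfun_def K_def w_def[symmetric] by (simp only: if_True mult_ac)
    moreover have "fact (l + 1) * K * (x ^ (l + 1) / fact (l + 1) * R) = x ^ (l + 1) * (K * R)" for R
      by (simp del: fact_Suc power_Suc)
    ultimately show ?thesis by (simp only:)
  qed (simp add: Hfun_def rphi_def)
  have FK: "fact (l + 1) * K \<ge> 0" using K by simp
  have "(\<integral>\<^sup>+x. ennreal (Hfun z z' t l x U V) \<partial>lborel)
     = ennreal (fact (l + 1) * K) * (\<integral>\<^sup>+x. ennreal (rphi (real (l + 1)) x * rphi (t - 2) (w - x)) \<partial>lborel)"
    unfolding e ennreal_mult'[OF FK] by (rule nn_integral_cmult) measurable
  also have "\<dots> = ennreal (fact (l + 1) * K) * ennreal (rphi (real (l + 1) + (t - 2) + 1) w)"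
    by (subst rphi_nn_convolution) (use t in auto)
  also have "\<dots> = ennreal (fact (l + 1) * K * rphi (real (l + 1) + (t - 2) + 1) w)"
    by (rule ennreal_mult'[OF FK, symmetric])
  also have "fact (l + 1) * K * rphi (real (l + 1) + (t - 2) + 1) w = fact (l + 1) / Gamma (t + l + 1)
     * (if w > 0 then rphi (- z) U * (1 - U) powr z * (rphi (- z') V * (1 - V) powr z') * w ^ l else 0)"
  proof (cases "w > 0")
    case True
    have 1: "w powr (- t) * w powr (real l + t) = w ^ l"
      using True by (simp add: powr_add[symmetric] powr_realpow)
    have 2: "rphi (real (l + 1) + (t - 2) + 1) w = w powr (real l + t) / Gamma (t + l + 1)"
      using True by (simp add: rphi_def algebra_simps)
    have "fact (l + 1) * K * (w powr (real l + t) / Gamma (t + l + 1)) = fact (l + 1) / Gamma (t + l + 1)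
      * (rphi (- z) U * (1 - U) powr z * (rphi (- z') V * (1 - V) powr z') * (w powr (- t) * w powr (real l + t)))"
      unfolding K_def by (simp only: times_divide_eq_right times_divide_eq_left mult_ac)
    then show ?thesis unfolding 1 2 by (simp only: True if_True)
  qed (simp add: rphi_def)
  finally show ?thesis by (simp add: w_def)
qed

lemma Psi_of_real:
  assumes "(u, v) \<in> triangle" "0 < x" "x < 1"
  shows "Psi (of_real z) (of_real z') (of_real t) x (u, v) = of_real (rPsi z z' t (1 - x) u v)"
proof -
  have b: "0 \<le> 1 - (1 - x) * w" if "0 \<le> w" "w \<le> 1" for w
    using mult_mono[of "1 - x" 1 w 1] that assms by simp
  have p: "complex_of_real (1 - (1 - x) * w) powr of_real y = of_real ((1 - (1 - x) * w) powr y)"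
    if "0 \<le> w" "w \<le> 1" for w y
    by (rule powr_of_real[OF b[OF that]])
  show ?thesis
    using p[of u z] p[of v z'] p[of "u + v" "- t"] assms(1)
    unfolding Psi_def rPsi_def prod.case of_real_mult of_real_minus by (auto simp: triangle_def)
qed

lemma Adens_of_real: "Adens (- of_real z) (- of_real z') (of_real t - 2) (u, v) = of_real (rA z z' t u v)"
  using phi_of_real[of "- z" u] phi_of_real[of "- z'" v] phi_of_real[of "t - 2" "1 - u - v"]
  by (simp add: Adens_def rA_def)

text \<open>For z, z' < 1 < t the exponents -z, -z' and t - 2 all exceed -1, so the continued
  pairing is still an integral, and its integrand is nonnegative.\<close>

lemma Kser_nn:
  assumes t: "t > 1" and z: "z < 1" "z' < 1" and x: "0 < x" "x < 1"
  obtains r where "r \<ge> 0" "Kser (of_real z) (of_real z') (of_real t) (of_real (1 - x)) = of_real r"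
    "ennreal r = (\<integral>\<^sup>+u. \<integral>\<^sup>+v. ennreal (rA z z' t u v * rPsi z z' t (1 - x) u v) \<partial>lborel \<partial>lborel)"
proof -
  define a b c where "a = - complex_of_real z" and "b = - complex_of_real z'" and "c = complex_of_real t - 2"
  have abc: "Re a > - 1" "Re b > - 1" "Re c > - 1" using t z by (auto simp: a_def b_def c_def)
  define F where "F = (\<lambda>(u, v). rA z z' t u v * rPsi z z' t (1 - x) u v)"
  have Fm: "F \<in> borel_measurable (lborel \<Otimes>\<^sub>M lborel)" unfolding F_def rA_def rPsi_def by measurable
  have F0: "F uv \<ge> 0" for uv
    using t z unfolding F_def rA_def rPsi_def by (auto intro!: mult_nonneg_nonneg rphi_nonneg split: prod.split)
  have e: "Adens a b c uv * Psi (of_real z) (of_real z') (of_real t) x uv = of_real (F uv)" for uv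
  proof (cases "uv \<in> triangle")
    case True
    then show ?thesis using Adens_of_real[of z z' t] Psi_of_real[OF _ x]
      by (cases uv) (simp add: F_def a_def b_def c_def)
  next
    case False
    have "complex_of_real (rA z z' t (fst uv) (snd uv)) = 0"
      using Adens_eq_0[OF False, of a b c] Adens_of_real[of z z' t "fst uv" "snd uv"] by (simp add: a_def b_def c_def)
    then show ?thesis using Adens_eq_0[OF False] by (simp add: F_def split_beta)
  qed
  have "integrable lborel (\<lambda>uv. complex_of_real (F uv))"
    using pairing_int_series(1)[OF abc x, of "of_real z" "of_real z'" "of_real t"] unfolding e .
  then have Fi: "integrable lborel F" by (simp only: complex_of_real_integrable_eq)
  have K: "Kser (of_real z) (of_real z') (of_real t) (of_real (1 - x)) = of_real (\<integral>uv. F uv \<partial>lborel)"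
    using pairing_int_series(2)[OF abc x, of "of_real z" "of_real z'" "of_real t"]
    unfolding Kser_def pairing_int_eq e integral_complex_of_real by (simp add: a_def b_def c_def)
  have "ennreal (\<integral>uv. F uv \<partial>lborel) = (\<integral>\<^sup>+uv. ennreal (F uv) \<partial>(lborel \<Otimes>\<^sub>M lborel))"
    unfolding lborel_prod by (rule nn_integral_eq_integral[symmetric]) (use Fi F0 in auto)
  also have "\<dots> = (\<integral>\<^sup>+u. \<integral>\<^sup>+v. ennreal (F (u, v)) \<partial>lborel \<partial>lborel)"
    by (rule lborel.nn_integral_fst[symmetric]) (use Fm in measurable)
  finally have "ennreal (\<integral>uv. F uv \<partial>lborel) = (\<integral>\<^sup>+u. \<integral>\<^sup>+v. ennreal (F (u, v)) \<partial>lborel \<partial>lborel)" .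
  then show ?thesis using F0 K
    by (intro that[of "\<integral>uv. F uv \<partial>lborel"]) (auto simp: F_def intro!: Bochner_Integration.integral_nonneg)
qed

lemma Hfun_measurable [measurable]:
  "(\<lambda>(x, U, V). Hfun z z' t l x U V) \<in> borel_measurable (borel \<Otimes>\<^sub>M borel \<Otimes>\<^sub>M borel)"
  unfolding Hfun_def by measurable

text \<open>Substituting U = (1-x) u and V = (1-x) v puts x only into a power and into the third
  factor of the density, which prepares the integration over x. Working with nonnegative integrals
  avoids separate integrability conditions.\<close>

lemma wfun_nn:
  assumes t: "t > 1" and z: "z < 1" "z' < 1"
  obtains r where "r \<ge> 0" "wfun (of_real z) (of_real z') (of_real t) l x = of_real r"
    "ennreal r = (\<integral>\<^sup>+U. \<integral>\<^sup>+V. ennreal (Hfun z z' t l x U V) \<partial>lborel \<partial>lborel)"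
proof (cases "0 < x \<and> x < 1")
  case True
  then have x: "0 < x" "x < 1" by auto
  define s where "s = 1 - x"
  have s: "s > 0" using x by (simp add: s_def)
  obtain r where r: "r \<ge> 0" "Kser (of_real z) (of_real z') (of_real t) (of_real (1 - x)) = of_real r"
    "ennreal r = (\<integral>\<^sup>+u. \<integral>\<^sup>+v. ennreal (rA z z' t u v * rPsi z z' t (1 - x) u v) \<partial>lborel \<partial>lborel)"
    using Kser_nn[OF t z x] by blast
  define C where "C = x ^ (l + 1) * (1 - x) powr (t - z - z')"
  have C: "C \<ge> 0" using x by (simp add: C_def)
  have m: "(\<lambda>V. Hfun z z' t l x U V) \<in> borel_measurable borel" for U unfolding Hfun_def by measurable
  have m2: "(\<lambda>U. \<integral>\<^sup>+V. ennreal (Hfun z z' t l x U V) \<partial>lborel) \<in> borel_measurable borel"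
    unfolding Hfun_def by measurable
  have "(\<integral>\<^sup>+U. \<integral>\<^sup>+V. ennreal (Hfun z z' t l x U V) \<partial>lborel \<partial>lborel)
     = ennreal s * (\<integral>\<^sup>+u. \<integral>\<^sup>+V. ennreal (Hfun z z' t l x (0 + s * u) V) \<partial>lborel \<partial>lborel)"
    using nn_integral_real_affine[OF m2, of s 0] s by simp
  also have "\<dots> = ennreal s * (\<integral>\<^sup>+u. ennreal s * (\<integral>\<^sup>+v. ennreal (Hfun z z' t l x (0 + s * u) (0 + s * v)) \<partial>lborel) \<partial>lborel)"
    using nn_integral_real_affine[of "\<lambda>V. ennreal (Hfun z z' t l x _ V)" s 0] m s by simp
  also have "\<dots> = (\<integral>\<^sup>+u. \<integral>\<^sup>+v. ennreal s * (ennreal s * ennreal (Hfun z z' t l x (s * u) (s * v))) \<partial>lborel \<partial>lborel)"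
  proof -
    have a: "(\<lambda>v. ennreal (Hfun z z' t l x (s * u) (s * v))) \<in> borel_measurable lborel" for u unfolding Hfun_def by measurable
    have b: "(\<lambda>u. \<integral>\<^sup>+v. ennreal s * ennreal (Hfun z z' t l x (s * u) (s * v)) \<partial>lborel) \<in> borel_measurable lborel" unfolding Hfun_def by measurable
    show ?thesis by (simp add: nn_integral_cmult[OF a, symmetric] nn_integral_cmult[OF b, symmetric] nn_integral_cmult[symmetric] a)
  qed
  also have "\<dots> = (\<integral>\<^sup>+u. \<integral>\<^sup>+v. ennreal C * ennreal (rA z z' t u v * rPsi z z' t (1 - x) u v) \<partial>lborel \<partial>lborel)"
    using s C by (simp add: ennreal_mult'[symmetric] Hfun_scale[OF x, of z z' t l, folded s_def C_def, unfolded C_def[symmetric]] s_def[symmetric] C_def[symmetric])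
  also have "\<dots> = ennreal C * ennreal r"
  proof -
    have a: "(\<lambda>v. ennreal (rA z z' t u v * rPsi z z' t (1 - x) u v)) \<in> borel_measurable lborel" for u unfolding rA_def rPsi_def by measurable
    have b: "(\<lambda>u. \<integral>\<^sup>+v. ennreal (rA z z' t u v * rPsi z z' t (1 - x) u v) \<partial>lborel) \<in> borel_measurable lborel" unfolding rA_def rPsi_def by measurable
    show ?thesis unfolding r(3) by (simp add: nn_integral_cmult[OF a] nn_integral_cmult[OF b])
  qed
  also have "\<dots> = ennreal (C * r)" using C by (simp add: ennreal_mult')
  finally have 1: "(\<integral>\<^sup>+U. \<integral>\<^sup>+V. ennreal (Hfun z z' t l x U V) \<partial>lborel \<partial>lborel) = ennreal (C * r)" .
  have "of_real (1 - x) powr (of_real t - of_real z - of_real z') = complex_of_real ((1 - x) powr (t - z - z'))"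
    using x by (simp add: powr_of_real flip: of_real_diff)
  then have "wfun (of_real z) (of_real z') (of_real t) l x = of_real (C * r)"
    using x unfolding wfun_def r(2) C_def by (simp del: of_real_diff)
  then show ?thesis using C r 1 by (intro that[of "C * r"]) auto
next
  case False
  \<comment> \<open>For \<open>x \<ge> 1\<close> the conditions U > 0, V > 0 and x + U + V < 1
    contradict each other, so the range of x needs no explicit cutoff at 1.\<close>
  have "Hfun z z' t l x U V = 0" for U V
  proof (cases "x > 0")
    case True
    then have "x \<ge> 1" using False by simp
    then have "\<not> (U > 0 \<and> V > 0 \<and> 1 - x - U - V > 0)" by auto
    then show ?thesis by (auto simp: Hfun_def rphi_def)
  qed (simp add: Hfun_def)
  then show ?thesis using False by (intro that[of 0]) (auto simp: wfun_def)
qed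

text \<open>On (0, 1) this is U^(-z) (1-U)^z divided by Gamma(1-z) Gamma(1+z). Replacing U by 1 - U
  exchanges z and -z, which is the link between the two branches of the density.\<close>

definition rkap :: "real \<Rightarrow> real \<Rightarrow> real" where
  "rkap z U = rphi (- z) U * rphi z (1 - U)"

definition jfun :: "real \<Rightarrow> real \<Rightarrow> nat \<Rightarrow> real \<Rightarrow> real \<Rightarrow> real" where
  "jfun z z' l U V = rkap z U * rkap z' V * (if 1 - U - V > 0 then (1 - U - V) ^ l else 0)"

lemma rkap_measurable [measurable]: "rkap z \<in> borel_measurable borel"
  unfolding rkap_def[abs_def] by measurable

lemma jfun_measurable [measurable]: "(\<lambda>(U, V). jfun z z' l U V) \<in> borel_measurable (borel \<Otimes>\<^sub>M borel)"
  unfolding jfun_def by measurable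

lemma rkap_nonneg: "\<bar>z\<bar> < 1 \<Longrightarrow> 0 \<le> rkap z U"
  unfolding rkap_def by (auto intro!: mult_nonneg_nonneg rphi_nonneg)

lemma rkap_reflect: "rkap (- z) (1 - U) = rkap z U" by (simp add: rkap_def)

lemma jfun_nonneg: "\<bar>z\<bar> < 1 \<Longrightarrow> \<bar>z'\<bar> < 1 \<Longrightarrow> 0 \<le> jfun z z' l U V"
  unfolding jfun_def by (auto intro!: mult_nonneg_nonneg rkap_nonneg)

lemma inner_eq_jfun:
  assumes z: "\<bar>z\<bar> < 1" "\<bar>z'\<bar> < 1"
  shows "(if 1 - U - V > 0 then rphi (- z) U * (1 - U) powr z * (rphi (- z') V * (1 - V) powr z') * (1 - U - V) ^ l else 0)
    = Gamma (1 + z) * Gamma (1 + z') * jfun z z' l U V"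
proof (cases "U > 0 \<and> V > 0 \<and> 1 - U - V > 0")
  case True
  have "Gamma (1 + z) > 0" "Gamma (1 + z') > 0" by (rule Gamma_real_pos, use z in linarith)+
  then have G: "Gamma (1 + z) \<noteq> 0" "Gamma (1 + z') \<noteq> 0" by simp_all
  have "rphi z (1 - U) = (1 - U) powr z / Gamma (1 + z)" "rphi z' (1 - V) = (1 - V) powr z' / Gamma (1 + z')"
    using True by (auto simp: rphi_def add.commute)
  then show ?thesis using True G by (simp add: jfun_def rkap_def)
qed (auto simp: jfun_def rkap_def rphi_def)

text \<open>The same moment is computed twice: termwise, as the hypotheses provide, and by Tonelli
  with the integration over x done first. Reciprocal Gamma factors are put on the left so that both
  sides extend to all parameters.\<close>

lemma base_moment:
  assumes z: "\<bar>z\<bar> < 1" "\<bar>z'\<bar> < 1" and t: "t > 1"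
    and w: "integrable lborel (wfun (of_real z) (of_real z') (of_real t) l)"
      "(\<integral>x. wfun (of_real z) (of_real z') (of_real t) l x \<partial>lborel) = fact (l + 1) * Nser (of_real z) (of_real z') (of_real t) l"
  shows "integrable (lborel \<Otimes>\<^sub>M lborel) (\<lambda>(U, V). jfun z z' l U V)"
    and "rGamma (1 + of_real z) * rGamma (1 + of_real z') * Nser (of_real z) (of_real z') (of_real t) l
      = rGamma (of_real t + of_nat l + 1) * of_real (\<integral>(U, V). jfun z z' l U V \<partial>(lborel \<Otimes>\<^sub>M lborel))"
proof -
  define W where "W x = Re (wfun (of_real z) (of_real z') (of_real t) l x)" for x
  have z1: "z < 1" "z' < 1" using z by auto
  have W: "W x \<ge> 0" "wfun (of_real z) (of_real z') (of_real t) l x = of_real (W x)"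
    "ennreal (W x) = (\<integral>\<^sup>+U. \<integral>\<^sup>+V. ennreal (Hfun z z' t l x U V) \<partial>lborel \<partial>lborel)" for x
    using wfun_nn[OF t z1, of l x] unfolding W_def by (metis Re_complex_of_real)+
  have Wi: "integrable lborel W" using w(1) unfolding W(2) by (simp only: complex_of_real_integrable_eq)
  define c where "c = fact (l + 1) / Gamma (t + l + 1) * (Gamma (1 + z) * Gamma (1 + z'))"
  have G: "Gamma (1 + z) > 0" "Gamma (1 + z') > 0" "Gamma (t + l + 1) > 0"
    using z t by (auto intro!: Gamma_real_pos)
  have c: "c > 0" unfolding c_def using G by (intro mult_pos_pos divide_pos_pos) auto
  have m1: "(\<lambda>(x, U). \<integral>\<^sup>+V. ennreal (Hfun z z' t l x U V) \<partial>lborel) \<in> borel_measurable (lborel \<Otimes>\<^sub>M lborel)"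
    unfolding Hfun_def by measurable
  have m2: "(\<lambda>(x, V). ennreal (Hfun z z' t l x U V)) \<in> borel_measurable (lborel \<Otimes>\<^sub>M lborel)" for U
    unfolding Hfun_def by measurable
  have "ennreal (\<integral>x. W x \<partial>lborel) = (\<integral>\<^sup>+x. ennreal (W x) \<partial>lborel)"
    by (rule nn_integral_eq_integral[symmetric]) (use Wi W in auto)
  also have "\<dots> = (\<integral>\<^sup>+x. \<integral>\<^sup>+U. \<integral>\<^sup>+V. ennreal (Hfun z z' t l x U V) \<partial>lborel \<partial>lborel \<partial>lborel)"
    unfolding W(3) ..
  also have "\<dots> = (\<integral>\<^sup>+U. \<integral>\<^sup>+x. \<integral>\<^sup>+V. ennreal (Hfun z z' t l x U V) \<partial>lborel \<partial>lborel \<partial>lborel)"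
    by (rule lborel_pair.Fubini'[OF m1, symmetric])
  also have "\<dots> = (\<integral>\<^sup>+U. \<integral>\<^sup>+V. \<integral>\<^sup>+x. ennreal (Hfun z z' t l x U V) \<partial>lborel \<partial>lborel \<partial>lborel)"
    by (intro nn_integral_cong lborel_pair.Fubini'[OF m2, symmetric])
  also have "\<dots> = (\<integral>\<^sup>+U. \<integral>\<^sup>+V. ennreal (c * jfun z z' l U V) \<partial>lborel \<partial>lborel)"
    unfolding Hfun_inner[OF t z1] inner_eq_jfun[OF z] c_def by (simp only: mult.assoc)
  also have "\<dots> = (\<integral>\<^sup>+p. ennreal (c * (case p of (U, V) \<Rightarrow> jfun z z' l U V)) \<partial>(lborel \<Otimes>\<^sub>M lborel))"
    using lborel.nn_integral_fst[of "\<lambda>p. ennreal (c * (case p of (U, V) \<Rightarrow> jfun z z' l U V))" lborel] by simp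
  finally have nn: "(\<integral>\<^sup>+p. ennreal (c * (case p of (U, V) \<Rightarrow> jfun z z' l U V)) \<partial>(lborel \<Otimes>\<^sub>M lborel)) = ennreal (\<integral>x. W x \<partial>lborel)" ..
  have jn: "0 \<le> c * (case p of (U, V) \<Rightarrow> jfun z z' l U V)" for p
    using c jfun_nonneg[OF z] by (auto split: prod.split)
  have "integrable (lborel \<Otimes>\<^sub>M lborel) (\<lambda>p. c * (case p of (U, V) \<Rightarrow> jfun z z' l U V))"
    by (rule integrableI_nonneg) (use nn jn in auto)
  note ci = this
  then show ji: "integrable (lborel \<Otimes>\<^sub>M lborel) (\<lambda>(U, V). jfun z z' l U V)" using c by simp
  have "ennreal (\<integral>p. c * (case p of (U, V) \<Rightarrow> jfun z z' l U V) \<partial>(lborel \<Otimes>\<^sub>M lborel)) = ennreal (\<integral>x. W x \<partial>lborel)"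
    using nn_integral_eq_integral[OF ci] jn nn by auto
  then have WJ: "(\<integral>x. W x \<partial>lborel) = c * (\<integral>(U, V). jfun z z' l U V \<partial>(lborel \<Otimes>\<^sub>M lborel))"
  proof -
    have p: "0 \<le> (\<integral>x. W x \<partial>lborel)" "0 \<le> (\<integral>p. c * (case p of (U, V) \<Rightarrow> jfun z z' l U V) \<partial>(lborel \<Otimes>\<^sub>M lborel))"
      by (rule Bochner_Integration.integral_nonneg, rule W jn)+
    show ?thesis using \<open>ennreal _ = ennreal _\<close>
      unfolding ennreal_inj[OF p(2,1)] by simp
  qed
  have "fact (l + 1) * Nser (of_real z) (of_real z') (of_real t) l = of_real (\<integral>x. W x \<partial>lborel)"
    unfolding w(2)[symmetric] W(2) by (rule integral_complex_of_real)
  also have "\<dots> = fact (l + 1) * (of_real (1 / Gamma (t + l + 1)) * of_real (Gamma (1 + z)) * of_real (Gamma (1 + z'))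
      * of_real (\<integral>(U, V). jfun z z' l U V \<partial>(lborel \<Otimes>\<^sub>M lborel)))"
    unfolding WJ c_def by (simp del: fact_Suc)
  finally have N: "Nser (of_real z) (of_real z') (of_real t) l = of_real (1 / Gamma (t + l + 1)) * of_real (Gamma (1 + z)) * of_real (Gamma (1 + z'))
      * of_real (\<integral>(U, V). jfun z z' l U V \<partial>(lborel \<Otimes>\<^sub>M lborel))" by (rule mult_left_cancel[THEN iffD1, OF fact_nonzero])
  have r: "rGamma (1 + of_real y) * of_real (Gamma (1 + y)) = (1 :: complex)" if "Gamma (1 + y) > 0" for y :: real
  proof -
    have "rGamma (1 + complex_of_real y) = of_real (rGamma (1 + y))" using rGamma_complex_of_real[of "1 + y"] by simp
    then show ?thesis using that by (simp add: rGamma_inverse_Gamma flip: of_real_mult)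
  qed
  have r3: "of_real (1 / Gamma (t + l + 1)) = rGamma (complex_of_real t + of_nat l + 1)"
    using rGamma_complex_of_real[of "t + l + 1"] by (simp add: rGamma_inverse_Gamma inverse_eq_divide)
  have "rGamma (1 + of_real z) * rGamma (1 + of_real z') * Nser (of_real z) (of_real z') (of_real t) l
    = (rGamma (1 + of_real z) * of_real (Gamma (1 + z))) * (rGamma (1 + of_real z') * of_real (Gamma (1 + z')))
      * (rGamma (of_real t + of_nat l + 1) * of_real (\<integral>(U, V). jfun z z' l U V \<partial>(lborel \<Otimes>\<^sub>M lborel)))"
    unfolding N r3 by (simp only: mult_ac)
  then show "rGamma (1 + of_real z) * rGamma (1 + of_real z') * Nser (of_real z) (of_real z') (of_real t) l
      = rGamma (of_real t + of_nat l + 1) * of_real (\<integral>(U, V). jfun z z' l U V \<partial>(lborel \<Otimes>\<^sub>M lborel))"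
    unfolding r[OF G(1)] r[OF G(2)] by simp
qed

text \<open>\<open>jfun\<close> lives on the half U + V < 1 of the unit square; the reflection of
  both coordinates carries it to the half U + V > 1.\<close>

lemma jfun_reflect:
  assumes z: "\<bar>z\<bar> < 1" "\<bar>z'\<bar> < 1" and i: "integrable (lborel \<Otimes>\<^sub>M lborel) (\<lambda>(U, V). jfun z z' l U V)"
  shows "integrable (lborel \<Otimes>\<^sub>M lborel) (\<lambda>(U, V). jfun z z' l (1 - U) (1 - V))"
    and "(\<integral>(U, V). jfun z z' l (1 - U) (1 - V) \<partial>(lborel \<Otimes>\<^sub>M lborel)) = (\<integral>(U, V). jfun z z' l U V \<partial>(lborel \<Otimes>\<^sub>M lborel))"
proof -
  have m: "(\<lambda>(U, V). jfun z z' l (1 - U) (1 - V)) \<in> borel_measurable (lborel \<Otimes>\<^sub>M lborel)"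
    unfolding jfun_def by measurable
  have mv: "(\<lambda>V. ennreal (jfun z z' l U V)) \<in> borel_measurable borel" for U unfolding jfun_def by measurable
  have mu: "(\<lambda>U. \<integral>\<^sup>+V. ennreal (jfun z z' l U V) \<partial>lborel) \<in> borel_measurable borel" unfolding jfun_def by measurable
  have "(\<integral>\<^sup>+p. ennreal (case p of (U, V) \<Rightarrow> jfun z z' l (1 - U) (1 - V)) \<partial>(lborel \<Otimes>\<^sub>M lborel))
    = (\<integral>\<^sup>+U. \<integral>\<^sup>+V. ennreal (jfun z z' l (1 - U) (1 - V)) \<partial>lborel \<partial>lborel)"
    using lborel.nn_integral_fst[of "\<lambda>p. ennreal (case p of (U, V) \<Rightarrow> jfun z z' l (1 - U) (1 - V))" lborel] m by simp
  also have "\<dots> = (\<integral>\<^sup>+U. \<integral>\<^sup>+V. ennreal (jfun z z' l (1 - U) V) \<partial>lborel \<partial>lborel)"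
    using nn_integral_real_affine[OF mv, of "-1" _ 1] by simp
  also have "\<dots> = (\<integral>\<^sup>+U. \<integral>\<^sup>+V. ennreal (jfun z z' l U V) \<partial>lborel \<partial>lborel)"
    using nn_integral_real_affine[OF mu, of "-1" 1] by simp
  also have "\<dots> = (\<integral>\<^sup>+p. ennreal (case p of (U, V) \<Rightarrow> jfun z z' l U V) \<partial>(lborel \<Otimes>\<^sub>M lborel))"
    using lborel.nn_integral_fst[of "\<lambda>p. ennreal (case p of (U, V) \<Rightarrow> jfun z z' l U V)" lborel] by simp
  also have "\<dots> = ennreal (\<integral>(U, V). jfun z z' l U V \<partial>(lborel \<Otimes>\<^sub>M lborel))"
    by (rule nn_integral_eq_integral[OF i]) (auto simp: jfun_nonneg[OF z])
  finally have nn: "(\<integral>\<^sup>+p. ennreal (case p of (U, V) \<Rightarrow> jfun z z' l (1 - U) (1 - V)) \<partial>(lborel \<Otimes>\<^sub>M lborel))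
     = ennreal (\<integral>(U, V). jfun z z' l U V \<partial>(lborel \<Otimes>\<^sub>M lborel))" .
  show i': "integrable (lborel \<Otimes>\<^sub>M lborel) (\<lambda>(U, V). jfun z z' l (1 - U) (1 - V))"
    by (rule integrableI_nonneg) (use nn m jfun_nonneg[OF z] in auto)
  have "ennreal (\<integral>(U, V). jfun z z' l (1 - U) (1 - V) \<partial>(lborel \<Otimes>\<^sub>M lborel)) = ennreal (\<integral>(U, V). jfun z z' l U V \<partial>(lborel \<Otimes>\<^sub>M lborel))"
    unfolding nn[symmetric]
    by (rule nn_integral_eq_integral[OF i', symmetric]) (auto simp: jfun_nonneg[OF z])
  moreover have "0 \<le> (\<integral>(U, V). jfun z z' l (1 - U) (1 - V) \<partial>(lborel \<Otimes>\<^sub>M lborel))"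
    "0 \<le> (\<integral>(U, V). jfun z z' l U V \<partial>(lborel \<Otimes>\<^sub>M lborel))"
    by (rule Bochner_Integration.integral_nonneg, simp add: jfun_nonneg[OF z] split: prod.split)+
  ultimately show "(\<integral>(U, V). jfun z z' l (1 - U) (1 - V) \<partial>(lborel \<Otimes>\<^sub>M lborel)) = (\<integral>(U, V). jfun z z' l U V \<partial>(lborel \<Otimes>\<^sub>M lborel))"
    by simp
qed

lemma integrable_lborel_product:
  fixes f g :: "real \<Rightarrow> complex"
  assumes f: "integrable lborel f" and g: "integrable lborel g"
  shows "integrable (lborel \<Otimes>\<^sub>M lborel) (\<lambda>(x, y). f x * g y)"
    and "(\<integral>(x, y). f x * g y \<partial>(lborel \<Otimes>\<^sub>M lborel)) = (\<integral>x. f x \<partial>lborel) * (\<integral>y. g y \<partial>lborel)"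
proof -
  note [measurable] = borel_measurable_integrable[OF f] borel_measurable_integrable[OF g]
  show i: "integrable (lborel \<Otimes>\<^sub>M lborel) (\<lambda>(x, y). f x * g y)"
  proof (rule lborel_pair.Fubini_integrable)
    show "integrable lborel (\<lambda>x. \<integral>y. norm (case (x, y) of (x, y) \<Rightarrow> f x * g y) \<partial>lborel)"
      unfolding case_prod_conv norm_mult integral_mult_right_zero by (intro integrable_mult_left integrable_norm f)
  qed (use g in auto)
  show "(\<integral>(x, y). f x * g y \<partial>(lborel \<Otimes>\<^sub>M lborel)) = (\<integral>x. f x \<partial>lborel) * (\<integral>y. g y \<partial>lborel)"
    using lborel_pair.integral_fst'[OF i] by simp
qed

lemma rkap_monomial:
  assumes z: "\<bar>z\<bar> < 1"
  shows "integrable lborel (\<lambda>U. complex_of_real (rkap z U * ((1 - U) ^ p * U ^ q)))"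
    and "(\<integral>U. complex_of_real (rkap z U * ((1 - U) ^ p * U ^ q)) \<partial>lborel)
      = pochhammer (1 - of_real z) q * pochhammer (1 + of_real z) p / fact (p + q + 1)"
proof -
  have zz: "Re (- of_real z) > - 1" "Re (of_real z) > - 1" "Re (- of_real z + of_nat q) > - 1" "Re (of_real z + of_nat p) > - 1" using z by auto
  have e: "complex_of_real (rkap z U * ((1 - U) ^ p * U ^ q)) = pochhammer (1 - of_real z) q * pochhammer (1 + of_real z) p
    * (phi (- of_real z + of_nat q) U * phi (of_real z + of_nat p) (1 - U))" for U
  proof -
    have "complex_of_real (rkap z U * ((1 - U) ^ p * U ^ q)) = (phi (- of_real z) U * of_real U ^ q) * (phi (of_real z) (1 - U) * of_real (1 - U) ^ p)"
      using phi_of_real[of "- z" U] phi_of_real[of z "1 - U"] by (simp add: rkap_def)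
    then show ?thesis unfolding phi_shift[OF zz(1)] phi_shift[OF zz(2)] by (simp add: add.commute)
  qed
  show "integrable lborel (\<lambda>U. complex_of_real (rkap z U * ((1 - U) ^ p * U ^ q)))"
    unfolding e by (intro integrable_mult_right phi_conv_integrable zz)
  have "(- of_real z + of_nat q) + (of_real z + of_nat p) + 1 = (of_nat (p + q + 1) :: complex)" by simp
  note n = this
  have ph: "phi (of_nat m) 1 = 1 / fact m" for m
    using Gamma_fact[of m, where 'a = complex] by (simp add: phi_def add_ac)
  show "(\<integral>U. complex_of_real (rkap z U * ((1 - U) ^ p * U ^ q)) \<partial>lborel)
      = pochhammer (1 - of_real z) q * pochhammer (1 + of_real z) p / fact (p + q + 1)"
    unfolding e integral_mult_right_zero phi_convolution[OF zz(3,4)] n ph by (simp only: mult.right_neutral times_divide_eq_right)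
qed

definition Ssum :: "complex \<Rightarrow> complex \<Rightarrow> nat \<Rightarrow> complex" where
  "Ssum z z' l = (\<Sum>p\<le>l. of_nat (l choose p) * (- 1) ^ (l - p) *
     ((pochhammer (1 - z) (l - p) * pochhammer (1 + z) p / fact (l + 1)) * (pochhammer (1 - z') (l - p) * pochhammer (1 + z') p / fact (l + 1))))"

text \<open>Writing 1 - U - V as (1-U)(1-V) - UV and expanding the power separates the variables, so
  that each term is a product of two Beta integrals.\<close>

lemma square_integral:
  assumes z: "\<bar>z\<bar> < 1" "\<bar>z'\<bar> < 1"
  shows "(\<integral>(U, V). complex_of_real (rkap z U * rkap z' V * (1 - U - V) ^ l) \<partial>(lborel \<Otimes>\<^sub>M lborel)) = Ssum (of_real z) (of_real z') l"
proof -
  define f g where "f p = (\<lambda>U. complex_of_real (rkap z U * ((1 - U) ^ p * U ^ (l - p))))"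
    and "g p = (\<lambda>V. complex_of_real (rkap z' V * ((1 - V) ^ p * V ^ (l - p))))" for p
  have e: "complex_of_real (rkap z U * rkap z' V * (1 - U - V) ^ l) = (\<Sum>p\<le>l. of_nat (l choose p) * (- 1) ^ (l - p) * (f p U * g p V))" for U V
  proof -
    have "1 - U - V = (1 - U) * (1 - V) + - (U * V)" by (simp add: algebra_simps)
    then have "(1 - U - V) ^ l = ((1 - U) * (1 - V) + - (U * V)) ^ l" by (rule arg_cong)
    also have "\<dots> = (\<Sum>p\<le>l. real (l choose p) * ((1 - U) * (1 - V)) ^ p * (- (U * V)) ^ (l - p))"
      by (rule binomial_ring)
    finally have "rkap z U * rkap z' V * (1 - U - V) ^ l
      = (\<Sum>p\<le>l. real (l choose p) * (- 1) ^ (l - p) * ((rkap z U * ((1 - U) ^ p * U ^ (l - p))) * (rkap z' V * ((1 - V) ^ p * V ^ (l - p)))))"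
      by (simp only: sum_distrib_left power_minus[of "U * V"] power_mult_distrib mult_ac)
    then show ?thesis unfolding f_def g_def by simp
  qed
  have i: "integrable lborel (f p)" "integrable lborel (g p)" for p
    unfolding f_def g_def by (rule rkap_monomial(1)[OF z(1)], rule rkap_monomial(1)[OF z(2)])
  have v: "(\<integral>U. f p U \<partial>lborel) = pochhammer (1 - of_real z) (l - p) * pochhammer (1 + of_real z) p / fact (l + 1)"
    "(\<integral>V. g p V \<partial>lborel) = pochhammer (1 - of_real z') (l - p) * pochhammer (1 + of_real z') p / fact (l + 1)" if "p \<le> l" for p
    unfolding f_def g_def rkap_monomial(2)[OF z(1)] rkap_monomial(2)[OF z(2)] using that by simp_all
  have "(\<integral>(U, V). complex_of_real (rkap z U * rkap z' V * (1 - U - V) ^ l) \<partial>(lborel \<Otimes>\<^sub>M lborel))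
    = (\<integral>x. (\<Sum>p\<le>l. of_nat (l choose p) * (- 1) ^ (l - p) * (case x of (U, V) \<Rightarrow> f p U * g p V)) \<partial>(lborel \<Otimes>\<^sub>M lborel))"
    unfolding e by (intro Bochner_Integration.integral_cong refl) (auto split: prod.split)
  also have "\<dots> = (\<Sum>p\<le>l. of_nat (l choose p) * (- 1) ^ (l - p) * ((\<integral>U. f p U \<partial>lborel) * (\<integral>V. g p V \<partial>lborel)))"
    by (subst Bochner_Integration.integral_sum, intro integrable_mult_right integrable_lborel_product i)
       (simp only: integral_mult_right_zero integrable_lborel_product(2)[OF i])
  also have "\<dots> = Ssum (of_real z) (of_real z') l" unfolding Ssum_def by (intro sum.cong refl) (simp only: v atMost_iff)
  finally show ?thesis .
qed

text \<open>The branch with parameters -z, -z' is reflected onto the complementary triangle. There 1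
  - U - V is negative, which accounts for the sign (-1)^l, and the two halves combine to the full
  power over the square.\<close>

lemma base_identity:
  assumes z: "\<bar>z\<bar> < 1" "\<bar>z'\<bar> < 1" and t: "t > 1" and l: "l \<ge> 1"
    and w: "integrable lborel (wfun (of_real z) (of_real z') (of_real t) l)"
      "(\<integral>x. wfun (of_real z) (of_real z') (of_real t) l x \<partial>lborel) = fact (l + 1) * Nser (of_real z) (of_real z') (of_real t) l"
    and w': "integrable lborel (wfun (- of_real z) (- of_real z') (of_real t) l)"
      "(\<integral>x. wfun (- of_real z) (- of_real z') (of_real t) l x \<partial>lborel) = fact (l + 1) * Nser (- of_real z) (- of_real z') (of_real t) l"
  shows "rGamma (1 + of_real z) * rGamma (1 + of_real z') * Nser (of_real z) (of_real z') (of_real t) l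
    + (- 1) ^ l * (rGamma (1 - of_real z) * rGamma (1 - of_real z') * Nser (- of_real z) (- of_real z') (of_real t) l)
    = rGamma (of_real t + of_nat l + 1) * Ssum (of_real z) (of_real z') l"
proof -
  note b = base_moment[OF z t w]
  have z': "\<bar>- z\<bar> < 1" "\<bar>- z'\<bar> < 1" using z by auto
  note b' = base_moment[OF z' t, of l, unfolded of_real_minus, OF w']
  note r = jfun_reflect[OF z' b'(1)]
  have e: "jfun z z' l U V + (- 1) ^ l * jfun (- z) (- z') l (1 - U) (1 - V) = rkap z U * rkap z' V * (1 - U - V) ^ l" for U V
  proof -
    have w: "1 - (1 - U) - (1 - V) = - (1 - U - V)" by simp
    have p: "(- 1) ^ l * (- w) ^ l = w ^ l" for w :: real by (simp flip: power_mult_distrib)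
    \<comment> \<open>On the diagonal w = 0 neither half contributes, so the identity needs w^l = 0
      there; this is where \<open>l \<ge> 1\<close> enters.\<close>
    have c: "A * (if w > 0 then w ^ l else 0) + (- 1) ^ l * (A * (if - w > 0 then (- w) ^ l else 0)) = A * w ^ l" for A w :: real
      using l p[of w] by (cases w "0 :: real" rule: linorder_cases) (simp_all add: mult.left_commute[of _ A])
    show ?thesis unfolding jfun_def rkap_reflect w by (rule c)
  qed
  have "complex_of_real ((\<integral>(U, V). jfun z z' l U V \<partial>(lborel \<Otimes>\<^sub>M lborel)) + (- 1) ^ l * (\<integral>(U, V). jfun (- z) (- z') l U V \<partial>(lborel \<Otimes>\<^sub>M lborel)))
    = of_real (\<integral>p. (case p of (U, V) \<Rightarrow> jfun z z' l U V) + (- 1) ^ l * (case p of (U, V) \<Rightarrow> jfun (- z) (- z') l (1 - U) (1 - V)) \<partial>(lborel \<Otimes>\<^sub>M lborel))"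
    unfolding r(2)[symmetric] using b(1) r(1) by (subst Bochner_Integration.integral_add) auto
  also have "\<dots> = of_real (\<integral>(U, V). rkap z U * rkap z' V * (1 - U - V) ^ l \<partial>(lborel \<Otimes>\<^sub>M lborel))"
    by (intro arg_cong[where f = of_real] Bochner_Integration.integral_cong refl) (auto simp: e split: prod.split)
  also have "\<dots> = (\<integral>(U, V). complex_of_real (rkap z U * rkap z' V * (1 - U - V) ^ l) \<partial>(lborel \<Otimes>\<^sub>M lborel))"
    by (simp only: integral_complex_of_real[symmetric] prod.case_distrib[of complex_of_real])
  also have "\<dots> = Ssum (of_real z) (of_real z') l" by (rule square_integral[OF z])
  finally have S: "of_real (\<integral>(U, V). jfun z z' l U V \<partial>(lborel \<Otimes>\<^sub>M lborel)) + (- 1) ^ l * of_real (\<integral>(U, V). jfun (- z) (- z') l U V \<partial>(lborel \<Otimes>\<^sub>M lborel))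
     = Ssum (of_real z) (of_real z') l" by simp
  have b2: "rGamma (1 - of_real z) * rGamma (1 - of_real z') * Nser (- of_real z) (- of_real z') (of_real t) l
    = rGamma (of_real t + of_nat l + 1) * of_real (\<integral>(U, V). jfun (- z) (- z') l U V \<partial>(lborel \<Otimes>\<^sub>M lborel))"
    using b'(2) by simp
  show ?thesis unfolding b(2) b2 S[symmetric] by (simp add: distrib_left mult.left_commute)
qed

section \<open>Continuation of the moment identity to all parameters\<close>

lemma real_identity:
  assumes f: "f holomorphic_on ball 0 R" and ab: "a < b" "- R < a" "b < R"
    and z: "\<And>x. a < x \<Longrightarrow> x < b \<Longrightarrow> f (of_real x) = 0" and w: "norm w < R"
  shows "f w = (0 :: complex)"
proof (rule analytic_continuation[OF f, of "complex_of_real ` {a<..<b}" "of_real ((a + b) / 2)"])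
  show "complex_of_real ` {a<..<b} \<subseteq> ball 0 R" using ab by (auto simp: abs_less_iff)
  have "\<bar>(a + b) / 2\<bar> < R" using ab by (auto simp: abs_less_iff)
  then show "complex_of_real ((a + b) / 2) \<in> ball 0 R" unfolding mem_ball_0 norm_of_real .
  show "complex_of_real ((a + b) / 2) islimpt complex_of_real ` {a<..<b}"
    unfolding islimpt_approachable
  proof (intro allI impI)
    fix e :: real assume e: "e > 0"
    define d where "d = min e ((b - a) / 2) / 2"
    have d: "d > 0" "d < e" "d < (b - a) / 2" using e ab by (auto simp: d_def min_def)
    have "dist (complex_of_real ((a + b) / 2 + d)) (complex_of_real ((a + b) / 2)) = \<bar>d\<bar>"
      unfolding dist_of_real dist_real_def by simp
    moreover have "complex_of_real ((a + b) / 2 + d) \<noteq> complex_of_real ((a + b) / 2)"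
      unfolding of_real_eq_iff using d(1) by linarith
    moreover have "(a + b) / 2 + d \<in> {a<..<b}" using d ab by (auto simp: field_simps)
    ultimately show "\<exists>x'\<in>complex_of_real ` {a<..<b}. x' \<noteq> complex_of_real ((a + b) / 2) \<and> dist x' (complex_of_real ((a + b) / 2)) < e"
      using d(1,2) by (intro bexI[of _ "complex_of_real ((a + b) / 2 + d)"] conjI imageI) linarith+
  qed
qed (use z w in auto)

text \<open>The difference \<open>E\<close> of the two sides is holomorphic in each parameter. It
  vanishes for real parameters in a box, and the identity theorem frees first t, then z', then z.
  The integral formula keeps its own condition on the real part of t - z - z'.\<close>

theorem moment_identity:
  obtains L :: nat where
    "\<And>z z' t l. norm z < R \<Longrightarrow> norm z' < R \<Longrightarrow> norm t < R \<Longrightarrow> L \<le> l \<Longrightarrow>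
      rGamma (1 + z) * rGamma (1 + z') * Nser z z' t l + (- 1) ^ l * (rGamma (1 - z) * rGamma (1 - z') * Nser (- z) (- z') t l)
      = rGamma (t + of_nat l + 1) * Ssum z z' l"
    "\<And>z z' t l. norm z < R \<Longrightarrow> norm z' < R \<Longrightarrow> norm t < R \<Longrightarrow> L \<le> l \<Longrightarrow> Re (t - z - z') > - 1 \<Longrightarrow>
      integrable lborel (wfun z z' t l) \<and> (\<integral>x. wfun z z' t l x \<partial>lborel) = fact (l + 1) * Nser z z' t l"
proof -
  \<comment> \<open>The disc must contain the real intervals on which the identity is first known,
    in particular 1 < t < 2.\<close>
  define R' where "R' = max R 3"
  have R': "R' \<ge> 3" "R \<le> R'" by (auto simp: R'_def)
  show ?thesis
  proof (rule moment_integral[of R'], goal_cases)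
    case (1 L)
    note L = 1
    define E where "E l z z' t = rGamma (1 + z) * rGamma (1 + z') * Nser z z' t l + (- 1) ^ l * (rGamma (1 - z) * rGamma (1 - z') * Nser (- z) (- z') t l)
        - rGamma (t + of_nat l + 1) * Ssum z z' l" for l z z' t
    have hol: "(\<lambda>x. E l (f x) (g x) (h x)) holomorphic_on ball 0 R'"
      if "L \<le> l" "f holomorphic_on ball 0 R'" "g holomorphic_on ball 0 R'" "h holomorphic_on ball 0 R'"
        "\<And>x. norm x < R' \<Longrightarrow> norm (f x) \<le> R' \<and> norm (g x) \<le> R' \<and> norm (h x) \<le> R'" for l f g h
      unfolding E_def Ssum_def by (auto intro!: holomorphic_intros L(2) that simp: that(5))
    \<comment> \<open>In this box t - z - z' and t + z + z' both exceed -1, so the moment integrals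
      of both branches converge. The bound \<open>Suc L\<close> supplies the positive order needed
      on the diagonal.\<close>
    have E0: "E l (of_real z) (of_real z') (of_real t) = 0" if "Suc L \<le> l" "-1 < z" "z < 1" "-1 < z'" "z' < 1" "1 < t" "t < 2" for l z z' t
    proof -
      have n: "norm (complex_of_real z) \<le> R'" "norm (complex_of_real z') \<le> R'" "norm (complex_of_real t) \<le> R'"
        "norm (- complex_of_real z) \<le> R'" "norm (- complex_of_real z') \<le> R'" using that R' by auto
      have l: "L \<le> l" "1 \<le> l" using that by auto
      have 1: "Re (complex_of_real t - complex_of_real z - complex_of_real z') > - 1"
        "Re (complex_of_real t - (- complex_of_real z) - (- complex_of_real z')) > - 1" using that by auto
      have z: "\<bar>z\<bar> < 1" "\<bar>z'\<bar> < 1" using that by auto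
      note a = L(1)[OF n(1,2,3) l(1) 1(1)] and a' = L(1)[OF n(4,5,3) l(1) 1(2)]
      from base_identity[OF z that(6) l(2) a[THEN conjunct1] a[THEN conjunct2] a'[THEN conjunct1] a'[THEN conjunct2]]
      show ?thesis by (simp add: E_def)
    qed
    have E1: "E l (of_real z) (of_real z') t = 0" if "Suc L \<le> l" "-1 < z" "z < 1" "-1 < z'" "z' < 1" "norm t < R'" for l z z' t
    proof (rule real_identity[of "\<lambda>t. E l (of_real z) (of_real z') t" R' 1 2])
      show "E l (of_real z) (of_real z') holomorphic_on ball 0 R'"
        by (rule hol[of l "\<lambda>_. of_real z" "\<lambda>_. of_real z'" "\<lambda>t. t"]) (use that R' in \<open>auto intro!: holomorphic_intros\<close>)
    qed (use that R' E0 in auto)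
    have E2: "E l (of_real z) z' t = 0" if "Suc L \<le> l" "-1 < z" "z < 1" "norm z' < R'" "norm t < R'" for l z z' t
    proof (rule real_identity[of "\<lambda>z'. E l (of_real z) z' t" R' "-1" 1])
      show "(\<lambda>z'. E l (of_real z) z' t) holomorphic_on ball 0 R'"
        by (rule hol[of l "\<lambda>_. of_real z" "\<lambda>t. t" "\<lambda>_. t"]) (use that R' in \<open>auto intro!: holomorphic_intros\<close>)
    qed (use that R' E1 in auto)
    have E3: "E l z z' t = 0" if "Suc L \<le> l" "norm z < R'" "norm z' < R'" "norm t < R'" for l z z' t
    proof (rule real_identity[of "\<lambda>z. E l z z' t" R' "-1" 1])
      show "(\<lambda>z. E l z z' t) holomorphic_on ball 0 R'"
        by (rule hol[of l "\<lambda>t. t" "\<lambda>_. z'" "\<lambda>_. t"]) (use that R' in \<open>auto intro!: holomorphic_intros\<close>)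
    qed (use that R' E2 in auto)
    show ?thesis
    proof (rule that[of "Suc L"])
      fix z z' t :: complex and l :: nat assume n: "norm z < R" "norm z' < R" "norm t < R" and l: "Suc L \<le> l"
      have "E l z z' t = 0" by (rule E3) (use n l R' in auto)
      then show "rGamma (1 + z) * rGamma (1 + z') * Nser z z' t l + (- 1) ^ l * (rGamma (1 - z) * rGamma (1 - z') * Nser (- z) (- z') t l)
        = rGamma (t + of_nat l + 1) * Ssum z z' l" by (simp add: E_def)
    next
      fix z z' t :: complex and l :: nat assume n: "norm z < R" "norm z' < R" "norm t < R" and l: "Suc L \<le> l" and g: "Re (t - z - z') > - 1"
      show "integrable lborel (wfun z z' t l) \<and> (\<integral>x. wfun z z' t l x \<partial>lborel) = fact (l + 1) * Nser z z' t l"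
        by (rule L(1)[OF _ _ _ _ g]) (use n l R' in auto)
    qed
  qed
qed

text \<open>The product of Gamma(t+1) and \<open>rGamma\<close> is 1/(t+1)_l, which also equals
  t/(t)_(l+1). The excluded values of t are the poles; the rest is a comparison of
  factorials.\<close>

theorem sigma_moment_eq:
  assumes t: "t = z * z'" and t0: "\<And>n. t \<noteq> - of_nat n"
  shows "Gamma (t + 1) * (fact (l + 1) * (rGamma (t + of_nat l + 1) * Ssum z z' l)) = sigma_moment z z' l"
proof -
  have tp: "t + 1 \<notin> \<int>\<^sub>\<le>\<^sub>0"
  proof
    assume "t + 1 \<in> \<int>\<^sub>\<le>\<^sub>0"
    then obtain n where "t + 1 = - of_nat n" by (elim nonpos_Ints_cases')
    then have "t = - of_nat n - 1" by (simp add: eq_diff_eq)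
    then have "t = - of_nat (Suc n)" by simp
    then show False using t0[of "Suc n"] by simp
  qed
  have tn: "t \<noteq> 0" using t0[of 0] by simp
  have P: "pochhammer (t + 1) l \<noteq> 0"
  proof
    assume "pochhammer (t + 1) l = 0"
    then obtain n where "t + 1 = - of_nat n" unfolding pochhammer_eq_0_iff by blast
    then show False using tp by simp
  qed
  have "rGamma (t + 1) = pochhammer (t + 1) l * rGamma (t + of_nat l + 1)"
    using pochhammer_rGamma[of "t + 1" l] by (simp add: add_ac)
  then have "Gamma (t + 1) * rGamma (t + of_nat l + 1) * pochhammer (t + 1) l = Gamma (t + 1) * rGamma (t + 1)" by simp
  also have "\<dots> = 1" using tp by (simp add: Gamma_def rGamma_eq_zero_iff)
  finally have G: "Gamma (t + 1) * rGamma (t + of_nat l + 1) = 1 / pochhammer (t + 1) l"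
    using P by (simp add: eq_divide_eq)
  have T: "t / pochhammer t (l + 1) = 1 / pochhammer (t + 1) l" using tn by (simp add: pochhammer_rec)
  have "Gamma (t + 1) * (fact (l + 1) * (rGamma (t + of_nat l + 1) * Ssum z z' l)) = 1 / pochhammer (t + 1) l * (fact (l + 1) * Ssum z z' l)"
    unfolding G[symmetric] by (simp only: mult_ac)
  also have "\<dots> = (\<Sum>p\<le>l. t / pochhammer t (l + 1) * ((- 1) ^ (l - p) * pochhammer (z + 1) p * pochhammer (- z + 1) (l - p)
          * pochhammer (z' + 1) p * pochhammer (- z' + 1) (l - p) / (of_nat (l + 1) * fact p * fact (l - p))))"
    unfolding T Ssum_def sum_distrib_left
  proof (intro sum.cong refl arg_cong[where f = "(*) _"])
    fix p assume "p \<in> {..l}"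
    then have b: "(of_nat (l choose p) :: complex) = fact l / (fact p * fact (l - p))"
      using binomial_fact[of p l] by simp
    have F: "(fact (l + 1) :: complex) = of_nat (l + 1) * fact l" by (simp only: Suc_eq_plus1[symmetric] fact_Suc)
    have c: "F * (f / (a * b) * s * (A * B / F * (C * D / F))) = s * B * A * D * C / (m * a * b)"
      if "F = m * f" "f \<noteq> 0" "m \<noteq> 0" for F f a b s A B C D m :: complex
      unfolding that(1) using that by (cases "a = 0"; cases "b = 0") (simp_all add: divide_simps)
    show "fact (l + 1) * (of_nat (l choose p) * (- 1) ^ (l - p) * (pochhammer (1 - z) (l - p) * pochhammer (1 + z) p / fact (l + 1) *
          (pochhammer (1 - z') (l - p) * pochhammer (1 + z') p / fact (l + 1))))
      = (- 1) ^ (l - p) * pochhammer (z + 1) p * pochhammer (- z + 1) (l - p) * pochhammer (z' + 1) p * pochhammer (- z' + 1) (l - p) / (of_nat (l + 1) * fact p * fact (l - p))"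
      unfolding b add.commute[of 1 z] add.commute[of 1 z'] diff_conv_add_uminus[of 1 z] diff_conv_add_uminus[of 1 z'] add.commute[of 1 "- z"] add.commute[of 1 "- z'"]
      by (rule c[OF F]) (simp_all del: of_nat_add of_nat_Suc)
  qed
  also have "\<dots> = sigma_moment z z' l"
    unfolding sigma_moment_def Let_def t[symmetric] by (intro sum.cong refl) (simp add: mult_ac)
  finally show ?thesis .
qed

section \<open>The density of the first correlation measure\<close>

text \<open>(z + m)(z' + m) is either the squared modulus of a nonzero number or a product of two
  reals of equal sign, since no integer lies between z and z'.\<close>

lemma admissible_positive:
  assumes adm: "admissible z z'"
  obtains t e where "z * z' = of_real t" "z + z' = of_real e" "\<And>m::int. t + e * of_int m + (of_int m)\<^sup>2 > 0"
  using adm unfolding admissible_def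
proof (elim disjE conjE exE)
  assume z': "z' = cnj z" and z: "z \<notin> \<int>"
  show ?thesis
  proof (rule that[of "(norm z)\<^sup>2" "2 * Re z"])
    show "z * z' = of_real ((norm z)\<^sup>2)" "z + z' = of_real (2 * Re z)"
      unfolding z' by (simp_all only: complex_norm_square complex_add_cnj)
    fix m :: int
    have "z + of_int m \<noteq> 0"
    proof
      assume "z + of_int m = 0"
      then have "z = of_int (- m)" by (simp add: add_eq_0_iff2)
      then show False using z by (metis Ints_of_int)
    qed
    then have "0 < (Re (z + of_int m))\<^sup>2 + (Im (z + of_int m))\<^sup>2" by (simp only: complex_neq_0)
    then show "(norm z)\<^sup>2 + 2 * Re z * of_int m + (of_int m)\<^sup>2 > 0"
      unfolding cmod_power2 by (simp add: power2_eq_square algebra_simps)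
  qed
next
  fix m :: int
  assume z: "z \<in> \<real>" "z' \<in> \<real>" and m: "of_int m < Re z" "Re z < of_int m + 1" "of_int m < Re z'" "Re z' < of_int m + 1"
  have e: "z = of_real (Re z)" "z' = of_real (Re z')" using z by simp_all
  show ?thesis
  proof (rule that[of "Re z * Re z'" "Re z + Re z'"])
    show "z * z' = of_real (Re z * Re z')" "z + z' = of_real (Re z + Re z')"
      unfolding of_real_mult of_real_add by (rule arg_cong2[OF e])+
    fix k :: int
    have "(Re z + of_int k) * (Re z' + of_int k) > 0"
    proof (cases "m + k \<ge> 0")
      case True
      then have "of_int m + (of_int k :: real) \<ge> 0" by (metis of_int_0_le_iff of_int_add)
      then show ?thesis using m by (intro mult_pos_pos) linarith+
    next
      case False
      then have "m + k + 1 \<le> 0" by simp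
      then have "of_int m + (of_int k :: real) + 1 \<le> 0" by (metis of_int_le_0_iff of_int_add of_int_1)
      then show ?thesis using m by (intro mult_neg_neg) linarith+
    qed
    then show "Re z * Re z' + (Re z + Re z') * of_int k + (of_int k)\<^sup>2 > 0"
      by (simp add: power2_eq_square algebra_simps)
  qed
qed

lemma sigma1_properties:
  assumes adm: "admissible z z'"
  shows "sets (sigma1 z z') = sets borel" "finite_measure (sigma1 z z')" "emeasure (sigma1 z z') (UNIV - {-1..1}) = 0"
    "complex_of_real (\<integral>x. x ^ l \<partial>sigma1 z z') = sigma_moment z z' l"
proof -
  obtain t e where te: "z * z' = of_real t" "z + z' = of_real e" "\<And>m::int. t + e * of_int m + (of_int m)\<^sup>2 > 0"
    using admissible_positive[OF adm] by blast
  have "t > 0" using te(3)[of 0] by simp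
  moreover have "poly [:t, e, 1:] (of_int m) \<ge> 0" for m :: int
    using te(3)[of m] by (simp add: power2_eq_square algebra_simps)
  ultimately obtain M where M: "sets M = sets (borel :: real measure)" "finite_measure M" "emeasure M (UNIV - {-1..1}) = 0"
    "\<And>l. (\<integral>x. x ^ l \<partial>M) = moment_val t e l"
    using moment_measure_exists by blast
  have mom: "complex_of_real (\<integral>x. x ^ l \<partial>M) = sigma_moment z z' l" for l
    unfolding M(4) sigma_moment_moment_val[OF te(1,2)] ..
  have "sigma1 z z' = M" unfolding sigma1_def
  proof (rule the_equality)
    fix N :: "real measure"
    assume N: "sets N = sets borel \<and> finite_measure N \<and> emeasure N (UNIV - {-1..1}) = 0 \<and>
      (\<forall>l. complex_of_real (\<integral>x. x ^ l \<partial>N) = sigma_moment z z' l)"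
    show "N = M"
    proof (rule moments_unique)
      fix l
      have "complex_of_real (\<integral>x. x ^ l \<partial>N) = complex_of_real (\<integral>x. x ^ l \<partial>M)" using N mom by simp
      then show "(\<integral>x. x ^ l \<partial>N) = (\<integral>x. x ^ l \<partial>M)" by (simp only: of_real_eq_iff)
    qed (use N M in auto)
  qed (use M mom in auto)
  then show "sets (sigma1 z z') = sets borel" "finite_measure (sigma1 z z')" "emeasure (sigma1 z z') (UNIV - {-1..1}) = 0"
    "complex_of_real (\<integral>x. x ^ l \<partial>sigma1 z z') = sigma_moment z z' l" using M mom by auto
qed

lemma continuous_nonneg_of_integrals:
  fixes v :: "real \<Rightarrow> real"
  assumes i: "integrable lborel v" and S: "open S" and c: "continuous_on S v"
    and p: "\<And>a b. a \<le> b \<Longrightarrow> 0 \<le> (\<integral>x. indicator {a<..b} x * v x \<partial>lborel)" and x: "x \<in> S"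
  shows "0 \<le> v x"
proof (rule ccontr)
  assume n: "\<not> 0 \<le> v x"
  have "isCont v x" using c S x by (simp add: continuous_on_eq_continuous_at)
  then obtain d where d: "d > 0" "\<And>y. \<bar>y - x\<bar> < d \<Longrightarrow> \<bar>v y - v x\<bar> < - v x / 2"
    using n unfolding continuous_at_eps_delta dist_real_def by (metis half_gt_zero neg_0_less_iff_less not_le)
  define e where "e = d / 2"
  have e: "e > 0" "e < d" using d by (auto simp: e_def)
  have "(\<integral>y. indicator {x - e<..x} y * v y \<partial>lborel) \<le> (\<integral>y. indicator {x - e<..x} y * (v x / 2) \<partial>lborel)"
  proof (rule integral_mono)
    show "integrable lborel (\<lambda>y. indicator {x - e<..x} y * v y)"
      using integrable_mult_indicator[OF _ i, of "{x - e<..x}"] by simp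
    show "integrable lborel (\<lambda>y. indicator {x - e<..x} y * (v x / 2))"
      by (intro integrable_mult_left integrable_real_indicator) (use e in auto)
    fix y show "indicator {x - e<..x} y * v y \<le> indicator {x - e<..x} y * (v x / 2)"
      using d(2)[of y] e by (auto simp: indicator_def abs_less_iff)
  qed
  also have "\<dots> = e * (v x / 2)" using e by simp
  also have "\<dots> < 0" using e n by (simp add: mult_pos_neg)
  finally show False using p[of "x - e" x] e by simp
qed

text \<open>Differences of tails give the integrals of \<open>k\<close> over all half-open
  intervals, and these are nonnegative reals. Continuity on \<open>S\<close> turns this into reality
  and nonnegativity at every point of \<open>S\<close>, as the pointwise claims about the density
  require.\<close>

lemma density_of_tails:
  fixes N :: "real measure" and k :: "real \<Rightarrow> complex"
  assumes sN: "sets N = sets borel" and fN: "finite_measure N" and i: "integrable lborel k"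
    and S: "open S" "continuous_on S k" "\<And>x. x \<notin> S \<Longrightarrow> k x = 0"
    and tails: "\<And>a. (\<integral>x. of_real (indicator {a<..} x) * k x \<partial>lborel) = of_real (measure N {a<..})"
  obtains r where "\<And>x. 0 \<le> r x" "\<And>x. k x = of_real (r x)" "r \<in> borel_measurable borel"
    "N = density lborel (\<lambda>x. ennreal (r x))"
proof -
  interpret N: finite_measure N by fact
  have ii: "integrable lborel (\<lambda>x. of_real (indicator A x) * k x)" if "A \<in> sets borel" for A
    using integrable_mult_indicator[OF _ i, of A] that by (simp add: scaleR_conv_of_real)
  have I: "(\<integral>x. of_real (indicator {a<..b} x) * k x \<partial>lborel) = of_real (measure N {a<..b})" if "a \<le> b" for a b
  proof -
    have "(\<integral>x. of_real (indicator {a<..b} x) * k x \<partial>lborel)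
      = (\<integral>x. of_real (indicator {a<..} x) * k x - of_real (indicator {b<..} x) * k x \<partial>lborel)"
      using that by (intro Bochner_Integration.integral_cong refl) (auto simp: indicator_def)
    also have "\<dots> = of_real (measure N {a<..}) - of_real (measure N {b<..})"
      by (subst Bochner_Integration.integral_diff) (simp_all only: ii borel_open open_greaterThan tails)
    also have "measure N {a<..} = measure N {a<..b} + measure N {b<..}"
    proof -
      have "{a<..b} \<union> {b<..} = {a<..}" "{a<..b} \<inter> {b<..} = {}" using that by auto
      then show ?thesis using N.finite_measure_Union[of "{a<..b}" "{b<..}"] sN by simp
    qed
    finally show ?thesis by simp
  qed
  have R: "(\<integral>x. indicator A x * Re (k x) \<partial>lborel) = Re (\<integral>x. of_real (indicator A x) * k x \<partial>lborel)"
    "(\<integral>x. indicator A x * Im (k x) \<partial>lborel) = Im (\<integral>x. of_real (indicator A x) * k x \<partial>lborel)" if "A \<in> sets borel" for A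
    using integral_Re[OF ii[OF that]] integral_Im[OF ii[OF that]] by simp_all
  have nn: "Re (k x) \<ge> 0" "Im (k x) \<ge> 0" "- Im (k x) \<ge> 0" if x: "x \<in> S" for x
  proof -
    show "Re (k x) \<ge> 0"
      by (rule continuous_nonneg_of_integrals[OF integrable_Re[OF i] S(1) continuous_on_Re[OF S(2)] _ x])
        (simp add: R I)
    show "Im (k x) \<ge> 0"
      by (rule continuous_nonneg_of_integrals[OF integrable_Im[OF i] S(1) continuous_on_Im[OF S(2)] _ x])
        (simp add: R I)
    have "integrable lborel (\<lambda>x. - Im (k x))" "continuous_on S (\<lambda>x. - Im (k x))"
      using i S(2) by (auto intro!: continuous_intros)
    from continuous_nonneg_of_integrals[OF this(1) S(1) this(2) _ x]
    show "- Im (k x) \<ge> 0" by (simp add: R I)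
  qed
  define r where "r x = Re (k x)" for x
  have r0: "0 \<le> r x" for x using nn(1)[of x] S(3)[of x] by (cases "x \<in> S") (auto simp: r_def)
  have kr: "k x = of_real (r x)" for x
    using nn(2,3)[of x] S(3)[of x] by (cases "x \<in> S") (auto simp: r_def complex_eq_iff)
  have ri: "integrable lborel r" unfolding r_def using i by simp
  then have [measurable]: "r \<in> borel_measurable borel" by simp
  have "N = density lborel (\<lambda>x. ennreal (r x))"
  proof (rule measure_eqI_lessThan)
    fix a :: real
    have "emeasure (density lborel (\<lambda>x. ennreal (r x))) {a<..} = (\<integral>\<^sup>+x. ennreal (indicator {a<..} x * r x) \<partial>lborel)"
      by (subst emeasure_density) (auto intro!: nn_integral_cong simp: indicator_def)
    also have "\<dots> = ennreal (\<integral>x. indicator {a<..} x * r x \<partial>lborel)"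
      by (rule nn_integral_eq_integral) (use integrable_mult_indicator[OF _ ri, of "{a<..}"] r0 in auto)
    also have "(\<integral>x. indicator {a<..} x * r x \<partial>lborel) = measure N {a<..}"
      unfolding r_def by (simp add: R tails)
    finally show "emeasure N {a<..} = emeasure (density lborel (\<lambda>x. ennreal (r x))) {a<..}"
      by (simp add: N.emeasure_eq_measure)
  qed (simp_all add: sN N.emeasure_eq_measure)
  then show ?thesis using that[of r] r0 kr by auto
qed

lemma Kser_holomorphic: "Kser z z' t holomorphic_on ball 0 1"
  by (rule power_series_holomorphic[where a = "\<lambda>k. dcoef z z' t (- z) (- z') k * rGamma (t - z - z' + 1 + of_nat k)"])
    (use Kser_sums[of _ z z' t] in simp)

text \<open>The claimed density as a function of a complex variable, so that real analyticity
  follows from holomorphy on discs.\<close>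

definition dens :: "complex \<Rightarrow> complex \<Rightarrow> complex \<Rightarrow> complex \<Rightarrow> complex" where
  "dens z z' t w = Gamma (t + 1) / (Gamma (z + 1) * Gamma (z' + 1)) * (1 - w) powr (t - z - z') * Kser z z' t (1 - w)"

text \<open>The first condition places 1 - w in the disc of convergence of \<open>Kser\<close>, the
  second keeps 1 - w off the branch cut of the power.\<close>

lemma dens_holomorphic:
  assumes A: "\<And>w. w \<in> A \<Longrightarrow> norm (1 - w) < 1 \<and> Re w < 1"
  shows "dens z z' t holomorphic_on A"
proof -
  have "1 - w \<notin> \<real>\<^sub>\<le>\<^sub>0" if "w \<in> A" for w
    using A[OF that] by (auto simp: complex_nonpos_Reals_iff)
  moreover have "(\<lambda>w. 1 - w) holomorphic_on A" by (intro holomorphic_intros)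
  then have "(\<lambda>w. Kser z z' t (1 - w)) holomorphic_on A"
    using A by (intro holomorphic_on_compose_gen[OF _ Kser_holomorphic, unfolded o_def]) auto
  ultimately show ?thesis unfolding dens_def[abs_def] by (intro holomorphic_intros) auto
qed

lemma dens_holomorphic_ball:
  assumes x: "0 < x" "x < 1"
  shows "dens z z' t holomorphic_on ball (of_real x) (min x (1 - x))"
proof (rule dens_holomorphic)
  fix w :: complex assume "w \<in> ball (of_real x) (min x (1 - x))"
  then have d: "norm (of_real x - w) < x" "norm (of_real x - w) < 1 - x" by (auto simp: dist_norm)
  have "norm (1 - w) \<le> norm (of_real (1 - x) :: complex) + norm (of_real x - w)"
    using norm_triangle_ineq[of "of_real (1 - x) :: complex" "of_real x - w"] by simp
  moreover have "norm (of_real (1 - x) :: complex) = 1 - x" unfolding norm_of_real using x by simp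
  moreover have "\<bar>Re (of_real x - w)\<bar> \<le> norm (of_real x - w)" by (rule abs_Re_le_cmod)
  ultimately show "norm (1 - w) < 1 \<and> Re w < 1" using d x by auto
qed

lemma real_analytic_onI:
  assumes "\<And>x. x \<in> S \<Longrightarrow> \<exists>r>0. \<exists>g. g holomorphic_on ball (of_real x) r \<and> (\<forall>y. \<bar>y - x\<bar> < r \<longrightarrow> f y = Re (g (of_real y)))"
  shows "real_analytic_on f S"
  unfolding real_analytic_on_def
proof
  fix x assume "x \<in> S"
  then obtain r g where r: "r > 0" "g holomorphic_on ball (of_real x) r" "\<And>y. \<bar>y - x\<bar> < r \<Longrightarrow> f y = Re (g (of_real y))"
    using assms by blast
  show "\<exists>r>0. \<exists>c. \<forall>y. \<bar>y - x\<bar> < r \<longrightarrow> (\<lambda>n. c n * (y - x) ^ n) sums f y"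
  proof (intro exI[of _ r] exI[of _ "\<lambda>n. Re ((deriv ^^ n) g (of_real x) / fact n)"] conjI allI impI r(1))
    fix y assume y: "\<bar>y - x\<bar> < r"
    then have "complex_of_real y \<in> ball (of_real x) r" by (simp add: dist_of_real dist_real_def abs_minus_commute)
    from sums_Re[OF holomorphic_power_series[OF r(2) this]]
    show "(\<lambda>n. Re ((deriv ^^ n) g (of_real x) / fact n) * (y - x) ^ n) sums f y"
      unfolding r(3)[OF y] of_real_diff[symmetric] of_real_power[symmetric]
      by (simp only: times_complex.sel Re_complex_of_real Im_complex_of_real mult_zero_right diff_zero)
  qed
qed

lemma wfun_dens:
  "Gamma (t + 1) * (rGamma (1 + z) * rGamma (1 + z')) * wfun z z' t n x
    = (if 0 < x \<and> x < 1 then of_real x ^ (n + 1) * dens z z' t (of_real x) else 0)"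
  by (simp add: wfun_def dens_def rGamma_inverse_Gamma field_simps add.commute)

lemma dens_continuous: "continuous_on {0<..<1} (\<lambda>x. dens z z' t (of_real x))"
proof -
  have "dens z z' t holomorphic_on complex_of_real ` {0<..<1}"
  proof (rule dens_holomorphic)
    fix w assume "w \<in> complex_of_real ` {0<..<1}"
    then obtain x where "w = of_real x" "0 < x" "x < 1" by auto
    moreover have "norm (of_real (1 - x) :: complex) = \<bar>1 - x\<bar>" by (rule norm_of_real)
    ultimately show "norm (1 - w) < 1 \<and> Re w < 1" by simp
  qed
  from continuous_on_compose2[OF holomorphic_on_imp_continuous_on[OF this] _ subset_refl]
  show ?thesis by (auto intro!: continuous_intros)
qed

lemma wfun_dens_continuous:
  "continuous_on ({..<0} \<union> {0<..<1}) (\<lambda>x. Gamma (t + 1) * (rGamma (1 + z) * rGamma (1 + z')) * wfun z z' t n x)"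
proof (rule continuous_on_open_Un)
  show "continuous_on {..<0} (\<lambda>x. Gamma (t + 1) * (rGamma (1 + z) * rGamma (1 + z')) * wfun z z' t n x)"
    by (rule continuous_on_eq[OF continuous_on_const[of _ 0]]) (auto simp: wfun_def)
  have "continuous_on {0<..<1} (\<lambda>x. of_real x ^ (n + 1) * dens z z' t (of_real x))"
    by (intro continuous_intros dens_continuous)
  then show "continuous_on {0<..<1} (\<lambda>x. Gamma (t + 1) * (rGamma (1 + z) * rGamma (1 + z')) * wfun z z' t n x)"
    by (rule continuous_on_eq) (simp only: wfun_dens greaterThanLessThan_iff simp_thms if_True)
qed auto

lemma wfun_shift: "of_real (x ^ l) * wfun z z' t n x = wfun z z' t (n + l) x"
  by (simp add: wfun_def power_add mult_ac)

theorem rho1_dens: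
  assumes adm: "admissible z z'" and t: "t = z * z'" and S: "S = {-1<..<0} \<union> {0<..<1}"
  obtains f where "\<And>x. 0 \<le> f x" "\<And>x. 0 < x \<Longrightarrow> x < 1 \<Longrightarrow> dens z z' t (of_real x) = of_real (f x)"
    "\<And>x. - 1 < x \<Longrightarrow> x < 0 \<Longrightarrow> dens (- z) (- z') t (of_real (- x)) = of_real (f x)"
    "\<And>A. A \<in> sets borel \<Longrightarrow> emeasure (rho1 z z') (A \<inter> S) = (\<integral>\<^sup>+x\<in>A \<inter> S. ennreal (f x) \<partial>lborel)"
proof (rule moment_identity[where R = "norm z + norm z' + norm t + 1"], goal_cases)
  case (1 L)
  note mi = this(2) and wi = this(3)
  have nz: "norm z < norm z + norm z' + norm t + 1" "norm z' < norm z + norm z' + norm t + 1" "norm t < norm z + norm z' + norm t + 1"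
    "norm (- z) < norm z + norm z' + norm t + 1" "norm (- z') < norm z + norm z' + norm t + 1"
    using norm_ge_zero[of z] norm_ge_zero[of z'] norm_ge_zero[of t] unfolding norm_minus_cancel by linarith+
  obtain \<tau> e where te: "z * z' = of_real \<tau>" "z + z' = of_real e" "\<And>m::int. \<tau> + e * of_int m + (of_int m)\<^sup>2 > 0"
    using admissible_positive[OF adm] by blast
  \<comment> \<open>The values of (z + m)(z' + m) at m = -1 and m = 1 are t - z - z' + 1 and t + z +
    z' + 1. Their positivity is the convergence condition of the moment integrals at the ends of the
    two branches.\<close>
  have "t - z - z' = of_real \<tau> - (z + z')" "t - (- z) - (- z') = of_real \<tau> + (z + z')" unfolding t te(1) by simp_all
  then have g: "Re (t - z - z') > - 1" "Re (t - (- z) - (- z')) > - 1"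
    unfolding te(2) using te(3)[of "-1"] te(3)[of 1] by auto
  have t0: "t \<noteq> - of_nat m" for m
  proof
    assume "t = - of_nat m"
    then have "complex_of_real \<tau> = of_real (- of_nat m)" unfolding t te(1) by simp
    then have "\<tau> = - of_nat m" by (simp only: of_real_eq_iff)
    then show False using te(3)[of 0] by simp
  qed
  \<comment> \<open>At least \<open>L\<close>, so that the moment identity holds from order
    \<open>n\<close> on, and even, so that x^n is nonnegative and the sign (-1)^(n+l) in that
    identity agrees with the (-1)^l coming from the reflected branch.\<close>
  define n where "n = 2 * L"
  have n: "even n" "L \<le> n + l" for l by (auto simp: n_def)
  define C D where "C = Gamma (t + 1) * (rGamma (1 + z) * rGamma (1 + z'))"
    and "D = Gamma (t + 1) * (rGamma (1 + (- z)) * rGamma (1 + (- z')))"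
  \<comment> \<open>The candidate for the density of x^n \<open>sigma1\<close>: on each branch the
    claimed density of \<open>rho1\<close> times |x|^(n+1). It is complex until
    \<open>density_of_tails\<close> applies.\<close>
  define k where "k x = C * wfun z z' t n x + D * wfun (- z) (- z') t n (- x)" for x
  have w: "integrable lborel (wfun z z' t (n + l))" "(\<integral>x. wfun z z' t (n + l) x \<partial>lborel) = fact (n + l + 1) * Nser z z' t (n + l)"
    "integrable lborel (\<lambda>x. wfun (- z) (- z') t (n + l) (- x))"
    "(\<integral>x. wfun (- z) (- z') t (n + l) (- x) \<partial>lborel) = fact (n + l + 1) * Nser (- z) (- z') t (n + l)" for l
    using wi[OF nz(1,2,3) n(2) g(1)] wi[OF nz(4,5,3) n(2) g(2)]
      lborel_integrable_real_affine[of "wfun (- z) (- z') t (n + l)" "-1" 0]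
      lborel_integral_real_affine[of "-1" "wfun (- z) (- z') t (n + l)" 0] by auto
  have ik: "integrable lborel k" unfolding k_def using w(1,3)[of 0] by simp
  have xk: "of_real (x ^ l) * k x = C * wfun z z' t (n + l) x + (- 1) ^ l * D * wfun (- z) (- z') t (n + l) (- x)" for x l
  proof -
    have "x ^ l = (- 1) ^ l * (- x) ^ l" by (simp flip: power_mult_distrib)
    then have "complex_of_real (x ^ l) * wfun (- z) (- z') t n (- x) = (- 1) ^ l * (of_real ((- x) ^ l) * wfun (- z) (- z') t n (- x))" by simp
    note e = this[unfolded wfun_shift]
    have "of_real (x ^ l) * k x = C * (of_real (x ^ l) * wfun z z' t n x) + D * (of_real (x ^ l) * wfun (- z) (- z') t n (- x))"
      unfolding k_def distrib_left by (simp only: mult.left_commute)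
    then show ?thesis unfolding e wfun_shift by (simp only: mult.assoc mult.left_commute[of D])
  qed
  have mk: "(\<integral>x. of_real (x ^ l) * k x \<partial>lborel) = sigma_moment z z' (n + l)" for l
  proof -
    have "(\<integral>x. of_real (x ^ l) * k x \<partial>lborel) = C * (fact (n + l + 1) * Nser z z' t (n + l))
      + (- 1) ^ l * D * (fact (n + l + 1) * Nser (- z) (- z') t (n + l))"
      unfolding xk using w[of l] by (subst Bochner_Integration.integral_add) (auto intro: integrable_mult_right simp del: fact_Suc)
    also have "\<dots> = Gamma (t + 1) * (fact (n + l + 1) * (rGamma (1 + z) * rGamma (1 + z') * Nser z z' t (n + l)
       + (- 1) ^ (n + l) * (rGamma (1 - z) * rGamma (1 - z') * Nser (- z) (- z') t (n + l))))"
      unfolding C_def D_def using n(1) by (simp add: power_add distrib_left mult_ac del: fact_Suc)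
    also have "\<dots> = sigma_moment z z' (n + l)"
      unfolding mi[OF nz(1,2,3) n(2)] by (rule sigma_moment_eq[OF t t0])
    finally show ?thesis .
  qed
  define M where "M = sigma1 z z'"
  note M = sigma1_properties[OF adm, folded M_def]
  note [measurable_cong] = M(1)
  interpret M: finite_measure M by (rule M(2))
  define h where "h x = x ^ n * indicator {-1..1} x" for x :: real
  have [measurable]: "h \<in> borel_measurable borel" unfolding h_def by measurable
  have h0: "0 \<le> h x" for x using n(1) by (simp add: h_def zero_le_even_power)
  have hi: "integrable M h"
  proof (rule M.integrable_const_bound[of _ 1])
    have "\<bar>x\<bar> ^ n \<le> 1" if "x \<in> {-1..1}" for x :: real using that by (intro power_le_one) auto
    then show "AE x in M. norm (h x) \<le> 1" by (intro AE_I2) (auto simp: h_def indicator_def power_abs)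
  qed measurable
  have mh: "(\<integral>x. of_real (x ^ l) * complex_of_real (h x) \<partial>M) = sigma_moment z z' (n + l)" for l
  proof -
    have "(\<integral>x. of_real (x ^ l) * complex_of_real (h x) \<partial>M) = (\<integral>x. of_real (x ^ (n + l)) * indicator {-1..1} x \<partial>M)"
      by (intro Bochner_Integration.integral_cong refl) (auto simp: h_def power_add indicator_def mult_ac)
    then show ?thesis unfolding finite_measure_moments(2)[OF M(1-3)] M(4) .
  qed
  have tails: "(\<integral>x. of_real (indicator {a<..} x) * complex_of_real (h x) \<partial>M) = (\<integral>x. of_real (indicator {a<..} x) * k x \<partial>lborel)" for a
  proof (rule moments_tail[OF M(1) sets_lborel _ ik])
    show "integrable M (\<lambda>x. complex_of_real (h x))" using hi by (simp only: complex_of_real_integrable_eq)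
    show "complex_of_real (h x) = 0" "k x = 0" if "x \<notin> {-1..1}" for x
      using that by (auto simp: h_def k_def wfun_def)
  qed (simp only: mh mk)
  define N where "N = density M (\<lambda>x. ennreal (h x))"
  have "emeasure N (space N) = (\<integral>\<^sup>+x. ennreal (h x) \<partial>M)"
    unfolding N_def by (subst emeasure_density) (auto intro!: nn_integral_cong)
  then have fN: "finite_measure N"
    using nn_integral_eq_integral[OF hi] h0 by (intro finite_measureI) simp
  have sN: "sets N = sets borel" unfolding N_def by (simp add: M(1))
  have tk: "(\<integral>x. of_real (indicator {a<..} x) * k x \<partial>lborel) = of_real (measure N {a<..})" for a
  proof -
    have "measure N {a<..} = (\<integral>x. indicator {a<..} x \<partial>N)"
      using sN sets_eq_imp_space_eq[OF sN] by simp
    also have "\<dots> = (\<integral>x. indicator {a<..} x * h x \<partial>M)"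
      unfolding N_def by (subst integral_density) (auto simp: h0 mult.commute)
    finally have "complex_of_real (measure N {a<..}) = (\<integral>x. complex_of_real (indicator {a<..} x * h x) \<partial>M)"
      by (simp only: integral_complex_of_real)
    then show ?thesis unfolding tails[symmetric] of_real_mult ..
  qed
  have ck: "continuous_on S k" unfolding k_def C_def D_def
  proof (rule continuous_on_add)
    show "continuous_on S (\<lambda>x. Gamma (t + 1) * (rGamma (1 + z) * rGamma (1 + z')) * wfun z z' t n x)"
      by (rule continuous_on_subset[OF wfun_dens_continuous]) (auto simp: S)
    show "continuous_on S (\<lambda>x. Gamma (t + 1) * (rGamma (1 + - z) * rGamma (1 + - z')) * wfun (- z) (- z') t n (- x))"
      by (rule continuous_on_compose2[OF wfun_dens_continuous continuous_on_minus[OF continuous_on_id]]) (auto simp: S)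
  qed
  have oS: "open S" unfolding S by (intro open_Un open_greaterThanLessThan)
  have kS: "k x = 0" if "x \<notin> S" for x using that by (auto simp: k_def wfun_def S)
  obtain r where r: "\<And>x. 0 \<le> r x" "\<And>x. k x = of_real (r x)" "r \<in> borel_measurable borel"
    "N = density lborel (\<lambda>x. ennreal (r x))"
    using density_of_tails[OF sN fN ik oS ck kS tk] by blast
  note [measurable] = r(3)
  \<comment> \<open>Of the \<open>n + 1\<close> powers, \<open>n\<close> undo the weight
    \<open>h\<close> and one is the factor 1/|x| between \<open>sigma1\<close> and
    \<open>rho1\<close>.\<close>
  define f where "f x = r x / \<bar>x\<bar> ^ (n + 1)" for x
  show ?case
  proof (rule 1(1)[of f])
    show "0 \<le> f x" for x using r(1) by (simp add: f_def)
    show "dens z z' t (of_real x) = of_real (f x)" if x: "0 < x" "x < 1" for x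
    proof -
      have "of_real (r x) = of_real x ^ (n + 1) * dens z z' t (of_real x)"
        unfolding r(2)[symmetric] k_def C_def wfun_dens using x by (simp add: wfun_def)
      then show ?thesis using x by (simp add: f_def)
    qed
    show "dens (- z) (- z') t (of_real (- x)) = of_real (f x)" if x: "- 1 < x" "x < 0" for x
    proof -
      have "of_real (r x) = of_real (- x) ^ (n + 1) * dens (- z) (- z') t (of_real (- x))"
        unfolding r(2)[symmetric] k_def D_def wfun_dens using x by (simp add: wfun_def)
      moreover have "\<bar>x\<bar> = - x" using x by simp
      ultimately show ?thesis unfolding f_def using x by (simp only: of_real_divide of_real_power) simp
    qed
    fix A :: "real set" assume A: "A \<in> sets borel"
    have [measurable]: "A \<inter> S \<in> sets borel" using A oS by (intro sets.Int) auto
    have [measurable]: "I_set \<in> sets borel" unfolding I_set_def by measurable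
    have "emeasure (rho1 z z') (A \<inter> S) = (\<integral>\<^sup>+x. ennreal (indicator I_set x / \<bar>x\<bar>) * indicator (A \<inter> S) x \<partial>M)"
      unfolding rho1_def M_def[symmetric] by (rule emeasure_density) (simp_all add: M(1))
    also have "\<dots> = (\<integral>\<^sup>+x. ennreal (h x) * (ennreal (1 / \<bar>x\<bar> ^ (n + 1)) * indicator (A \<inter> S) x) \<partial>M)"
    proof (rule nn_integral_cong)
      fix x
      have "h x * (1 / \<bar>x\<bar> ^ (n + 1)) = indicator I_set x / \<bar>x\<bar>" if "x \<in> S"
      proof -
        have "x \<in> {-1..1}" "x \<in> I_set" "x \<noteq> 0" using that by (auto simp: S I_set_def)
        moreover have "x ^ n = \<bar>x\<bar> ^ n" using n(1) by (simp add: power_even_abs)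
        ultimately show ?thesis by (simp add: h_def)
      qed
      then show "ennreal (indicator I_set x / \<bar>x\<bar>) * indicator (A \<inter> S) x = ennreal (h x) * (ennreal (1 / \<bar>x\<bar> ^ (n + 1)) * indicator (A \<inter> S) x)"
        using h0[of x] by (cases "x \<in> S") (auto simp: indicator_def simp flip: ennreal_mult)
    qed
    also have "\<dots> = (\<integral>\<^sup>+x. ennreal (1 / \<bar>x\<bar> ^ (n + 1)) * indicator (A \<inter> S) x \<partial>N)"
      unfolding N_def by (rule nn_integral_density[symmetric]) measurable
    also have "\<dots> = (\<integral>\<^sup>+x. ennreal (r x) * (ennreal (1 / \<bar>x\<bar> ^ (n + 1)) * indicator (A \<inter> S) x) \<partial>lborel)"
      unfolding r(4) by (rule nn_integral_density) measurable
    also have "\<dots> = (\<integral>\<^sup>+x\<in>A \<inter> S. ennreal (f x) \<partial>lborel)"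
      using r(1) by (intro nn_integral_cong) (auto simp: f_def indicator_def simp flip: ennreal_mult)
    finally show "emeasure (rho1 z z') (A \<inter> S) = (\<integral>\<^sup>+x\<in>A \<inter> S. ennreal (f x) \<partial>lborel)" .
  qed
qed

lemma dens_pairing:
  assumes "0 < x" "x < 1"
  shows "dens z z' t (of_real x) = Gamma (t + 1) / (Gamma (z + 1) * Gamma (z' + 1))
    * complex_of_real (1 - x) powr (t - z - z') * pairing (- z) (- z') (t - 2) (Psi z z' t x)"
  unfolding pairing_Psi[OF assms] dens_def Kser_def by simp

theorem theorem5p10:
  fixes z z' :: complex
  assumes adm: "admissible z z'"
  shows "\<exists>f :: real \<Rightarrow> real.
     (\<forall>A\<in>sets borel. emeasure (rho1 z z') (A \<inter> ({-1<..<0} \<union> {0<..<1}))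
         = set_nn_integral lborel (A \<inter> ({-1<..<0} \<union> {0<..<1})) (\<lambda>x. ennreal (f x))) \<and>
     (\<forall>x\<in>{-1<..<0} \<union> {0<..<1}. 0 \<le> f x) \<and>
     real_analytic_on f {0<..<1} \<and> real_analytic_on f {-1<..<0} \<and>
     (\<forall>x\<in>{0<..<1}. complex_of_real (f x) =
        Gamma (z * z' + 1) / (Gamma (z + 1) * Gamma (z' + 1))
        * complex_of_real (1 - x) powr (z * z' - z - z')
        * pairing (- z) (- z') (z * z' - 2) (Psi z z' (z * z') x)) \<and>
     (\<forall>x\<in>{-1<..<0}. complex_of_real (f x) =
        Gamma (z * z' + 1) / (Gamma (- z + 1) * Gamma (- z' + 1))
        * complex_of_real (1 - \<bar>x\<bar>) powr (z * z' + z + z')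
        * pairing z z' (z * z' - 2) (Psi (- z) (- z') (z * z') \<bar>x\<bar>))"
proof -
  obtain f where f: "\<And>x. 0 \<le> f x" "\<And>x. 0 < x \<Longrightarrow> x < 1 \<Longrightarrow> dens z z' (z * z') (of_real x) = of_real (f x)"
    "\<And>x. - 1 < x \<Longrightarrow> x < 0 \<Longrightarrow> dens (- z) (- z') (z * z') (of_real (- x)) = of_real (f x)"
    "\<And>A. A \<in> sets borel \<Longrightarrow> emeasure (rho1 z z') (A \<inter> ({-1<..<0} \<union> {0<..<1}))
      = (\<integral>\<^sup>+x\<in>A \<inter> ({-1<..<0} \<union> {0<..<1}). ennreal (f x) \<partial>lborel)"
    using rho1_dens[OF adm refl refl] by blast
  show ?thesis
  proof (intro exI[of _ f] conjI ballI)
    show "real_analytic_on f {0<..<1}"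
    proof (rule real_analytic_onI)
      fix x :: real assume x: "x \<in> {0<..<1}"
      have "f y = Re (dens z z' (z * z') (of_real y))" if "\<bar>y - x\<bar> < min x (1 - x)" for y
        using that f(2)[of y] by auto
      then show "\<exists>r>0. \<exists>g. g holomorphic_on ball (of_real x) r \<and> (\<forall>y. \<bar>y - x\<bar> < r \<longrightarrow> f y = Re (g (of_real y)))"
        using x dens_holomorphic_ball[of x z z' "z * z'"] by (intro exI[of _ "min x (1 - x)"]) auto
    qed
    show "real_analytic_on f {-1<..<0}"
    proof (rule real_analytic_onI)
      fix x :: real assume x: "x \<in> {-1<..<0}"
      let ?r = "min (- x) (1 - (- x))" and ?g = "\<lambda>w. dens (- z) (- z') (z * z') (- w)"
      have "?g holomorphic_on ball (of_real x) ?r"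
      proof (rule holomorphic_on_compose_gen[OF _ dens_holomorphic_ball, unfolded o_def])
        show "0 < - x" "- x < 1" using x by auto
        show "uminus holomorphic_on ball (complex_of_real x) ?r" by (intro holomorphic_intros)
        have "dist (- a) (- b) = dist a b" for a b :: complex by (simp add: dist_norm norm_minus_commute)
        then show "uminus ` ball (complex_of_real x) ?r \<subseteq> ball (of_real (- x)) ?r" by auto
      qed
      moreover have "f y = Re (?g (of_real y))" if "\<bar>y - x\<bar> < ?r" for y
        using that f(3)[of y] by auto
      ultimately show "\<exists>r>0. \<exists>g. g holomorphic_on ball (of_real x) r \<and> (\<forall>y. \<bar>y - x\<bar> < r \<longrightarrow> f y = Re (g (of_real y)))"
        using x by (intro exI[of _ ?r] conjI exI[of _ ?g]) auto
    qed
  next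
    fix x :: real assume x: "x \<in> {0<..<1}"
    then show "complex_of_real (f x) = Gamma (z * z' + 1) / (Gamma (z + 1) * Gamma (z' + 1))
        * complex_of_real (1 - x) powr (z * z' - z - z') * pairing (- z) (- z') (z * z' - 2) (Psi z z' (z * z') x)"
      using f(2)[of x] dens_pairing[of x z z' "z * z'"] by simp
  next
    fix x :: real assume x: "x \<in> {-1<..<0}"
    then have a: "\<bar>x\<bar> = - x" by simp
    show "complex_of_real (f x) = Gamma (z * z' + 1) / (Gamma (- z + 1) * Gamma (- z' + 1))
        * complex_of_real (1 - \<bar>x\<bar>) powr (z * z' + z + z') * pairing z z' (z * z' - 2) (Psi (- z) (- z') (z * z') \<bar>x\<bar>)"
    proof -
      have "- 1 < x" "x < 0" "0 < - x" "- x < 1" using x by auto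
      then show ?thesis unfolding a using f(3)[of x] dens_pairing[of "- x" "- z" "- z'" "z * z'"]
        by (simp only: minus_minus diff_minus_eq_add)
    qed
  qed (use f in auto)
qed

end
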